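(* Let $(X_n)_{n\ge1}$ be a sequence of exchangeable real random variables with directing random probability measure $p^*$, $(a_n)_{n\ge1}$ a sequence of real numbers and $(b_n)_{n\ge1}$ a sequence with $b_n>0$ for every $n$ and $b_n\to+\infty$. Put $c_n:=a_n/b_n$ and $T_n-c_n:=\frac{\sum_{i=1}^nX_i-a_n}{b_n}$. Suppose $(T_n-c_n)_{n\ge1}$ converges in law to a nondegenerate random variable $T$ with characteristic function $$( * )\qquad \int_{\mathbb{R}\times\mathbb{R}_+}\exp\Big\{it\gamma-\frac{t^2}{2}\sigma^2\Big\}\mu_{12}(d\gamma\,d\sigma^2)\qquad(t\in\mathbb{R})$$ for some probability measure $\mu_{12}$ on $\mathbb{R}\times\mathbb{R}_+$. Then, if $$( ** )\qquad n\big(p^*((-\infty,-\epsilon b_n])+p^*((\epsilon b_n,+\infty))\big)\to0\ \text{ in probability, for every }\epsilon>0,$$ one of the following two cases takes place. Either (A) $b_n=\sqrt{n}\,h(n)$ for every $n$, with $h$ a slowly varying function on $\mathbb{N}$; for some $\tau>0$, $m_n^*(\tau)-c_n\to\gamma_0$ in probability and $\sigma_n^*(\tau)^2\to\sigma^{*2}$ in law, where $\gamma_0$ is a real number and $\sigma^{*2}$ is a (finite) random variable with probability distribution $\rho_1\neq\delta_0$; and $\mu_{12}=\delta_{\gamma_0}\cdot\rho_1$; or (B) $b_n=n\,h(n)$ for every $n$, with $h$ a slowly varying function on $\mathbb{N}$; for some $\tau>0$, $m_n^*(\tau)-c_n\to\gamma^*$ in law and $\sigma_n^*(\tau)^2\to0$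 in probability, where $\gamma^*$ is a random variable with probability distribution $\rho_2\neq\delta_a$ for every $a\in\mathbb{R}$; and $\mu_{12}=\rho_2\cdot\delta_0$. Conversely, if the conditions in (A) (respectively, in (B)) on $b_n$, $m_n^*(\tau)-c_n$, $\sigma_n^*(\tau)^2$ hold together with $( ** )$, then $(T_n-c_n)_{n\ge1}$ converges in law to a nondegenerate random variable $T$ with characteristic function $( * )$ and $\mu_{12}=\delta_{\gamma_0}\cdot\rho_1$ (respectively, $\mu_{12}=\rho_2\cdot\delta_0$).
   Context: All random variables are defined on a probability space $(\Omega,\mathcal{F},P)$. The sequence $(X_n)_{n\ge1}$ is exchangeable if, for every $m\ge1$, the joint distribution of every finite subset of $m$ of the $X_n$'s depends only on $m$. By de Finetti's theorem there is a random probability measure $p^*$ on the Borel sets of $\mathbb{R}$ (the directing random measure) such that $P\{X_1\in A_1,\dots,X_n\in A_n\}=E(\prod_{k=1}^np^*(A_k))$ for all Borel $A_1,\dots,A_n$ and all $n$, i.e. the $X_n$ are conditionally i.i.d. with common distribution $p^*$ given $p^*$. $\mathbb{R}_+:=[0,+\infty)$, $\delta_x$ is the unit mass at $x$, and a dot denotes product of measures. For $\tau>0$, $$m_n^*(\tau):=\frac{n}{b_n}\int_{|x|<\tau b_n}x\,p^*(dx),\qquad \sigma_n^*(\tau)^2:=\frac{n}{b_n^2}\Big[\int_{|x|<\tau b_n}x^2p^*(dx)-\Big(\int_{|x|<\tau b_n}x\,p^*(dx)\Big)^2\Big].$$ A positive function $h$ on $\mathbb{N}$ is slowly varying if $h(mn)/h(n)\to1$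 as $n\to\infty$ for every $m\in\mathbb{N}$.
   Formalization: Since ( * ) does not determine μ₁₂ (N(0,1) arises from N(0,1)·δ₀ and from δ₀·δ₁), the direct part assumes ( * ) for some μ₁₂ and concludes that ( * ) holds with some, possibly different, μ₁₂ of the form in (A) or (B). *)

theory Defs
  imports "HOL-Probability.Probability"
begin

(* Sequences are indexed by the positive integers: the value at index 0 is never constrained. *)

(* All m-tuples with pairwise distinct (not necessarily increasing) indices have the same law. *)
definition exchangeable :: "'a measure \<Rightarrow> (nat \<Rightarrow> 'a \<Rightarrow> real) \<Rightarrow> bool" where
  "exchangeable M X \<longleftrightarrow>
     (\<forall>m\<ge>1. \<forall>f g :: nat \<Rightarrow> nat.
        inj_on f {1..m} \<and> f ` {1..m} \<subseteq> {1..} \<and> inj_on g {1..m} \<and> g ` {1..m} \<subseteq> {1..} \<longrightarrow>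
        distr M (\<Pi>\<^sub>M k\<in>{1..m}. borel) (\<lambda>\<omega>. \<lambda>k\<in>{1..m}. X (f k) \<omega>) =
        distr M (\<Pi>\<^sub>M k\<in>{1..m}. borel) (\<lambda>\<omega>. \<lambda>k\<in>{1..m}. X (g k) \<omega>))"

definition directing_measure ::
    "'a measure \<Rightarrow> (nat \<Rightarrow> 'a \<Rightarrow> real) \<Rightarrow> ('a \<Rightarrow> real measure) \<Rightarrow> bool" where
  "directing_measure M X p \<longleftrightarrow>
     p \<in> measurable M (prob_algebra borel) \<and>
     (\<forall>n\<ge>1. \<forall>A :: nat \<Rightarrow> real set. (\<forall>k\<in>{1..n}. A k \<in> sets borel) \<longrightarrow>
        measure M {\<omega>\<in>space M. \<forall>k\<in>{1..n}. X k \<omega> \<in> A k} =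
        (\<integral>\<omega>. (\<Prod>k=1..n. measure (p \<omega>) (A k)) \<partial>M))"

definition trunc_mean :: "('a \<Rightarrow> real measure) \<Rightarrow> (nat \<Rightarrow> real) \<Rightarrow> real \<Rightarrow> nat \<Rightarrow> 'a \<Rightarrow> real" where
  "trunc_mean p b \<tau> n \<omega> = real n / b n * (LINT x:{x. \<bar>x\<bar> < \<tau> * b n}|p \<omega>. x)"

definition trunc_var :: "('a \<Rightarrow> real measure) \<Rightarrow> (nat \<Rightarrow> real) \<Rightarrow> real \<Rightarrow> nat \<Rightarrow> 'a \<Rightarrow> real" where
  "trunc_var p b \<tau> n \<omega> = real n / (b n)\<^sup>2 *
     ((LINT x:{x. \<bar>x\<bar> < \<tau> * b n}|p \<omega>. x\<^sup>2) - (LINT x:{x. \<bar>x\<bar> < \<tau> * b n}|p \<omega>. x)\<^sup>2)"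

definition slowly_varying :: "(nat \<Rightarrow> real) \<Rightarrow> bool" where
  "slowly_varying h \<longleftrightarrow>
     (\<forall>n\<ge>1. h n > 0) \<and> (\<forall>m\<ge>1. (\<lambda>n. h (m * n) / h n) \<longlonglongrightarrow> 1)"

definition conv_in_prob :: "'a measure \<Rightarrow> (nat \<Rightarrow> 'a \<Rightarrow> real) \<Rightarrow> real \<Rightarrow> bool" where
  "conv_in_prob M Y c \<longleftrightarrow>
     (\<forall>\<epsilon>>0. (\<lambda>n. measure M {\<omega>\<in>space M. \<bar>Y n \<omega> - c\<bar> > \<epsilon>}) \<longlonglongrightarrow> 0)"

(* The limiting random variable is represented by its law. *)
definition conv_in_law :: "'a measure \<Rightarrow> (nat \<Rightarrow> 'a \<Rightarrow> real) \<Rightarrow> real measure \<Rightarrow> bool" where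
  "conv_in_law M Y \<nu> \<longleftrightarrow> real_distribution \<nu> \<and> weak_conv_m (\<lambda>n. distr M borel (Y n)) \<nu>"

definition nondegenerate :: "real measure \<Rightarrow> bool" where
  "nondegenerate \<nu> \<longleftrightarrow> (\<forall>a. \<nu> \<noteq> return borel a)"

(* Probability measures on R x [0,infinity) are represented as probability measures on
   R x R giving full mass to that half-plane; the second coordinate is the variance. *)
definition mixing_measure :: "(real \<times> real) measure \<Rightarrow> bool" where
  "mixing_measure \<mu> \<longleftrightarrow>
     prob_space \<mu> \<and> sets \<mu> = sets borel \<and> measure \<mu> (UNIV \<times> {0..}) = 1"

definition normal_mixture_char :: "(real \<times> real) measure \<Rightarrow> real \<Rightarrow> complex" where
  "normal_mixture_char \<mu> t =
     (CLINT (\<gamma>, s)|\<mu>. exp (\<i> * complex_of_real (t * \<gamma>) - complex_of_real (t\<^sup>2 / 2 * s)))"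

(* The normalised sums converge in law to a nondegenerate limit with law \<nu> whose
   characteristic function is the normal mixture given by \<mu>.  Pitfall: \<nu> does not determine
   \<mu>; the standard normal law arises both from N(0,1) x \<delta>_0 and from \<delta>_0 x \<delta>_1. *)
definition sums_conv_to_mixture ::
    "'a measure \<Rightarrow> (nat \<Rightarrow> 'a \<Rightarrow> real) \<Rightarrow> (nat \<Rightarrow> real) \<Rightarrow> (nat \<Rightarrow> real) \<Rightarrow>
     real measure \<Rightarrow> (real \<times> real) measure \<Rightarrow> bool" where
  "sums_conv_to_mixture M X a b \<nu> \<mu> \<longleftrightarrow>
     conv_in_law M (\<lambda>n \<omega>. ((\<Sum>i=1..n. X i \<omega>) - a n) / b n) \<nu> \<and> nondegenerate \<nu> \<and>
     mixing_measure \<mu> \<and> (\<forall>t. char \<nu> t = normal_mixture_char \<mu> t)"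

definition negligible_tails :: "'a measure \<Rightarrow> ('a \<Rightarrow> real measure) \<Rightarrow> (nat \<Rightarrow> real) \<Rightarrow> bool" where
  "negligible_tails M p b \<longleftrightarrow>
     (\<forall>\<epsilon>>0. conv_in_prob M
        (\<lambda>n \<omega>. real n * (measure (p \<omega>) {..- (\<epsilon> * b n)} + measure (p \<omega>) {\<epsilon> * b n<..})) 0)"

definition random_variance_case ::
    "'a measure \<Rightarrow> ('a \<Rightarrow> real measure) \<Rightarrow> (nat \<Rightarrow> real) \<Rightarrow> (nat \<Rightarrow> real) \<Rightarrow>
     real \<Rightarrow> real measure \<Rightarrow> bool" where
  "random_variance_case M p a b \<gamma>\<^sub>0 \<rho>\<^sub>1 \<longleftrightarrow>
     (\<exists>h. slowly_varying h \<and> (\<forall>n\<ge>1. b n = sqrt (real n) * h n)) \<and>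
     (\<exists>\<tau>>0. conv_in_prob M (\<lambda>n \<omega>. trunc_mean p b \<tau> n \<omega> - a n / b n) \<gamma>\<^sub>0 \<and>
             conv_in_law M (trunc_var p b \<tau>) \<rho>\<^sub>1) \<and>
     \<rho>\<^sub>1 \<noteq> return borel 0"

definition random_mean_case ::
    "'a measure \<Rightarrow> ('a \<Rightarrow> real measure) \<Rightarrow> (nat \<Rightarrow> real) \<Rightarrow> (nat \<Rightarrow> real) \<Rightarrow>
     real measure \<Rightarrow> bool" where
  "random_mean_case M p a b \<rho>\<^sub>2 \<longleftrightarrow>
     (\<exists>h. slowly_varying h \<and> (\<forall>n\<ge>1. b n = real n * h n)) \<and>
     (\<exists>\<tau>>0. conv_in_law M (\<lambda>n \<omega>. trunc_mean p b \<tau> n \<omega> - a n / b n) \<rho>\<^sub>2 \<and>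
             conv_in_prob M (trunc_var p b \<tau>) 0) \<and>
     nondegenerate \<rho>\<^sub>2"

end

theory Submission
  imports Defs
begin

text \<open>
Write $m_n$ for the truncated mean minus $c_n$, and $V_n$ for the truncated variance; both are
functions of the directing measure $p^*$.

Given $p^*$, the characteristic function of the normed sum at $t$ is $e^{-itc_n}\varphi(t/b_n)^n$, with
$\varphi$ the characteristic function of $p^*$. When $n\,p^*(|x| > \epsilon b_n)$ is small, this power
differs little from $\exp(i t m_n - t^2 V_n / 2)$, uniformly over all laws with such tails and however large
$V_n$ is (\<open>char_power_eq_normal_char_approx\<close>). Taking expectations, convergence in law of the normed
sums is equivalent to convergence of $E \exp(i t m_n - t^2 V_n / 2)$ for all $t$
(\<open>normed_sum_conv_in_law_iff\<close>). The two converse implications follow at once: convergence in law of one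
of $m_n$, $V_n$ together with convergence in probability of the other to a constant gives the limit
of this expectation.

For the direct implication, the form of the limit mixture alone does not suffice: a normal limit, for
instance, can come from a random mean and from a random variance at the same time. What excludes a
genuine mixture is that $m$ and $V$ move differently when the index changes. If the tails are negligible,
changing the truncation level is harmless, so that for indices $n, k$ of bounded ratio
\[ m_n \approx A\, m_k + d, \quad V_n \approx B\, V_k, \quad
   A = \frac{n b_k}{k b_n}, \quad B = A^2\,\frac{k}{n} , \]
with $d$ a constant and errors tending to 0 in probability. Hence passing to a larger index
reduces the variance relative to the squared spread of the mean by the factor $k/n$. Convergence to a
nondegenerate limit makes $m_n$ and $V_n$ bounded in probability, forces
$b_n/b_k$ to stay bounded (\<open>ratio_bounded\<close>), and prevents both parts from collapsing together.
If $V_k$ is once small at a large index, then $m_k$ carries the spread of the limit, $A$ is bounded, $B$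
is at most a constant times $k/n$, and the variance is still smaller later: it stays small and tends to 0. Otherwise $V_n$ stays
away from 0; then $B$ is bounded below, and reading the relation backwards expresses $m_k$ as a small
multiple of $m_n$ plus a constant, so that $m$ becomes deterministic (\<open>var_vanishes_or_persists\<close>,
\<open>mean_concentrates\<close>).

In the first case the limit law is that of the random mean, in the second it is a centred
variance mixture shifted by a constant. In both, comparing indices $n$ and $mn$ shows that the limit
characteristic function has modulus $g(t) = g(\kappa t)$ for every limit point $\kappa$ of $m b_n/b_{mn}$,
respectively $\sqrt m\, b_n/b_{mn}$. As $g$ is not constant, $\kappa = 1$ (\<open>scale_ratio_tendsto_1\<close>); this is
the slow variation of $b_n/n$, respectively $b_n/\sqrt n$. In the second case the law of the variance is
recovered from its Laplace transform $t \mapsto g(t)$ at $t^2/2$.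
\<close>

section \<open>Characteristic functions of conditionally independent sums\<close>

text \<open>
The measurability makes the mixture over $\omega$ of the product laws available as a monadic bind.
It is enough to test on boxes, where the mass is a finite product of masses under $p(\omega)$.
\<close>

lemma measurable_iid_product:
  fixes p :: "'a \<Rightarrow> real measure" and I :: "nat set"
  assumes p: "p \<in> M \<rightarrow>\<^sub>M prob_algebra borel" and I: "finite I"
  shows "(\<lambda>\<omega>. Pi\<^sub>M I (\<lambda>_. p \<omega>)) \<in> M \<rightarrow>\<^sub>M prob_algebra (Pi\<^sub>M I (\<lambda>_. borel))"
proof -
  have pr: "prob_space (p \<omega>)" and sets_p: "sets (p \<omega>) = sets borel" if "\<omega> \<in> space M" for \<omega>
    using measurable_space[OF p that] by (auto simp: space_prob_algebra)
  have [measurable]: "p \<in> M \<rightarrow>\<^sub>M subprob_algebra borel"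
    using p by (rule measurable_prob_algebraD)
  let ?G = "prod_algebra I (\<lambda>_. borel :: real measure)"
  show ?thesis
  proof (rule measurable_prob_algebra_generated[where \<Omega> = "\<Pi>\<^sub>E i\<in>I. space (borel :: real measure)" and G = ?G])
    show "sets (Pi\<^sub>M I (\<lambda>_. borel :: real measure)) = sigma_sets (\<Pi>\<^sub>E i\<in>I. space borel) ?G"
      by (rule sets_PiM)
    show "Int_stable ?G" by (rule Int_stable_prod_algebra)
    show "?G \<subseteq> Pow (\<Pi>\<^sub>E i\<in>I. space borel)" by (rule prod_algebra_sets_into_space)
    show "prob_space (Pi\<^sub>M I (\<lambda>_. p \<omega>))" if "\<omega> \<in> space M" for \<omega>
      using pr[OF that] by (intro prob_space_PiM)
    show "sets (Pi\<^sub>M I (\<lambda>_. p \<omega>)) = sets (Pi\<^sub>M I (\<lambda>_. borel))" if "\<omega> \<in> space M" for \<omega>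
      using sets_p[OF that] by (intro sets_PiM_cong) auto
    fix A assume "A \<in> ?G"
    then obtain B where A: "A = (\<Pi>\<^sub>E i\<in>I. B i)" and B: "\<And>i. i \<in> I \<Longrightarrow> B i \<in> sets (borel :: real measure)"
      using I by (auto simp: prod_algebra_eq_finite)
    have "emeasure (Pi\<^sub>M I (\<lambda>_. p \<omega>)) A = (\<Prod>i\<in>I. emeasure (p \<omega>) (B i))" if "\<omega> \<in> space M" for \<omega>
    proof -
      interpret prob_space "p \<omega>" by (rule pr[OF that])
      interpret product_sigma_finite "\<lambda>_. p \<omega>" by standard
      show ?thesis unfolding A using B sets_p[OF that] by (intro emeasure_PiM I) auto
    qed
    moreover have "(\<lambda>\<omega>. \<Prod>i\<in>I. emeasure (p \<omega>) (B i)) \<in> borel_measurable M"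
      using B by measurable
    ultimately show "(\<lambda>\<omega>. emeasure (Pi\<^sub>M I (\<lambda>_. p \<omega>)) A) \<in> borel_measurable M"
      by (subst measurable_cong)
  qed
qed

text \<open>
The defining identity of the directing measure is this equality evaluated on boxes, and boxes determine a
law on a finite product.
\<close>

lemma joint_law_eq_mixture_of_products:
  fixes X :: "nat \<Rightarrow> 'a \<Rightarrow> real"
  assumes "prob_space M" and X: "\<And>n. n \<ge> 1 \<Longrightarrow> X n \<in> borel_measurable M"
    and dir: "directing_measure M X p" and n: "n \<ge> 1"
  shows "distr M (\<Pi>\<^sub>M k\<in>{1..n}. borel) (\<lambda>\<omega>. \<lambda>k\<in>{1..n}. X k \<omega>) = M \<bind> (\<lambda>\<omega>. Pi\<^sub>M {1..n} (\<lambda>_. p \<omega>))"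
    (is "?P = ?Q")
proof -
  interpret prob_space M by fact
  let ?I = "{1..n}" and ?N = "\<Pi>\<^sub>M k\<in>{1..n}. borel :: real measure"
  have p: "p \<in> M \<rightarrow>\<^sub>M prob_algebra borel" using dir by (simp add: directing_measure_def)
  have pr: "prob_space (p \<omega>)" and sets_p: "sets (p \<omega>) = sets borel" if "\<omega> \<in> space M" for \<omega>
    using measurable_space[OF p that] by (auto simp: space_prob_algebra)
  have K: "(\<lambda>\<omega>. Pi\<^sub>M ?I (\<lambda>_. p \<omega>)) \<in> M \<rightarrow>\<^sub>M subprob_algebra ?N"
    by (intro measurable_prob_algebraD measurable_iid_product p) simp
  have [measurable]: "p \<in> M \<rightarrow>\<^sub>M subprob_algebra borel"
    using p by (rule measurable_prob_algebraD)
  have Xm: "(\<lambda>\<omega>. \<lambda>k\<in>?I. X k \<omega>) \<in> M \<rightarrow>\<^sub>M ?N"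
    using X by (intro measurable_restrict) auto
  show ?thesis
  proof (rule measure_eqI_PiM_finite)
    show "finite ?I" "sets ?P = sets ?N" by simp_all
    show "sets ?Q = sets ?N" by (rule sets_bind[OF sets_kernel[OF K] not_empty])
    show "range (\<lambda>i::nat. \<Pi>\<^sub>E i\<in>?I. UNIV :: real set) \<subseteq> prod_algebra ?I (\<lambda>_. borel)"
      by (auto intro!: prod_algebraI_finite)
    show "(\<Union>i::nat. \<Pi>\<^sub>E i\<in>?I. UNIV) = space ?N" by (simp add: space_PiM)
    show "emeasure ?P (\<Pi>\<^sub>E i\<in>?I. UNIV :: real set) \<noteq> \<infinity>" for i :: nat
      using prob_space_distr[OF Xm] prob_space.emeasure_le_1 by (metis ennreal_one_less_top infinity_ennreal_def le_less_trans less_irrefl)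
    fix A :: "nat \<Rightarrow> real set" assume A: "\<And>i. i \<in> ?I \<Longrightarrow> A i \<in> sets borel"
    have "emeasure ?P (Pi\<^sub>E ?I A) = emeasure M {\<omega>\<in>space M. \<forall>k\<in>?I. X k \<omega> \<in> A k}"
      using A by (subst emeasure_distr[OF Xm]) (auto simp: Pi_iff intro!: arg_cong[where f = "emeasure M"] sets_PiM_I_finite)
    also have "\<dots> = ennreal (\<integral>\<omega>. (\<Prod>k=1..n. measure (p \<omega>) (A k)) \<partial>M)"
      using dir n A by (simp add: directing_measure_def emeasure_eq_measure)
    also have "\<dots> = (\<integral>\<^sup>+\<omega>. ennreal (\<Prod>k=1..n. measure (p \<omega>) (A k)) \<partial>M)"
    proof (rule nn_integral_eq_integral[symmetric])
      have "(\<lambda>\<omega>. \<Prod>k=1..n. measure (p \<omega>) (A k)) \<in> borel_measurable M"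
        using A by measurable
      then show "integrable M (\<lambda>\<omega>. \<Prod>k=1..n. measure (p \<omega>) (A k))"
        by (rule integrable_const_bound[where B = 1, rotated])
           (auto simp: abs_prod intro!: prod_le_1 prob_space.prob_le_1 pr AE_I2)
    qed (auto intro!: prod_nonneg)
    also have "\<dots> = (\<integral>\<^sup>+\<omega>. emeasure (Pi\<^sub>M ?I (\<lambda>_. p \<omega>)) (Pi\<^sub>E ?I A) \<partial>M)"
    proof (rule nn_integral_cong)
      fix \<omega> assume \<omega>: "\<omega> \<in> space M"
      interpret p: prob_space "p \<omega>" by (rule pr[OF \<omega>])
      interpret product_sigma_finite "\<lambda>_. p \<omega>" by standard
      show "ennreal (\<Prod>k=1..n. measure (p \<omega>) (A k)) = emeasure (Pi\<^sub>M ?I (\<lambda>_. p \<omega>)) (Pi\<^sub>E ?I A)"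
        using A sets_p[OF \<omega>]
        by (subst emeasure_PiM) (auto simp: p.emeasure_eq_measure prod_ennreal)
    qed
    also have "\<dots> = emeasure ?Q (Pi\<^sub>E ?I A)"
      using A by (subst emeasure_bind[OF _ K]) (auto simp: not_empty intro!: sets_PiM_I_finite)
    finally show "emeasure ?P (Pi\<^sub>E ?I A) = emeasure ?Q (Pi\<^sub>E ?I A)" .
  qed
qed

text \<open>
Under each product law the exponential of the sum factorises. Real and imaginary parts are integrated
separately, because integration against a bind is stated for real functions.
\<close>

lemma char_sum_eq_expectation_power:
  fixes X :: "nat \<Rightarrow> 'a \<Rightarrow> real"
  assumes "prob_space M" and X: "\<And>n. n \<ge> 1 \<Longrightarrow> X n \<in> borel_measurable M"
    and dir: "directing_measure M X p" and n: "n \<ge> 1"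
  shows "(CLINT \<omega>|M. iexp (s * (\<Sum>i=1..n. X i \<omega>))) = (CLINT \<omega>|M. (char (p \<omega>) s) ^ n)"
proof -
  interpret prob_space M by fact
  let ?I = "{1..n}" and ?N = "\<Pi>\<^sub>M k\<in>{1..n}. borel :: real measure"
  let ?f = "\<lambda>x::nat \<Rightarrow> real. iexp (s * (\<Sum>i=1..n. x i))"
  have p: "p \<in> M \<rightarrow>\<^sub>M prob_algebra borel" using dir by (simp add: directing_measure_def)
  have pr: "prob_space (p \<omega>)" and sets_p: "sets (p \<omega>) = sets borel" if "\<omega> \<in> space M" for \<omega>
    using measurable_space[OF p that] by (auto simp: space_prob_algebra)
  have K: "(\<lambda>\<omega>. Pi\<^sub>M ?I (\<lambda>_. p \<omega>)) \<in> M \<rightarrow>\<^sub>M prob_algebra ?N"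
    by (intro measurable_iid_product p) simp
  have K': "(\<lambda>\<omega>. Pi\<^sub>M ?I (\<lambda>_. p \<omega>)) \<in> M \<rightarrow>\<^sub>M subprob_algebra ?N"
    by (intro measurable_prob_algebraD K)
  have Kpr: "prob_space (Pi\<^sub>M ?I (\<lambda>_. p \<omega>))" if "\<omega> \<in> space M" for \<omega>
    using pr[OF that] by (intro prob_space_PiM)
  have Xm: "(\<lambda>\<omega>. \<lambda>k\<in>?I. X k \<omega>) \<in> M \<rightarrow>\<^sub>M ?N"
    using X by (intro measurable_restrict) auto
  have fm[measurable]: "?f \<in> borel_measurable ?N" by measurable
  have fm': "?f \<in> borel_measurable (Pi\<^sub>M ?I (\<lambda>_. p \<omega>))" if "\<omega> \<in> space M" for \<omega>
    using fm sets_kernel[OF K' that] measurable_cong_sets by blast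
  have fint: "integrable (Pi\<^sub>M ?I (\<lambda>_. p \<omega>)) ?f" if "\<omega> \<in> space M" for \<omega>
  proof -
    interpret K: prob_space "Pi\<^sub>M ?I (\<lambda>_. p \<omega>)" by (rule Kpr[OF that])
    show ?thesis using fm'[OF that] by (intro K.integrable_const_bound[where B = 1]) auto
  qed
  have Kmeas: "(\<lambda>\<omega>. integral\<^sup>L (Pi\<^sub>M ?I (\<lambda>_. p \<omega>)) ?f) \<in> borel_measurable M"
    by (rule measurable_compose[OF K' integral_measurable_subprob_algebra[OF fm]])
  interpret D: prob_space "M \<bind> (\<lambda>\<omega>. Pi\<^sub>M ?I (\<lambda>_. p \<omega>))"
    by (rule prob_space_bind[OF AE_I2[OF Kpr] K'])
  have sets_bind: "sets (M \<bind> (\<lambda>\<omega>. Pi\<^sub>M ?I (\<lambda>_. p \<omega>))) = sets ?N"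
    by (rule sets_bind[OF sets_kernel[OF K'] not_empty])
  have fbind: "integrable (M \<bind> (\<lambda>\<omega>. Pi\<^sub>M ?I (\<lambda>_. p \<omega>))) ?f"
    using fm by (intro D.integrable_const_bound[where B = 1])
      (auto simp only: measurable_cong_sets[OF sets_bind refl] norm_exp_i_times of_real_mult[symmetric] intro!: AE_I2)
  have Kint: "integrable M (\<lambda>\<omega>. integral\<^sup>L (Pi\<^sub>M ?I (\<lambda>_. p \<omega>)) ?f)"
  proof (rule integrable_const_bound[where B = 1, OF _ Kmeas], rule AE_I2)
    fix \<omega> assume \<omega>: "\<omega> \<in> space M"
    interpret K: prob_space "Pi\<^sub>M ?I (\<lambda>_. p \<omega>)" by (rule Kpr[OF \<omega>])
    have "norm (integral\<^sup>L (Pi\<^sub>M ?I (\<lambda>_. p \<omega>)) ?f) \<le> (\<integral>x. norm (?f x) \<partial>Pi\<^sub>M ?I (\<lambda>_. p \<omega>))"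
      by (rule integral_norm_bound)
    then show "norm (integral\<^sup>L (Pi\<^sub>M ?I (\<lambda>_. p \<omega>)) ?f) \<le> 1" using K.prob_space by simp
  qed
  have bnd: "AE x in M. emeasure (Pi\<^sub>M ?I (\<lambda>_. p x)) (space (Pi\<^sub>M ?I (\<lambda>_. p x))) \<le> ennreal 1"
    using Kpr by (intro AE_I2) (simp add: prob_space.emeasure_space_1)
  have part: "(\<integral>x. g (?f x) \<partial>(M \<bind> (\<lambda>\<omega>. Pi\<^sub>M ?I (\<lambda>_. p \<omega>)))) = (\<integral>\<omega>. (\<integral>x. g (?f x) \<partial>Pi\<^sub>M ?I (\<lambda>_. p \<omega>)) \<partial>M)"
    if g: "g = Re \<or> g = Im" for g
  proof (rule integral_bind[where K = ?N and B = 1 and B' = 1])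
    show "(\<lambda>x. g (?f x)) \<in> borel_measurable ?N" using g fm by auto
    show "\<bar>g (?f x)\<bar> \<le> 1" for x
      using g abs_Re_le_cmod[of "?f x"] abs_Im_le_cmod[of "?f x"] by auto
  qed (use K' bnd finite_measure_axioms in auto)
  have "(CLINT \<omega>|M. ?f (\<lambda>k. X k \<omega>)) = (CLINT \<omega>|M. ?f (\<lambda>k\<in>?I. X k \<omega>))" by simp
  also have "\<dots> = integral\<^sup>L (distr M ?N (\<lambda>\<omega>. \<lambda>k\<in>?I. X k \<omega>)) ?f"
    by (rule integral_distr[OF Xm fm, symmetric])
  also have "distr M ?N (\<lambda>\<omega>. \<lambda>k\<in>?I. X k \<omega>) = M \<bind> (\<lambda>\<omega>. Pi\<^sub>M ?I (\<lambda>_. p \<omega>))"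
    by (rule joint_law_eq_mixture_of_products[OF assms])
  also have "integral\<^sup>L (M \<bind> (\<lambda>\<omega>. Pi\<^sub>M ?I (\<lambda>_. p \<omega>))) ?f = (CLINT \<omega>|M. integral\<^sup>L (Pi\<^sub>M ?I (\<lambda>_. p \<omega>)) ?f)"
  proof (rule complex_eqI)
    let ?B = "M \<bind> (\<lambda>\<omega>. Pi\<^sub>M ?I (\<lambda>_. p \<omega>))" and ?g = "\<lambda>\<omega>. integral\<^sup>L (Pi\<^sub>M ?I (\<lambda>_. p \<omega>)) ?f"
    have "Re (integral\<^sup>L ?B ?f) = (\<integral>x. Re (?f x) \<partial>?B)" by (rule integral_Re[OF fbind, symmetric])
    also have "\<dots> = (\<integral>\<omega>. (\<integral>x. Re (?f x) \<partial>Pi\<^sub>M ?I (\<lambda>_. p \<omega>)) \<partial>M)" by (rule part) simp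
    also have "\<dots> = (\<integral>\<omega>. Re (?g \<omega>) \<partial>M)"
      by (rule Bochner_Integration.integral_cong[OF refl integral_Re[OF fint]])
    also have "\<dots> = Re (CLINT \<omega>|M. ?g \<omega>)" by (rule integral_Re[OF Kint])
    finally show "Re (integral\<^sup>L ?B ?f) = Re (CLINT \<omega>|M. ?g \<omega>)" .
    have "Im (integral\<^sup>L ?B ?f) = (\<integral>x. Im (?f x) \<partial>?B)" by (rule integral_Im[OF fbind, symmetric])
    also have "\<dots> = (\<integral>\<omega>. (\<integral>x. Im (?f x) \<partial>Pi\<^sub>M ?I (\<lambda>_. p \<omega>)) \<partial>M)" by (rule part) simp
    also have "\<dots> = (\<integral>\<omega>. Im (?g \<omega>) \<partial>M)"
      by (rule Bochner_Integration.integral_cong[OF refl integral_Im[OF fint]])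
    also have "\<dots> = Im (CLINT \<omega>|M. ?g \<omega>)" by (rule integral_Im[OF Kint])
    finally show "Im (integral\<^sup>L ?B ?f) = Im (CLINT \<omega>|M. ?g \<omega>)" .
  qed
  also have "\<dots> = (CLINT \<omega>|M. (char (p \<omega>) s) ^ n)"
  proof (rule Bochner_Integration.integral_cong[OF refl])
    fix \<omega> assume \<omega>: "\<omega> \<in> space M"
    interpret p: prob_space "p \<omega>" by (rule pr[OF \<omega>])
    interpret product_sigma_finite "\<lambda>_. p \<omega>" by standard
    have "?f = (\<lambda>x. \<Prod>k\<in>?I. iexp (s * x k))"
      by (simp add: fun_eq_iff exp_sum[symmetric] sum_distrib_left)
    then have "integral\<^sup>L (Pi\<^sub>M ?I (\<lambda>_. p \<omega>)) ?f = integral\<^sup>L (Pi\<^sub>M ?I (\<lambda>_. p \<omega>)) (\<lambda>x. \<Prod>k\<in>?I. iexp (s * x k))"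
      by metis
    also have "\<dots> = (\<Prod>k\<in>?I. CLINT x|p \<omega>. iexp (s * x))"
    proof (rule product_integral_prod)
      have "(\<lambda>x. iexp (s * x)) \<in> borel_measurable (p \<omega>)"
        unfolding measurable_cong_sets[OF sets_p[OF \<omega>] refl] by measurable
      then show "integrable (p \<omega>) (\<lambda>x. iexp (s * x))"
        by (intro p.integrable_const_bound[where B = 1]) auto
    qed simp
    finally show "integral\<^sup>L (Pi\<^sub>M ?I (\<lambda>_. p \<omega>)) ?f = (char (p \<omega>) s) ^ n"
      by (simp add: char_def)
  qed
  finally show ?thesis by simp
qed

section \<open>Normal approximation for a law with small tails\<close>

text \<open>
A second-order Taylor estimate whose error is proportional to the variance up to a tail term: where
$|Y| \le \epsilon$, the centred variable is at most $2\epsilon + \tau q$ in modulus, so its cube is at most that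
multiple of its square. The variance on the right-hand side is what later allows summands whose total variance is large.
\<close>

lemma (in prob_space) char_centred_bounded_approx:
  assumes Y[measurable]: "Y \<in> borel_measurable M" and bnd: "\<And>x. \<bar>Y x\<bar> \<le> \<tau>" and \<epsilon>: "\<epsilon> > 0"
  defines "m \<equiv> expectation Y" and "q \<equiv> prob {x\<in>space M. \<bar>Y x\<bar> > \<epsilon>}"
  shows "cmod (char (distr M borel (\<lambda>x. Y x - m)) t - (1 - t\<^sup>2 * (expectation (\<lambda>x. (Y x)\<^sup>2) - m\<^sup>2) / 2))
    \<le> \<bar>t\<bar>^3 * (2 * \<epsilon> + \<tau> * q) * (expectation (\<lambda>x. (Y x)\<^sup>2) - m\<^sup>2) / 6 + 4 * t\<^sup>2 * \<tau>\<^sup>2 * q"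
    and "expectation (\<lambda>x. (Y x)\<^sup>2) - m\<^sup>2 \<le> \<epsilon>\<^sup>2 + \<tau>\<^sup>2 * q"
    and "0 \<le> expectation (\<lambda>x. (Y x)\<^sup>2) - m\<^sup>2"
proof -
  let ?T = "{x\<in>space M. \<bar>Y x\<bar> > \<epsilon>}"
  have \<tau>0: "\<tau> \<ge> 0" using bnd[of undefined] by linarith
  have T: "?T \<in> events" by measurable
  have iY[simp]: "integrable M Y" using bnd by (intro integrable_const_bound[where B = \<tau>]) auto
  have Y2: "(Y x)\<^sup>2 \<le> \<tau>\<^sup>2" for x using power_mono[OF bnd[of x], of 2] by simp
  have iY2[simp]: "integrable M (\<lambda>x. (Y x)\<^sup>2)" using Y2 by (intro integrable_const_bound[where B = "\<tau>\<^sup>2"]) auto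
  have iT[simp]: "integrable M (indicator ?T :: _ \<Rightarrow> real)" using T by (intro integrable_real_indicator) (auto simp: less_top[symmetric])
  have ET: "expectation (indicator ?T) = q" unfolding q_def using T by (simp add: Int_absorb1)
  define X where "X x = Y x - m" for x
  have Xm[measurable]: "X \<in> borel_measurable M" unfolding X_def by measurable
  have X2: "(X x)\<^sup>2 = (Y x)\<^sup>2 - 2 * m * Y x + m\<^sup>2" for x unfolding X_def by (simp add: power2_diff)
  have iX2[simp]: "integrable M (\<lambda>x. (X x)\<^sup>2)" unfolding X2 by simp
  have EX2: "expectation (\<lambda>x. (X x)\<^sup>2) = expectation (\<lambda>x. (Y x)\<^sup>2) - m\<^sup>2"
  proof -
    have "expectation (\<lambda>x. (X x)\<^sup>2) = expectation (\<lambda>x. (Y x)\<^sup>2) - 2 * m * expectation Y + m\<^sup>2"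
      unfolding X2 by (simp add: prob_space)
    then show ?thesis by (simp add: m_def[symmetric] power2_eq_square)
  qed
  have EX: "expectation X = 0" unfolding X_def by (simp add: m_def prob_space)
  have var: "variance X = expectation (\<lambda>x. (Y x)\<^sup>2) - m\<^sup>2" unfolding EX using EX2 by simp
  show v0: "0 \<le> expectation (\<lambda>x. (Y x)\<^sup>2) - m\<^sup>2" unfolding EX2[symmetric] by simp
  have split: "\<bar>Y x\<bar> \<le> \<epsilon> + \<tau> * indicator ?T x" if "x \<in> space M" for x
    using bnd[of x] \<epsilon> that by (auto simp: indicator_def)
  have "\<bar>m\<bar> \<le> expectation (\<lambda>x. \<bar>Y x\<bar>)" unfolding m_def by (rule integral_abs_bound)
  also have "\<dots> \<le> expectation (\<lambda>x. \<epsilon> + \<tau> * indicator ?T x)" using split by (intro integral_mono) auto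
  also have "\<dots> = \<epsilon> + \<tau> * q" by (simp add: prob_space q_def)
  finally have m_le: "\<bar>m\<bar> \<le> \<epsilon> + \<tau> * q" .
  have "\<bar>m\<bar> \<le> expectation (\<lambda>x. \<bar>Y x\<bar>)" unfolding m_def by (rule integral_abs_bound)
  also have "\<dots> \<le> expectation (\<lambda>x. \<tau>)" using bnd by (intro integral_mono) auto
  finally have m_le2: "\<bar>m\<bar> \<le> \<tau>" by (simp add: prob_space)
  have "expectation (\<lambda>x. (Y x)\<^sup>2) \<le> expectation (\<lambda>x. \<epsilon>\<^sup>2 + \<tau>\<^sup>2 * indicator ?T x)"
  proof (rule integral_mono)
    fix x assume "x \<in> space M"
    then show "(Y x)\<^sup>2 \<le> \<epsilon>\<^sup>2 + \<tau>\<^sup>2 * indicator ?T x"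
      using Y2[of x] power_mono[of "\<bar>Y x\<bar>" \<epsilon> 2] by (cases "\<bar>Y x\<bar> > \<epsilon>") (auto simp: add_increasing)
  qed auto
  also have "\<dots> = \<epsilon>\<^sup>2 + \<tau>\<^sup>2 * q" by (simp add: prob_space q_def)
  finally show "expectation (\<lambda>x. (Y x)\<^sup>2) - m\<^sup>2 \<le> \<epsilon>\<^sup>2 + \<tau>\<^sup>2 * q" using zero_le_power2[of m] by linarith
  let ?\<eta> = "2 * \<epsilon> + \<tau> * q"
  have "cmod (char (distr M borel X) t - (1 - t\<^sup>2 * (expectation (\<lambda>x. (Y x)\<^sup>2) - m\<^sup>2) / 2))
    \<le> (t\<^sup>2 / 6) * expectation (\<lambda>x. min (6 * (X x)\<^sup>2) (\<bar>t\<bar> * \<bar>X x\<bar>^3))"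
    by (rule char_approx3'[OF Xm _ iX2 EX var refl]) (simp add: X_def[abs_def])
  also have "\<dots> \<le> (t\<^sup>2 / 6) * expectation (\<lambda>x. \<bar>t\<bar> * ?\<eta> * (X x)\<^sup>2 + 24 * \<tau>\<^sup>2 * indicator ?T x)"
  proof (intro mult_left_mono integral_mono)
    show "integrable M (\<lambda>x. min (6 * (X x)\<^sup>2) (\<bar>t\<bar> * \<bar>X x\<bar> ^ 3))"
      by (rule Bochner_Integration.integrable_bound[where f = "\<lambda>x. 6 * (X x)\<^sup>2"]) auto
    fix x assume x: "x \<in> space M"
    show "min (6 * (X x)\<^sup>2) (\<bar>t\<bar> * \<bar>X x\<bar> ^ 3) \<le> \<bar>t\<bar> * ?\<eta> * (X x)\<^sup>2 + 24 * \<tau>\<^sup>2 * indicator ?T x"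
    proof (cases "\<bar>Y x\<bar> > \<epsilon>")
      case True
      have "\<bar>X x\<bar> \<le> 2 * \<tau>" using bnd[of x] m_le2 unfolding X_def by linarith
      from power_mono[OF this, of 2] have "6 * (X x)\<^sup>2 \<le> 24 * \<tau>\<^sup>2" by (simp add: power_mult_distrib)
      moreover have "0 \<le> \<bar>t\<bar> * ?\<eta> * (X x)\<^sup>2" using \<epsilon> \<tau>0 by (simp add: q_def)
      ultimately show ?thesis using True x by simp
    next
      case False
      then have "\<bar>X x\<bar> \<le> ?\<eta>" using m_le unfolding X_def by linarith
      then have "\<bar>X x\<bar> * \<bar>X x\<bar>\<^sup>2 \<le> ?\<eta> * \<bar>X x\<bar>\<^sup>2" by (rule mult_right_mono) simp
      also have "\<bar>X x\<bar> * \<bar>X x\<bar>\<^sup>2 = \<bar>X x\<bar> ^ 3" by (simp add: numeral_3_eq_3 numeral_2_eq_2)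
      finally have "\<bar>X x\<bar> ^ 3 \<le> ?\<eta> * (X x)\<^sup>2" by simp
      then have "\<bar>t\<bar> * \<bar>X x\<bar> ^ 3 \<le> \<bar>t\<bar> * ?\<eta> * (X x)\<^sup>2" by (simp add: mult.assoc mult_left_mono)
      then show ?thesis using False by simp
    qed
  qed auto
  also have "expectation (\<lambda>x. \<bar>t\<bar> * ?\<eta> * (X x)\<^sup>2 + 24 * \<tau>\<^sup>2 * indicator ?T x)
     = \<bar>t\<bar> * ?\<eta> * (expectation (\<lambda>x. (Y x)\<^sup>2) - m\<^sup>2) + 24 * \<tau>\<^sup>2 * q"
    by (simp add: EX2 q_def)
  also have "(t\<^sup>2 / 6) * \<dots> = \<bar>t\<bar>^3 * ?\<eta> * (expectation (\<lambda>x. (Y x)\<^sup>2) - m\<^sup>2) / 6 + 4 * t\<^sup>2 * \<tau>\<^sup>2 * q"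
    by (simp add: field_simps power3_eq_cube power2_eq_square)
  finally show "cmod (char (distr M borel (\<lambda>x. Y x - m)) t - (1 - t\<^sup>2 * (expectation (\<lambda>x. (Y x)\<^sup>2) - m\<^sup>2) / 2))
    \<le> \<bar>t\<bar>^3 * ?\<eta> * (expectation (\<lambda>x. (Y x)\<^sup>2) - m\<^sup>2) / 6 + 4 * t\<^sup>2 * \<tau>\<^sup>2 * q"
    unfolding X_def .
qed

lemma norm_power_diff_scaled:
  fixes z w :: complex
  assumes "cmod z \<le> R" "cmod w \<le> R" "R > 0" "n \<ge> 1"
  shows "cmod (z ^ n - w ^ n) \<le> real n * R ^ (n - 1) * cmod (z - w)"
proof -
  have *: "z ^ n - w ^ n = R ^ n * ((z / R) ^ n - (w / R) ^ n)"
    using assms(3) by (simp add: power_divide field_simps)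
  have "cmod ((z / R) ^ n - (w / R) ^ n) \<le> n * cmod (z / R - w / R)"
    using assms by (intro norm_power_diff) (auto simp: norm_divide)
  also have "z / R - w / R = (z - w) / R" by (simp add: diff_divide_distrib)
  finally have "cmod (z ^ n - w ^ n) \<le> R ^ n * (n * (cmod (z - w) / R))"
    unfolding * norm_mult using assms(3) by (intro mult_mono) (auto simp: norm_divide norm_power)
  also have "\<dots> = real n * R ^ (n - 1) * cmod (z - w)"
    using assms(3,4) by (cases n) auto
  finally show ?thesis .
qed

text \<open>
The bound must not deteriorate as $n x$ grows. Both bases are at most $e^{\beta - x/2}$ in modulus, so the factor
$n x$ that the difference of $n$th powers produces is absorbed by $e^{-(n-1)x/2}$.
\<close>

lemma power_vs_exp_power:
  fixes z :: complex and x \<alpha> \<beta> :: real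
  assumes z: "cmod (z - (1 - x)) \<le> \<alpha> * x + \<beta>" and x: "0 \<le> x" "x \<le> 1" and \<alpha>: "0 \<le> \<alpha>" "\<alpha> \<le> 1 / 4"
    and \<beta>: "0 \<le> \<beta>" and n: "n \<ge> 1"
  shows "cmod (z ^ n - exp (- x) ^ n) \<le> exp (real n * \<beta>) * (4 * \<alpha> + 4 * x + real n * \<beta>)"
proof -
  let ?R = "exp (\<beta> - x / 2)"
  have "cmod z \<le> cmod (1 - x :: complex) + cmod (z - (1 - x))"
    using norm_triangle_ineq[of "1 - x" "z - (1 - x)"] by simp
  also have "cmod (1 - x :: complex) = 1 - x" using x by (metis abs_of_nonneg diff_ge_0_iff_ge norm_of_real of_real_1 of_real_diff)
  also have "1 - x + cmod (z - (1 - x)) \<le> 1 - x + (1 / 4) * x + \<beta>"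
    using z mult_right_mono[OF \<alpha>(2) x(1)] by linarith
  also have "\<dots> \<le> 1 + (\<beta> - x / 2)" using x by simp
  also have "\<dots> \<le> ?R" by (rule exp_ge_add_one_self)
  finally have zR: "cmod z \<le> ?R" .
  have wR: "cmod (exp (- x) :: complex) \<le> ?R" using x \<beta> by simp
  have ex: "\<bar>exp (- x) - (1 - x)\<bar> \<le> x\<^sup>2"
  proof -
    have "1 - x \<le> exp (- x)" using exp_ge_add_one_self[of "- x"] by simp
    moreover have "exp (- x) \<le> 1 - x + x\<^sup>2"
    proof -
      have "exp (- x) \<le> 1 / (1 + x)"
        using exp_ge_add_one_self[of x] x by (simp add: exp_minus field_simps)
      also have "\<dots> \<le> 1 - x + x\<^sup>2"
      proof -
        have "(1 - x + x\<^sup>2) * (1 + x) = 1 + x ^ 3" by (simp add: algebra_simps power2_eq_square power3_eq_cube)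
        then show ?thesis using x by (simp add: divide_le_eq)
      qed
      finally show ?thesis .
    qed
    ultimately show ?thesis by simp
  qed
  have "cmod (z - exp (- x)) \<le> cmod (z - (1 - x)) + cmod ((1 - x) - exp (- x) :: complex)"
    using norm_triangle_ineq[of "z - (1 - x)" "(1 - x) - exp (- x) :: complex"] by simp
  also have "cmod ((1 - x) - exp (- x) :: complex) = \<bar>exp (- x) - (1 - x)\<bar>"
    by (metis abs_minus_commute norm_of_real of_real_1 of_real_diff)
  finally have zw: "cmod (z - exp (- x)) \<le> (\<alpha> + x) * x + \<beta>"
    using z ex by (simp add: power2_eq_square algebra_simps)
  have "cmod (z ^ n - exp (- x) ^ n) \<le> real n * ?R ^ (n - 1) * cmod (z - exp (- x))"
    using norm_power_diff_scaled[OF zR _ _ n, of "exp (- x)"] wR by simp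
  also have "\<dots> \<le> real n * ?R ^ (n - 1) * ((\<alpha> + x) * x + \<beta>)"
    using zw by (intro mult_left_mono) auto
  also have "?R ^ (n - 1) = exp ((real n - 1) * \<beta>) * exp (- ((real n - 1) * x / 2))"
    using n by (simp add: exp_of_nat_mult[symmetric] exp_add[symmetric] of_nat_diff algebra_simps diff_divide_distrib)
  also have "real n * (exp ((real n - 1) * \<beta>) * exp (- ((real n - 1) * x / 2))) * ((\<alpha> + x) * x + \<beta>)
     = exp ((real n - 1) * \<beta>) * ((\<alpha> + x) * (real n * x * exp (- ((real n - 1) * x / 2)))
         + exp (- ((real n - 1) * x / 2)) * (real n * \<beta>))" by (simp add: algebra_simps)
  also have "\<dots> \<le> exp (real n * \<beta>) * ((\<alpha> + x) * 4 + 1 * (real n * \<beta>))"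
  proof (intro mult_mono add_mono mult_left_mono mult_right_mono)
    show "exp ((real n - 1) * \<beta>) \<le> exp (real n * \<beta>)" using \<beta> by (simp add: algebra_simps)
    have "real n * x / 2 \<le> exp (real n * x / 2)" using exp_ge_add_one_self[of "real n * x / 2"] by linarith
    then have y: "real n * x / 2 * exp (- (real n * x / 2)) \<le> 1" by (simp add: exp_minus field_simps)
    have x2: "exp (x / 2) \<le> 2"
    proof -
      have "exp (x / 2) \<le> exp (1 / 2 :: real)" using x by simp
      also have "\<dots> \<le> 2" by (rule exp_half_le2)
      finally show ?thesis .
    qed
    have "real n * x * exp (- ((real n - 1) * x / 2)) = 2 * ((real n * x / 2 * exp (- (real n * x / 2))) * exp (x / 2))"
      by (simp add: mult.assoc exp_add[symmetric] field_simps)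
    also have "\<dots> \<le> 2 * (1 * 2)" using y x2 x by (intro mult_left_mono mult_mono) auto
    finally show "real n * x * exp (- ((real n - 1) * x / 2)) \<le> 4" by simp
    show "exp (- ((real n - 1) * x / 2)) \<le> 1" using n x by simp
  qed (use \<alpha> \<beta> x n in auto)
  finally show ?thesis by (simp add: algebra_simps)
qed

text \<open>
The conditional central limit theorem in uniform form. The threshold $\epsilon$ depends on $t$, $\tau$ and the
accuracy only, so that the lemma can be applied to $p^*(\omega)$ for each $\omega$ outside an event of small probability. Truncation
costs at most $2 n P(|x| \ge \tau b)$; for the truncated summand divided by $b$ the two preceding
lemmas apply with $x = t^2 v / 2$, $v$ its variance.
\<close>

lemma char_power_eq_normal_char_approx:
  fixes t \<tau> e :: real
  assumes \<tau>: "\<tau> > 0" and e: "e > 0"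
  shows "\<exists>\<epsilon>>0. \<epsilon> < \<tau> \<and> (\<forall>P b n. real_distribution P \<and> b > 0 \<and> n \<ge> 1 \<and>
      real n * (measure P {..- (\<epsilon> * b)} + measure P {\<epsilon> * b<..}) \<le> \<epsilon> \<longrightarrow>
      cmod (char P (t / b) ^ n - exp (\<i> * complex_of_real (t * trunc_mean (\<lambda>_. P) (\<lambda>_. b) \<tau> n ()) -
        complex_of_real (t\<^sup>2 / 2 * trunc_var (\<lambda>_. P) (\<lambda>_. b) \<tau> n ()))) \<le> e)"
proof -
  define g where "g \<epsilon> = 2 * \<epsilon> + exp (4 * t\<^sup>2 * \<tau>\<^sup>2 * \<epsilon>) *
    (4 * (\<bar>t\<bar> * ((2 + \<tau>) * \<epsilon>) / 3) + 4 * (t\<^sup>2 / 2 * (\<epsilon>\<^sup>2 + \<tau>\<^sup>2 * \<epsilon>)) + 4 * t\<^sup>2 * \<tau>\<^sup>2 * \<epsilon>)" for \<epsilon>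
  have g0: "(g \<longlongrightarrow> g 0) (at_right 0)" unfolding g_def by (intro tendsto_intros) simp_all
  have x0: "((\<lambda>\<epsilon>. t\<^sup>2 / 2 * (\<epsilon>\<^sup>2 + \<tau>\<^sup>2 * \<epsilon>)) \<longlongrightarrow> t\<^sup>2 / 2 * (0\<^sup>2 + \<tau>\<^sup>2 * 0)) (at_right 0)"
    by (intro tendsto_intros)
  have a0: "((\<lambda>\<epsilon>. \<bar>t\<bar> * ((2 + \<tau>) * \<epsilon>) / 3) \<longlongrightarrow> \<bar>t\<bar> * ((2 + \<tau>) * 0) / 3) (at_right 0)"
    by (intro tendsto_intros) simp_all
  have "\<forall>\<^sub>F \<epsilon> in at_right 0. g \<epsilon> < e" using order_tendstoD(2)[OF g0, of e] e by (simp add: g_def)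
  moreover have "\<forall>\<^sub>F \<epsilon> in at_right 0. t\<^sup>2 / 2 * (\<epsilon>\<^sup>2 + \<tau>\<^sup>2 * \<epsilon>) < 1" using order_tendstoD(2)[OF x0, of 1] by simp
  moreover have "\<forall>\<^sub>F \<epsilon> in at_right 0. \<bar>t\<bar> * ((2 + \<tau>) * \<epsilon>) / 3 < 1 / 4" using order_tendstoD(2)[OF a0, of "1 / 4"] by simp
  moreover have "\<forall>\<^sub>F \<epsilon> in at_right 0. \<epsilon> \<in> {0<..<\<tau>}" using \<tau> by (rule eventually_at_right_real)
  ultimately have "\<forall>\<^sub>F \<epsilon> in at_right 0. g \<epsilon> < e \<and> t\<^sup>2 / 2 * (\<epsilon>\<^sup>2 + \<tau>\<^sup>2 * \<epsilon>) < 1 \<and>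
      \<bar>t\<bar> * ((2 + \<tau>) * \<epsilon>) / 3 < 1 / 4 \<and> \<epsilon> \<in> {0<..<\<tau>}"
    by eventually_elim auto
  then obtain \<epsilon> where ge: "g \<epsilon> < e" and x1: "t\<^sup>2 / 2 * (\<epsilon>\<^sup>2 + \<tau>\<^sup>2 * \<epsilon>) < 1"
    and al: "\<bar>t\<bar> * ((2 + \<tau>) * \<epsilon>) / 3 < 1 / 4" and \<epsilon>: "0 < \<epsilon>" "\<epsilon> < \<tau>"
    by (auto dest: eventually_happens)
  show ?thesis
  proof (intro exI[of _ \<epsilon>] conjI allI impI)
    fix P :: "real measure" and b :: real and n :: nat
    assume A: "real_distribution P \<and> b > 0 \<and> n \<ge> 1 \<and>
      real n * (measure P {..- (\<epsilon> * b)} + measure P {\<epsilon> * b<..}) \<le> \<epsilon>"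
    then interpret real_distribution P by simp
    from A have b: "b > 0" and n: "n \<ge> 1" and Q: "real n * (prob {..- (\<epsilon> * b)} + prob {\<epsilon> * b<..}) \<le> \<epsilon>" by auto
    define Y where "Y x = (if \<bar>x\<bar> < \<tau> * b then x / b else 0)" for x
    have Ym[measurable]: "Y \<in> borel_measurable P" unfolding Y_def by measurable
    have Yb: "\<bar>Y x\<bar> \<le> \<tau>" for x using b \<tau> by (auto simp: Y_def field_simps abs_less_iff)
    define m where "m = expectation Y"
    define v where "v = expectation (\<lambda>x. (Y x)\<^sup>2) - m\<^sup>2"
    define q where "q = prob {x\<in>space P. \<bar>Y x\<bar> > \<epsilon>}"
    define r where "r = prob {x. \<not> \<bar>x\<bar> < \<tau> * b}"
    have bound: "cmod (char (distr P borel (\<lambda>x. Y x - m)) t - (1 - t\<^sup>2 * v / 2))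
      \<le> \<bar>t\<bar>^3 * (2 * \<epsilon> + \<tau> * q) * v / 6 + 4 * t\<^sup>2 * \<tau>\<^sup>2 * q" and v_le: "v \<le> \<epsilon>\<^sup>2 + \<tau>\<^sup>2 * q" and v0: "0 \<le> v"
      unfolding m_def q_def v_def by (rule char_centred_bounded_approx[OF Ym Yb \<epsilon>(1)])+
    \<comment> \<open>Both exceptional events lie in the tail event of the hypothesis.\<close>
    have tail: "prob {x. \<bar>x\<bar> > \<epsilon> * b} \<le> prob {..- (\<epsilon> * b)} + prob {\<epsilon> * b<..}"
    proof -
      have "prob {x. \<bar>x\<bar> > \<epsilon> * b} \<le> prob ({..- (\<epsilon> * b)} \<union> {\<epsilon> * b<..})"
        by (rule finite_measure_mono) auto
      also have "\<dots> \<le> prob {..- (\<epsilon> * b)} + prob {\<epsilon> * b<..}" by (rule measure_Un_le) auto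
      finally show ?thesis .
    qed
    have q_le: "q \<le> prob {x. \<bar>x\<bar> > \<epsilon> * b}" unfolding q_def
      using b \<epsilon> by (intro finite_measure_mono) (auto simp: Y_def field_simps split: if_splits)
    have r_le: "r \<le> prob {x. \<bar>x\<bar> > \<epsilon> * b}" unfolding r_def
    proof (intro finite_measure_mono subsetI)
      fix x assume "x \<in> {x. \<not> \<bar>x\<bar> < \<tau> * b}"
      moreover have "\<epsilon> * b < \<tau> * b" using \<epsilon> b by simp
      ultimately show "x \<in> {x. \<bar>x\<bar> > \<epsilon> * b}" by auto
    qed auto
    have nq: "real n * q \<le> \<epsilon>" and nr: "real n * r \<le> \<epsilon>"
      using Q q_le r_le tail mult_left_mono[of q _ "real n"] mult_left_mono[of r _ "real n"]
      by (meson order_trans of_nat_0_le_iff)+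
    have q0: "0 \<le> q" unfolding q_def by simp
    have "q \<le> real n * q" using n q0 mult_right_mono[of 1 "real n" q] by simp
    then have q\<epsilon>: "q \<le> \<epsilon>" using nq by simp
    define z where "z = char (distr P borel (\<lambda>x. Y x - m)) t"
    define x where "x = t\<^sup>2 * v / 2"
    define \<alpha> where "\<alpha> = \<bar>t\<bar> * (2 * \<epsilon> + \<tau> * q) / 3"
    define \<beta> where "\<beta> = 4 * t\<^sup>2 * \<tau>\<^sup>2 * q"
    have xle: "x \<le> t\<^sup>2 / 2 * (\<epsilon>\<^sup>2 + \<tau>\<^sup>2 * \<epsilon>)"
    proof -
      have "v \<le> \<epsilon>\<^sup>2 + \<tau>\<^sup>2 * \<epsilon>" using v_le mult_left_mono[OF q\<epsilon>, of "\<tau>\<^sup>2"] by simp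
      from mult_left_mono[OF this, of "t\<^sup>2 / 2"] show ?thesis by (simp add: x_def)
    qed
    have \<alpha>le: "\<alpha> \<le> \<bar>t\<bar> * ((2 + \<tau>) * \<epsilon>) / 3"
      unfolding \<alpha>_def using mult_left_mono[OF q\<epsilon>, of \<tau>] \<tau> by (intro divide_right_mono mult_left_mono) (auto simp: algebra_simps)
    have n\<beta>: "real n * \<beta> \<le> 4 * t\<^sup>2 * \<tau>\<^sup>2 * \<epsilon>"
      using mult_left_mono[OF nq, of "4 * t\<^sup>2 * \<tau>\<^sup>2"] by (simp add: \<beta>_def mult_ac)
    have "cmod (z ^ n - exp (- x) ^ n) \<le> exp (real n * \<beta>) * (4 * \<alpha> + 4 * x + real n * \<beta>)"
    proof (rule power_vs_exp_power)
      show "cmod (z - (1 - x)) \<le> \<alpha> * x + \<beta>"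
        using bound by (simp add: z_def x_def \<alpha>_def \<beta>_def power3_eq_cube power2_eq_square field_simps)
      show "0 \<le> x" "x \<le> 1" using v0 xle x1 by (auto simp: x_def)
      show "0 \<le> \<alpha>" "\<alpha> \<le> 1 / 4" "0 \<le> \<beta>" using \<alpha>le al q0 \<epsilon> \<tau> by (auto simp: \<alpha>_def \<beta>_def)
    qed (rule n)
    also have "\<dots> \<le> exp (4 * t\<^sup>2 * \<tau>\<^sup>2 * \<epsilon>) *
      (4 * (\<bar>t\<bar> * ((2 + \<tau>) * \<epsilon>) / 3) + 4 * (t\<^sup>2 / 2 * (\<epsilon>\<^sup>2 + \<tau>\<^sup>2 * \<epsilon>)) + 4 * t\<^sup>2 * \<tau>\<^sup>2 * \<epsilon>)"
    proof (rule mult_mono)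
      show "4 * \<alpha> + 4 * x + real n * \<beta> \<le> 4 * (\<bar>t\<bar> * ((2 + \<tau>) * \<epsilon>) / 3) + 4 * (t\<^sup>2 / 2 * (\<epsilon>\<^sup>2 + \<tau>\<^sup>2 * \<epsilon>)) + 4 * t\<^sup>2 * \<tau>\<^sup>2 * \<epsilon>"
        using \<alpha>le xle n\<beta> by linarith
      show "0 \<le> 4 * \<alpha> + 4 * x + real n * \<beta>" using q0 \<epsilon> \<tau> v0 by (simp add: \<alpha>_def x_def \<beta>_def)
    qed (use n\<beta> in auto)
    finally have pw: "cmod (z ^ n - exp (- x) ^ n) \<le> g \<epsilon> - 2 * \<epsilon>" by (simp add: g_def)
    define u where "u = (CLINT x|P. iexp (t * Y x))"
    have iu: "complex_integrable P (\<lambda>x. iexp (t * Y x))" by (intro integrable_const_bound[where B = 1]) auto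
    have ic: "complex_integrable P (\<lambda>x. iexp (t / b * x))" by (intro integrable_const_bound[where B = 1]) auto
    have zu: "u = iexp (t * m) * z"
    proof -
      have "z = (CLINT x|P. iexp (- (t * m)) * iexp (t * Y x))"
      proof -
        have "iexp (t * (Y x - m)) = iexp (- (t * m)) * iexp (t * Y x)" for x
          unfolding exp_add[symmetric] by (rule arg_cong[where f = exp]) (simp add: algebra_simps)
        then show ?thesis unfolding z_def char_def by (subst integral_distr) auto
      qed
      also have "\<dots> = iexp (- (t * m)) * u" unfolding u_def using iu by simp
      finally have "iexp (t * m) * z = (iexp (t * m) * iexp (- (t * m))) * u" by (simp only: mult.assoc)
      also have "iexp (t * m) * iexp (- (t * m)) = 1" unfolding exp_add[symmetric] by simp
      finally show ?thesis by simp
    qed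
    have cu: "cmod (char P (t / b) - u) \<le> 2 * r"
    proof -
      have "char P (t / b) - u = (CLINT x|P. iexp (t / b * x) - iexp (t * Y x))"
        unfolding char_def u_def using iu ic by simp
      also have "cmod \<dots> \<le> (\<integral>x. 2 * indicator {x. \<not> \<bar>x\<bar> < \<tau> * b} x \<partial>P)"
      proof (rule order_trans[OF integral_norm_bound integral_mono])
        show "integrable P (\<lambda>x. cmod (iexp (t / b * x) - iexp (t * Y x)))" using iu ic by simp
        show "integrable P (\<lambda>x. 2 * indicat_real {x. \<not> \<bar>x\<bar> < \<tau> * b} x)"
          by (intro integrable_mult_right integrable_real_indicator) (auto simp: less_top[symmetric])
        fix x
        have "cmod (iexp (t / b * x) - iexp (t * Y x)) \<le> 2"
          using norm_triangle_ineq4[of "iexp (t / b * x)" "iexp (t * Y x)"] by (simp del: of_real_mult of_real_divide)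
        then show "cmod (iexp (t / b * x) - iexp (t * Y x)) \<le> 2 * indicat_real {x. \<not> \<bar>x\<bar> < \<tau> * b} x"
          by (cases "\<bar>x\<bar> < \<tau> * b") (auto simp: Y_def indicator_def)
      qed
      also have "\<dots> = 2 * r" by (simp add: r_def)
      finally show ?thesis .
    qed
    have u1: "cmod u \<le> 1"
      unfolding u_def using integral_norm_bound[of P "\<lambda>x. iexp (t * Y x)"] prob_space by simp
    have "cmod (char P (t / b) ^ n - u ^ n) \<le> n * cmod (char P (t / b) - u)"
      by (rule norm_power_diff) (auto simp: cmod_char_le_1 u1)
    also have "\<dots> \<le> n * (2 * r)" using cu by (intro mult_left_mono) auto
    also have "\<dots> \<le> 2 * \<epsilon>" using nr by simp
    finally have p1: "cmod (char P (t / b) ^ n - u ^ n) \<le> 2 * \<epsilon>" .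
    have p2: "cmod (u ^ n - (iexp (t * m) * exp (- x)) ^ n) \<le> g \<epsilon> - 2 * \<epsilon>"
      using pw by (simp add: zu power_mult_distrib right_diff_distrib[symmetric] norm_mult norm_power del: of_real_mult)
    have m_eq: "(LINT x:{x. \<bar>x\<bar> < \<tau> * b}|P. x) = b * m"
    proof -
      have "(\<lambda>x. indicator {x. \<bar>x\<bar> < \<tau> * b} x * x) = (\<lambda>x. b * Y x)"
        using b by (auto simp: Y_def fun_eq_iff)
      then show ?thesis by (simp add: set_lebesgue_integral_def m_def)
    qed
    have v_eq: "(LINT x:{x. \<bar>x\<bar> < \<tau> * b}|P. x\<^sup>2) = b\<^sup>2 * (v + m\<^sup>2)"
    proof -
      have "(\<lambda>x. indicator {x. \<bar>x\<bar> < \<tau> * b} x * x\<^sup>2) = (\<lambda>x. b\<^sup>2 * (Y x)\<^sup>2)"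
        using b by (auto simp: Y_def fun_eq_iff power_divide)
      then show ?thesis by (simp add: set_lebesgue_integral_def v_def)
    qed
    have "(iexp (t * m) * exp (- x)) ^ n =
      exp (\<i> * complex_of_real (t * trunc_mean (\<lambda>_. P) (\<lambda>_. b) \<tau> n ()) -
        complex_of_real (t\<^sup>2 / 2 * trunc_var (\<lambda>_. P) (\<lambda>_. b) \<tau> n ()))"
    proof -
      have "(iexp (t * m) * exp (- x)) ^ n = exp (of_nat n * (\<i> * complex_of_real (t * m) + complex_of_real (- x)))"
        unfolding exp_of_real[symmetric] exp_add[symmetric] exp_of_nat_mult[symmetric] ..
      also have "of_nat n * (\<i> * complex_of_real (t * m) + complex_of_real (- x)) =
        \<i> * complex_of_real (t * (real n * m)) - complex_of_real (real n * x)"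
        by (simp add: algebra_simps)
      also have "real n * m = trunc_mean (\<lambda>_. P) (\<lambda>_. b) \<tau> n ()"
        unfolding trunc_mean_def m_eq using b by simp
      also have "real n * x = t\<^sup>2 / 2 * trunc_var (\<lambda>_. P) (\<lambda>_. b) \<tau> n ()"
      proof -
        have "b\<^sup>2 * (v + m\<^sup>2) - (b * m)\<^sup>2 = b\<^sup>2 * v" by (simp add: algebra_simps power_mult_distrib)
        then show ?thesis unfolding trunc_var_def m_eq v_eq x_def using b by simp
      qed
      finally show ?thesis .
    qed
    then show "cmod (char P (t / b) ^ n - exp (\<i> * complex_of_real (t * trunc_mean (\<lambda>_. P) (\<lambda>_. b) \<tau> n ()) -
        complex_of_real (t\<^sup>2 / 2 * trunc_var (\<lambda>_. P) (\<lambda>_. b) \<tau> n ()))) \<le> e"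
      using p1 p2 ge norm_triangle_ineq[of "char P (t / b) ^ n - u ^ n" "u ^ n - (iexp (t * m) * exp (- x)) ^ n"]
      by simp
  qed (use \<epsilon> in auto)
qed

section \<open>Convergence in probability and normal mixtures\<close>

text \<open>
A translation-invariant metric for convergence in probability. It turns estimates in probability
into inequalities between real numbers, with a triangle inequality.
\<close>

definition prob_norm :: "'a measure \<Rightarrow> ('a \<Rightarrow> real) \<Rightarrow> real" where
  "prob_norm M Y = (\<integral>\<omega>. min 1 \<bar>Y \<omega>\<bar> \<partial>M)"

text \<open>
Tightness along the tail of the sequence, expressed through small multiples.
\<close>

definition bounded_in_prob :: "'a measure \<Rightarrow> (nat \<Rightarrow> 'a \<Rightarrow> real) \<Rightarrow> bool" where
  "bounded_in_prob M Y \<longleftrightarrow> (\<forall>\<epsilon>>0. \<exists>s>0. \<forall>\<^sub>F n in sequentially. prob_norm M (\<lambda>\<omega>. s * Y n \<omega>) \<le> \<epsilon>)"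

text \<open>
The characteristic function of $Y + \sqrt V Z$ for a standard normal $Z$ independent of $(Y, V)$. The pair
enters the proof only through this function, which avoids joint laws on the plane.
\<close>

definition mix_char :: "'a measure \<Rightarrow> ('a \<Rightarrow> real) \<Rightarrow> ('a \<Rightarrow> real) \<Rightarrow> real \<Rightarrow> complex" where
  "mix_char M Y V t = (CLINT \<omega>|M. exp (\<i> * complex_of_real (t * Y \<omega>) - complex_of_real (t\<^sup>2 / 2 * V \<omega>)))"

context prob_space
begin

lemma integrable_prob_norm [simp]:
  fixes Y :: "'a \<Rightarrow> real"
  assumes [measurable]: "Y \<in> borel_measurable M"
  shows "integrable M (\<lambda>\<omega>. min 1 \<bar>Y \<omega>\<bar>)"
  by (intro integrable_const_bound[where B = 1] AE_I2) auto

lemma prob_norm_nonneg [simp]: "0 \<le> prob_norm M Y"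
  unfolding prob_norm_def by (rule integral_nonneg_AE) auto

lemma prob_norm_le_add:
  assumes [measurable]: "Y \<in> borel_measurable M" "Z \<in> borel_measurable M" "W \<in> borel_measurable M"
    and le: "\<And>\<omega>. \<omega> \<in> space M \<Longrightarrow> \<bar>Y \<omega>\<bar> \<le> \<bar>Z \<omega>\<bar> + \<bar>W \<omega>\<bar>"
  shows "prob_norm M Y \<le> prob_norm M Z + prob_norm M W"
proof -
  have "prob_norm M Y \<le> (\<integral>\<omega>. min 1 \<bar>Z \<omega>\<bar> + min 1 \<bar>W \<omega>\<bar> \<partial>M)"
    unfolding prob_norm_def
  proof (rule integral_mono)
    fix \<omega> assume "\<omega> \<in> space M"
    from le[OF this] show "min 1 \<bar>Y \<omega>\<bar> \<le> min 1 \<bar>Z \<omega>\<bar> + min 1 \<bar>W \<omega>\<bar>" by linarith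
  qed auto
  then show ?thesis by (simp add: prob_norm_def)
qed

lemma prob_norm_mono:
  assumes [measurable]: "Y \<in> borel_measurable M" "Z \<in> borel_measurable M"
    and le: "\<And>\<omega>. \<omega> \<in> space M \<Longrightarrow> \<bar>Y \<omega>\<bar> \<le> \<bar>Z \<omega>\<bar>"
  shows "prob_norm M Y \<le> prob_norm M Z"
  unfolding prob_norm_def
proof (rule integral_mono)
  fix \<omega> assume "\<omega> \<in> space M"
  from le[OF this] show "min 1 \<bar>Y \<omega>\<bar> \<le> min 1 \<bar>Z \<omega>\<bar>" by linarith
qed auto

lemma prob_norm_scale:
  assumes [measurable]: "Y \<in> borel_measurable M" "Z \<in> borel_measurable M"
    and le: "\<And>\<omega>. \<omega> \<in> space M \<Longrightarrow> \<bar>Y \<omega>\<bar> \<le> K * \<bar>Z \<omega>\<bar>" and K: "K \<ge> 1"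
  shows "prob_norm M Y \<le> K * prob_norm M Z"
proof -
  have "prob_norm M Y \<le> (\<integral>\<omega>. K * min 1 \<bar>Z \<omega>\<bar> \<partial>M)" unfolding prob_norm_def
  proof (rule integral_mono)
    fix \<omega> assume "\<omega> \<in> space M"
    then show "min 1 \<bar>Y \<omega>\<bar> \<le> K * min 1 \<bar>Z \<omega>\<bar>" using le[of \<omega>] K by (auto simp: min_def)
  qed auto
  then show ?thesis by (simp add: prob_norm_def)
qed

lemma prob_norm_mult_le:
  assumes [measurable]: "Z \<in> borel_measurable M"
  shows "prob_norm M (\<lambda>\<omega>. a * Z \<omega>) \<le> (1 + \<bar>a\<bar>) * prob_norm M Z"
  by (rule prob_norm_scale) (auto simp: abs_mult algebra_simps)

lemma prob_norm_small_multiple: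
  assumes [measurable]: "Y \<in> borel_measurable M" and "\<epsilon> > 0"
  shows "\<exists>s>0. prob_norm M (\<lambda>\<omega>. s * Y \<omega>) \<le> \<epsilon>"
proof -
  have "(\<lambda>n. prob_norm M (\<lambda>\<omega>. inverse (real (Suc n)) * Y \<omega>)) \<longlonglongrightarrow> (\<integral>\<omega>. 0 \<partial>M)"
    unfolding prob_norm_def
  proof (rule integral_dominated_convergence[where w = "\<lambda>_. 1"])
    show "AE \<omega> in M. (\<lambda>n. min 1 \<bar>inverse (real (Suc n)) * Y \<omega>\<bar>) \<longlonglongrightarrow> 0"
    proof (rule AE_I2)
      fix \<omega>
      have "(\<lambda>n. min 1 \<bar>inverse (real (Suc n)) * Y \<omega>\<bar>) \<longlonglongrightarrow> min 1 \<bar>0 * Y \<omega>\<bar>"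
        by (intro tendsto_intros LIMSEQ_inverse_real_of_nat)
      then show "(\<lambda>n. min 1 \<bar>inverse (real (Suc n)) * Y \<omega>\<bar>) \<longlonglongrightarrow> 0" by simp
    qed
  qed auto
  then have "\<forall>\<^sub>F n in sequentially. prob_norm M (\<lambda>\<omega>. inverse (real (Suc n)) * Y \<omega>) < \<epsilon>"
    using order_tendstoD(2)[OF _ \<open>\<epsilon> > 0\<close>] by simp
  then obtain n where "prob_norm M (\<lambda>\<omega>. inverse (real (Suc n)) * Y \<omega>) < \<epsilon>"
    by (auto dest: eventually_happens)
  then show ?thesis by (intro exI[of _ "inverse (real (Suc n))"]) auto
qed

lemma conv_in_prob_iff_prob_norm:
  assumes [measurable]: "\<And>n. Y n \<in> borel_measurable M"
  shows "conv_in_prob M Y c \<longleftrightarrow> (\<lambda>n. prob_norm M (\<lambda>\<omega>. Y n \<omega> - c)) \<longlonglongrightarrow> 0"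
proof
  assume *: "conv_in_prob M Y c"
  show "(\<lambda>n. prob_norm M (\<lambda>\<omega>. Y n \<omega> - c)) \<longlonglongrightarrow> 0"
  proof (rule LIMSEQ_I)
    fix r :: real assume r: "r > 0"
    have "(\<lambda>n. prob {\<omega>\<in>space M. \<bar>Y n \<omega> - c\<bar> > r / 2}) \<longlonglongrightarrow> 0"
      using * half_gt_zero[OF r] unfolding conv_in_prob_def by blast
    from LIMSEQ_D[OF this, of "r / 2"] r obtain N
      where N: "\<And>n. n \<ge> N \<Longrightarrow> prob {\<omega>\<in>space M. \<bar>Y n \<omega> - c\<bar> > r / 2} < r / 2" by auto
    show "\<exists>no. \<forall>n\<ge>no. norm (prob_norm M (\<lambda>\<omega>. Y n \<omega> - c) - 0) < r"
    proof (intro exI allI impI)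
      fix n assume "n \<ge> N"
      let ?A = "{\<omega>\<in>space M. \<bar>Y n \<omega> - c\<bar> > r / 2}"
      have "prob_norm M (\<lambda>\<omega>. Y n \<omega> - c) \<le> (\<integral>\<omega>. r / 2 + indicator ?A \<omega> \<partial>M)"
        unfolding prob_norm_def
      proof (rule integral_mono)
        show "integrable M (\<lambda>\<omega>. r / 2 + indicat_real ?A \<omega>)"
          by (intro Bochner_Integration.integrable_add integrable_real_indicator) (auto simp: less_top[symmetric])
        show "min 1 \<bar>Y n \<omega> - c\<bar> \<le> r / 2 + indicat_real ?A \<omega>" if "\<omega> \<in> space M" for \<omega>
          using r that by (auto simp: indicator_def min_def)
      qed simp
      also have "\<dots> = r / 2 + prob ?A"
        by (subst Bochner_Integration.integral_add) (auto simp: prob_space less_top[symmetric] Int_absorb1 intro!: integrable_real_indicator)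
      also have "\<dots> < r" using N[OF \<open>n \<ge> N\<close>] by simp
      finally show "norm (prob_norm M (\<lambda>\<omega>. Y n \<omega> - c) - 0) < r" by simp
    qed
  qed
next
  assume *: "(\<lambda>n. prob_norm M (\<lambda>\<omega>. Y n \<omega> - c)) \<longlonglongrightarrow> 0"
  show "conv_in_prob M Y c" unfolding conv_in_prob_def
  proof (intro allI impI)
    fix \<epsilon> :: real assume \<epsilon>: "\<epsilon> > 0"
    let ?e = "min 1 \<epsilon>"
    have bnd: "prob {\<omega>\<in>space M. \<bar>Y n \<omega> - c\<bar> > \<epsilon>} \<le> prob_norm M (\<lambda>\<omega>. Y n \<omega> - c) / ?e" for n
    proof -
      let ?A = "{\<omega>\<in>space M. \<bar>Y n \<omega> - c\<bar> > \<epsilon>}"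
      have "prob ?A = (\<integral>\<omega>. indicator ?A \<omega> \<partial>M)" by (simp add: Int_absorb1)
      also have "\<dots> \<le> (\<integral>\<omega>. min 1 \<bar>Y n \<omega> - c\<bar> / ?e \<partial>M)"
      proof (rule integral_mono)
        show "integrable M (indicat_real ?A)"
          by (intro integrable_real_indicator) (auto simp: less_top[symmetric])
        show "indicat_real ?A \<omega> \<le> min 1 \<bar>Y n \<omega> - c\<bar> / ?e" if "\<omega> \<in> space M" for \<omega>
          using \<epsilon> by (auto simp: indicator_def field_simps min_def)
      qed simp
      finally show ?thesis by (simp add: prob_norm_def)
    qed
    have "(\<lambda>n. prob_norm M (\<lambda>\<omega>. Y n \<omega> - c) / ?e) \<longlonglongrightarrow> 0 / ?e"
      using * \<epsilon> by (intro tendsto_intros) auto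
    then have "(\<lambda>n. prob_norm M (\<lambda>\<omega>. Y n \<omega> - c) / ?e) \<longlonglongrightarrow> 0" by simp
    from tendsto_sandwich[OF _ _ tendsto_const this] bnd
    show "(\<lambda>n. prob {\<omega>\<in>space M. \<epsilon> < \<bar>Y n \<omega> - c\<bar>}) \<longlonglongrightarrow> 0"
      by (simp add: always_eventually)
  qed
qed

lemma norm_exp_diff_le:
  fixes x y v w :: real
  assumes "v \<ge> 0" "w \<ge> 0"
  shows "cmod (exp (\<i> * complex_of_real x - complex_of_real v) - exp (\<i> * complex_of_real y - complex_of_real w))
    \<le> 2 * min 1 \<bar>x - y\<bar> + min 1 \<bar>v - w\<bar>"
proof -
  have e: "exp (\<i> * complex_of_real x - complex_of_real v) = iexp x * of_real (exp (- v))" for x v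
    by (simp add: exp_diff exp_minus exp_of_real field_simps)
  have 1: "cmod (iexp x - iexp y) \<le> 2 * min 1 \<bar>x - y\<bar>"
  proof -
    have "cmod (iexp x - iexp y) \<le> 2"
      using norm_triangle_ineq4[of "iexp x" "iexp y"] by simp
    moreover have "cmod (iexp x - iexp y) \<le> \<bar>x - y\<bar>"
    proof -
      have "iexp x - iexp y = iexp y * (iexp (x - y) - 1)"
        by (simp add: right_diff_distrib exp_diff)
      then have "cmod (iexp x - iexp y) = cmod (iexp (x - y) - 1)" by (simp add: norm_mult)
      also have "\<dots> \<le> \<bar>x - y\<bar>" using iexp_approx1[of "x - y" 0] by simp
      finally show ?thesis .
    qed
    moreover have *: "c \<le> 2 * min 1 a" if "c \<le> 2" "c \<le> a" "0 \<le> a" for a c :: real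
      using that by (auto simp: min_def)
    ultimately show ?thesis by (intro * abs_ge_zero)
  qed
  have 2: "\<bar>exp (- v) - exp (- w)\<bar> \<le> min 1 \<bar>v - w\<bar>"
  proof -
    have *: "exp (- a) - exp (- b) \<le> b - a" if "0 \<le> a" "a \<le> b" for a b :: real
    proof -
      have "exp (- a) - exp (- b) = exp (- a) * (1 - exp (- (b - a)))"
        by (simp add: right_diff_distrib exp_add[symmetric])
      also have "\<dots> \<le> 1 * (b - a)"
      proof (rule mult_mono)
        show "1 - exp (- (b - a)) \<le> b - a" using exp_ge_add_one_self[of "- (b - a)"] by linarith
      qed (use that in auto)
      finally show ?thesis by simp
    qed
    have "\<bar>exp (- v) - exp (- w)\<bar> \<le> 1"
    proof -
      have "0 < exp (- v)" "exp (- v) \<le> 1" "0 < exp (- w)" "exp (- w) \<le> 1" using assms by auto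
      then show ?thesis by linarith
    qed
    moreover have "\<bar>exp (- v) - exp (- w)\<bar> \<le> \<bar>v - w\<bar>"
      using *[of v w] *[of w v] assms by (cases "v \<le> w") auto
    ultimately show ?thesis by simp
  qed
  have "iexp x * of_real (exp (- v)) - iexp y * of_real (exp (- w))
     = (iexp x - iexp y) * of_real (exp (- v)) + iexp y * of_real (exp (- v) - exp (- w))"
    by (simp add: algebra_simps)
  also have "cmod \<dots> \<le> cmod (iexp x - iexp y) * exp (- v) + \<bar>exp (- v) - exp (- w)\<bar>"
    by (rule order_trans[OF norm_triangle_ineq]) (simp add: norm_mult del: of_real_diff)
  also have "\<dots> \<le> cmod (iexp x - iexp y) * 1 + \<bar>exp (- v) - exp (- w)\<bar>"
    using assms by (intro add_mono mult_left_mono) auto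
  finally show ?thesis unfolding e using 1 2 by linarith
qed

lemma integrable_mix_char:
  assumes [measurable]: "Y \<in> borel_measurable M" "V \<in> borel_measurable M"
    and V: "\<And>\<omega>. \<omega> \<in> space M \<Longrightarrow> 0 \<le> V \<omega>"
  shows "complex_integrable M (\<lambda>\<omega>. exp (\<i> * complex_of_real (t * Y \<omega>) - complex_of_real (t\<^sup>2 / 2 * V \<omega>)))"
  using V by (intro integrable_const_bound[where B = 1] AE_I2) auto

text \<open>
Perturbations of $Y$ and $V$ that are small in probability change the mixture only a little.
\<close>

lemma norm_mix_char_diff_le:
  assumes [measurable]: "Y \<in> borel_measurable M" "V \<in> borel_measurable M" "Y' \<in> borel_measurable M" "V' \<in> borel_measurable M"
    and V: "\<And>\<omega>. \<omega> \<in> space M \<Longrightarrow> 0 \<le> V \<omega>" and V': "\<And>\<omega>. \<omega> \<in> space M \<Longrightarrow> 0 \<le> V' \<omega>"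
  shows "cmod (mix_char M Y V t - mix_char M Y' V' t)
    \<le> 2 * prob_norm M (\<lambda>\<omega>. t * (Y \<omega> - Y' \<omega>)) + prob_norm M (\<lambda>\<omega>. t\<^sup>2 / 2 * (V \<omega> - V' \<omega>))"
proof -
  let ?e = "\<lambda>Y V \<omega>. exp (\<i> * complex_of_real (t * Y \<omega>) - complex_of_real (t\<^sup>2 / 2 * V \<omega>))"
  have i: "complex_integrable M (?e Y V)" "complex_integrable M (?e Y' V')"
    by (rule integrable_mix_char; fact)+
  have "mix_char M Y V t - mix_char M Y' V' t = (CLINT \<omega>|M. ?e Y V \<omega> - ?e Y' V' \<omega>)"
    unfolding mix_char_def using i by (rule Bochner_Integration.integral_diff[symmetric])
  then have "cmod (mix_char M Y V t - mix_char M Y' V' t) = cmod (CLINT \<omega>|M. ?e Y V \<omega> - ?e Y' V' \<omega>)"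
    by (rule arg_cong)
  also have "\<dots> \<le> (\<integral>\<omega>. 2 * min 1 \<bar>t * (Y \<omega> - Y' \<omega>)\<bar> + min 1 \<bar>t\<^sup>2 / 2 * (V \<omega> - V' \<omega>)\<bar> \<partial>M)"
  proof (rule order_trans[OF integral_norm_bound integral_mono])
    show "integrable M (\<lambda>\<omega>. cmod (?e Y V \<omega> - ?e Y' V' \<omega>))" using i by (intro integrable_norm Bochner_Integration.integrable_diff)
    fix \<omega> assume "\<omega> \<in> space M"
    then show "cmod (?e Y V \<omega> - ?e Y' V' \<omega>) \<le> 2 * min 1 \<bar>t * (Y \<omega> - Y' \<omega>)\<bar> + min 1 \<bar>t\<^sup>2 / 2 * (V \<omega> - V' \<omega>)\<bar>"
      using norm_exp_diff_le[of "t\<^sup>2 / 2 * V \<omega>" "t\<^sup>2 / 2 * V' \<omega>" "t * Y \<omega>" "t * Y' \<omega>"] V V'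
      by (simp only: right_diff_distrib) simp
  next
    have "integrable M (\<lambda>\<omega>. min 1 \<bar>t * (Y \<omega> - Y' \<omega>)\<bar>)" "integrable M (\<lambda>\<omega>. min 1 \<bar>t\<^sup>2 / 2 * (V \<omega> - V' \<omega>)\<bar>)"
      by (rule integrable_prob_norm; measurable)+
    then show "integrable M (\<lambda>\<omega>. 2 * min 1 \<bar>t * (Y \<omega> - Y' \<omega>)\<bar> + min 1 \<bar>t\<^sup>2 / 2 * (V \<omega> - V' \<omega>)\<bar>)"
      by (intro Bochner_Integration.integrable_add integrable_mult_right)
  qed
  also have "\<dots> = 2 * prob_norm M (\<lambda>\<omega>. t * (Y \<omega> - Y' \<omega>)) + prob_norm M (\<lambda>\<omega>. t\<^sup>2 / 2 * (V \<omega> - V' \<omega>))"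
    unfolding prob_norm_def using integrable_prob_norm[of "\<lambda>\<omega>. t * (Y \<omega> - Y' \<omega>)"] integrable_prob_norm[of "\<lambda>\<omega>. t\<^sup>2 / 2 * (V \<omega> - V' \<omega>)"]
    by (subst Bochner_Integration.integral_add) (auto simp del: times_divide_eq_left)
  finally show ?thesis .
qed

lemma norm_mix_char_le_1:
  assumes [measurable]: "Y \<in> borel_measurable M" "V \<in> borel_measurable M"
    and V: "\<And>\<omega>. \<omega> \<in> space M \<Longrightarrow> 0 \<le> V \<omega>"
  shows "cmod (mix_char M Y V t) \<le> (\<integral>\<omega>. exp (- (t\<^sup>2 / 2 * V \<omega>)) \<partial>M)"
  unfolding mix_char_def by (rule order_trans[OF integral_norm_bound]) simp

lemma mix_char_shift:
  "mix_char M (\<lambda>\<omega>. Y \<omega> + d) V t = iexp (t * d) * mix_char M Y V t"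
proof -
  have "exp (\<i> * complex_of_real (t * (Y \<omega> + d)) - complex_of_real (t\<^sup>2 / 2 * V \<omega>)) =
    iexp (t * d) * exp (\<i> * complex_of_real (t * Y \<omega>) - complex_of_real (t\<^sup>2 / 2 * V \<omega>))" for \<omega>
    unfolding exp_add[symmetric] by (rule arg_cong[where f = exp]) (simp add: algebra_simps)
  then show ?thesis unfolding mix_char_def by simp
qed

text \<open>
Converts a Laplace transform close to 1 into smallness in probability; it rests on
$\min(1, x)/2 \le x/(1+x) \le 1 - e^{-x}$.
\<close>

lemma prob_norm_le_exp:
  assumes [measurable]: "V \<in> borel_measurable M" and V: "\<And>\<omega>. \<omega> \<in> space M \<Longrightarrow> 0 \<le> V \<omega>"
  shows "prob_norm M V \<le> 2 * (1 - (\<integral>\<omega>. exp (- V \<omega>) \<partial>M))"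
proof -
  have i: "integrable M (\<lambda>\<omega>. exp (- V \<omega>))" using V by (intro integrable_const_bound[where B = 1] AE_I2) auto
  have "prob_norm M V \<le> (\<integral>\<omega>. 2 * (1 - exp (- V \<omega>)) \<partial>M)" unfolding prob_norm_def
  proof (rule integral_mono)
    fix \<omega> assume "\<omega> \<in> space M"
    then have v: "0 \<le> V \<omega>" by (rule V)
    have "exp (- V \<omega>) \<le> 1 / (1 + V \<omega>)"
      using exp_ge_add_one_self[of "V \<omega>"] v by (simp add: exp_minus field_simps)
    also have "\<dots> \<le> 1 - min 1 (V \<omega>) / 2"
    proof (cases "V \<omega> \<le> 1")
      case True
      have "1 \<le> 1 + V \<omega> * (1 - V \<omega>) / 2" using True v by simp
      also have "\<dots> = (1 - V \<omega> / 2) * (1 + V \<omega>)" by (simp add: field_simps)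
      finally have "1 / (1 + V \<omega>) \<le> 1 - V \<omega> / 2" using v by (simp add: divide_le_eq)
      then show ?thesis using True by (simp add: min_def)
    qed (simp add: divide_le_eq min_def)
    finally show "min 1 \<bar>V \<omega>\<bar> \<le> 2 * (1 - exp (- V \<omega>))" using v by simp
  qed (use i in auto)
  also have "\<dots> = 2 * (1 - (\<integral>\<omega>. exp (- V \<omega>) \<partial>M))" using i by (simp add: prob_space)
  finally show ?thesis .
qed

end

lemma integral_std_normal_uminus:
  fixes f :: "real \<Rightarrow> real"
  assumes [measurable]: "f \<in> borel_measurable borel"
  shows "(\<integral>z. f (- z) \<partial>std_normal_distribution) = (\<integral>z. f z \<partial>std_normal_distribution)"
proof -
  have "(\<integral>z. f z \<partial>std_normal_distribution) = (\<integral>z. std_normal_density z * f z \<partial>lborel)"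
    by (subst integral_density) auto
  also have "\<dots> = (\<integral>z. std_normal_density z * f (- z) \<partial>lborel)"
    by (subst lborel_integral_real_affine[where c = "-1" and t = 0]) (auto simp: std_normal_density_def)
  also have "\<dots> = (\<integral>z. f (- z) \<partial>std_normal_distribution)"
    by (subst integral_density) auto
  finally show ?thesis by simp
qed

text \<open>
For nonnegative $V$, a law with characteristic function \<open>mix_char\<close>, which makes the continuity theorem applicable to it.
\<close>

definition normal_mixture_law :: "'a measure \<Rightarrow> ('a \<Rightarrow> real) \<Rightarrow> ('a \<Rightarrow> real) \<Rightarrow> real measure" where
  "normal_mixture_law M Y V =
     distr (M \<Otimes>\<^sub>M std_normal_distribution) borel (\<lambda>(\<omega>, z). Y \<omega> + sqrt (V \<omega>) * z)"

context prob_space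
begin

lemma real_distribution_normal_mixture_law:
  assumes [measurable]: "Y \<in> borel_measurable M" "V \<in> borel_measurable M"
  shows "real_distribution (normal_mixture_law M Y V)"
proof -
  interpret N: real_distribution std_normal_distribution by (rule real_dist_normal_dist)
  interpret MN: pair_prob_space M std_normal_distribution ..
  show ?thesis unfolding normal_mixture_law_def by (rule MN.real_distribution_distr) measurable
qed

lemma char_normal_mixture_law:
  assumes [measurable]: "Y \<in> borel_measurable M" "V \<in> borel_measurable M"
    and V: "\<And>\<omega>. \<omega> \<in> space M \<Longrightarrow> 0 \<le> V \<omega>"
  shows "char (normal_mixture_law M Y V) t = mix_char M Y V t"
proof -
  interpret N: real_distribution std_normal_distribution by (rule real_dist_normal_dist)
  interpret MN: pair_prob_space M std_normal_distribution ..
  let ?f = "\<lambda>\<omega> z. iexp (t * (Y \<omega> + sqrt (V \<omega>) * z))"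
  have i: "complex_integrable (M \<Otimes>\<^sub>M std_normal_distribution) (case_prod ?f)"
    by (intro MN.integrable_const_bound[where B = 1] AE_I2) (auto simp: split_beta)
  have "char (normal_mixture_law M Y V) t = (CLINT x|M \<Otimes>\<^sub>M std_normal_distribution. case_prod ?f x)"
    unfolding char_def normal_mixture_law_def by (subst integral_distr) (auto intro!: Bochner_Integration.integral_cong simp: split_beta)
  also have "\<dots> = (CLINT \<omega>|M. CLINT z|std_normal_distribution. ?f \<omega> z)"
    using MN.integral_fst[OF i] by simp
  also have "\<dots> = mix_char M Y V t" unfolding mix_char_def
  proof (rule Bochner_Integration.integral_cong[OF refl])
    fix \<omega> assume \<omega>: "\<omega> \<in> space M"
    have "(CLINT z|std_normal_distribution. ?f \<omega> z) =
      (CLINT z|std_normal_distribution. iexp (t * Y \<omega>) * iexp (t * sqrt (V \<omega>) * z))"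
    proof (rule Bochner_Integration.integral_cong[OF refl])
      show "?f \<omega> z = iexp (t * Y \<omega>) * iexp (t * sqrt (V \<omega>) * z)" for z
        unfolding exp_add[symmetric] by (rule arg_cong[where f = exp]) (simp add: algebra_simps)
    qed
    also have "\<dots> = iexp (t * Y \<omega>) * char std_normal_distribution (t * sqrt (V \<omega>))"
      unfolding char_def by simp
    also have "char std_normal_distribution (t * sqrt (V \<omega>)) = exp (- complex_of_real (t\<^sup>2 / 2 * V \<omega>))"
      unfolding char_std_normal_distribution using V[OF \<omega>] by (simp add: power_mult_distrib exp_of_real[symmetric])
    finally show "(CLINT z|std_normal_distribution. ?f \<omega> z) =
      exp (\<i> * complex_of_real (t * Y \<omega>) - complex_of_real (t\<^sup>2 / 2 * V \<omega>))"
      unfolding diff_conv_add_uminus exp_add .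
  qed
  finally show ?thesis .
qed

text \<open>
$Y$ is the midpoint of $Y + \sqrt V Z$ and $Y - \sqrt V Z$, which have the same law by symmetry of $Z$.
So the mean inherits tightness from the mixture.
\<close>

lemma prob_norm_le_normal_mixture_law:
  assumes [measurable]: "Y \<in> borel_measurable M" "V \<in> borel_measurable M"
  shows "prob_norm M (\<lambda>\<omega>. s * Y \<omega>) \<le> 2 * prob_norm (normal_mixture_law M Y V) (\<lambda>x. s * x)"
proof -
  interpret N: real_distribution std_normal_distribution by (rule real_dist_normal_dist)
  interpret MN: pair_prob_space M std_normal_distribution ..
  let ?f = "\<lambda>\<omega> z. min 1 \<bar>s * (Y \<omega> + sqrt (V \<omega>) * z)\<bar>"
  have i: "integrable (M \<Otimes>\<^sub>M std_normal_distribution) (case_prod ?f)"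
    by (intro MN.integrable_const_bound[where B = 1] AE_I2) (auto simp: split_beta)
  have iz: "integrable std_normal_distribution (\<lambda>z. min 1 \<bar>s * (c + d * z)\<bar>)" for c d
    by (intro N.integrable_const_bound[where B = 1] AE_I2) auto
  have pt: "min 1 \<bar>s * c\<bar> \<le> 2 * (\<integral>z. min 1 \<bar>s * (c + d * z)\<bar> \<partial>std_normal_distribution)" for c d
  proof -
    have "min 1 \<bar>s * c\<bar> = (\<integral>z. min 1 \<bar>s * c\<bar> \<partial>std_normal_distribution)" using N.prob_space by simp
    also have "\<dots> \<le> (\<integral>z. min 1 \<bar>s * (c + d * z)\<bar> + min 1 \<bar>s * (c + d * - z)\<bar> \<partial>std_normal_distribution)"
    proof (rule integral_mono)
      show "integrable std_normal_distribution (\<lambda>z. min 1 \<bar>s * (c + d * z)\<bar> + min 1 \<bar>s * (c + d * - z)\<bar>)"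
        using iz[of c d] iz[of c "- d"] by (intro Bochner_Integration.integrable_add) auto
      fix z
      have "2 * (s * c) = s * (c + d * z) + s * (c + d * - z)" by (simp add: algebra_simps)
      then have "2 * \<bar>s * c\<bar> \<le> \<bar>s * (c + d * z)\<bar> + \<bar>s * (c + d * - z)\<bar>" by linarith
      then show "min 1 \<bar>s * c\<bar> \<le> min 1 \<bar>s * (c + d * z)\<bar> + min 1 \<bar>s * (c + d * - z)\<bar>" by linarith
    qed simp
    also have "\<dots> = (\<integral>z. min 1 \<bar>s * (c + d * z)\<bar> \<partial>std_normal_distribution)
        + (\<integral>z. min 1 \<bar>s * (c + d * - z)\<bar> \<partial>std_normal_distribution)"
      using iz[of c d] iz[of c "- d"] by (intro Bochner_Integration.integral_add) auto
    also have "(\<integral>z. min 1 \<bar>s * (c + d * - z)\<bar> \<partial>std_normal_distribution) = (\<integral>z. min 1 \<bar>s * (c + d * z)\<bar> \<partial>std_normal_distribution)"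
      by (rule integral_std_normal_uminus[of "\<lambda>z. min 1 \<bar>s * (c + d * z)\<bar>"]) measurable
    finally show ?thesis by simp
  qed
  have "prob_norm M (\<lambda>\<omega>. s * Y \<omega>) \<le> (\<integral>\<omega>. 2 * (\<integral>z. ?f \<omega> z \<partial>std_normal_distribution) \<partial>M)"
    unfolding prob_norm_def using MN.integrable_fst'[OF i] pt by (intro integral_mono) auto
  also have "\<dots> = 2 * (\<integral>x. case_prod ?f x \<partial>(M \<Otimes>\<^sub>M std_normal_distribution))"
    using MN.integral_fst[OF i] by simp
  also have "(\<integral>x. case_prod ?f x \<partial>(M \<Otimes>\<^sub>M std_normal_distribution)) = prob_norm (normal_mixture_law M Y V) (\<lambda>x. s * x)"
    unfolding normal_mixture_law_def prob_norm_def by (subst integral_distr) (auto intro!: Bochner_Integration.integral_cong simp: split_beta)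
  finally show ?thesis .
qed

text \<open>
For the mean, the continuity theorem gives weak convergence of the mixtures and the previous lemma transfers
tightness. For the variance, the modulus of the mixture is at most the Laplace transform
$E e^{-t^2 V_n / 2}$, and near $t = 0$ the limit modulus is close to 1.
\<close>

lemma mix_char_convergent_imp_bounded_in_prob:
  assumes m[measurable]: "\<And>n. Y n \<in> borel_measurable M" "\<And>n. V n \<in> borel_measurable M"
    and V: "\<And>n \<omega>. \<omega> \<in> space M \<Longrightarrow> 0 \<le> V n \<omega>"
    and \<nu>: "real_distribution \<nu>" and lim: "\<And>t. (\<lambda>n. mix_char M (Y n) (V n) t) \<longlonglongrightarrow> char \<nu> t"
  shows "bounded_in_prob M Y" "bounded_in_prob M V"
proof -
  interpret \<nu>: real_distribution \<nu> by fact
  show "bounded_in_prob M Y" unfolding bounded_in_prob_def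
  proof (intro allI impI)
    fix \<epsilon> :: real assume \<epsilon>: "\<epsilon> > 0"
    have w: "weak_conv_m (\<lambda>n. normal_mixture_law M (Y n) (V n)) \<nu>"
      using lim by (intro levy_continuity real_distribution_normal_mixture_law \<nu>) (auto simp: char_normal_mixture_law V)
    obtain s where s: "s > 0" "prob_norm \<nu> (\<lambda>x. s * x) \<le> \<epsilon> / 4"
      using \<nu>.prob_norm_small_multiple[of "\<lambda>x. x" "\<epsilon> / 4"] \<epsilon> by auto
    have "(\<lambda>n. prob_norm (normal_mixture_law M (Y n) (V n)) (\<lambda>x. s * x)) \<longlonglongrightarrow> prob_norm \<nu> (\<lambda>x. s * x)"
      unfolding prob_norm_def
      by (rule weak_conv_imp_integral_bdd_continuous_conv[OF real_distribution_normal_mixture_law \<nu> w, where B = 1])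
         (auto intro!: continuous_intros m)
    then have "\<forall>\<^sub>F n in sequentially. prob_norm (normal_mixture_law M (Y n) (V n)) (\<lambda>x. s * x) < \<epsilon> / 2"
      using s \<epsilon> by (intro order_tendstoD(2)) auto
    then have "\<forall>\<^sub>F n in sequentially. prob_norm M (\<lambda>\<omega>. s * Y n \<omega>) \<le> \<epsilon>"
    proof eventually_elim
      case (elim n)
      then show ?case using prob_norm_le_normal_mixture_law[OF m, of s n n] by linarith
    qed
    with s show "\<exists>s>0. \<forall>\<^sub>F n in sequentially. prob_norm M (\<lambda>\<omega>. s * Y n \<omega>) \<le> \<epsilon>" by blast
  qed
  show "bounded_in_prob M V" unfolding bounded_in_prob_def
  proof (intro allI impI)
    fix \<epsilon> :: real assume \<epsilon>: "\<epsilon> > 0"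
    have "(\<lambda>t. cmod (char \<nu> t)) \<midarrow>0\<rightarrow> cmod (char \<nu> 0)"
      using \<nu>.isCont_char[of 0] by (intro tendsto_norm) (simp add: isCont_def)
    then have "\<forall>\<^sub>F t in at 0. cmod (char \<nu> t) > 1 - \<epsilon> / 2"
      using \<epsilon> by (intro order_tendstoD(1)) (auto simp: \<nu>.char_zero)
    then have "\<forall>\<^sub>F t in at 0. t \<noteq> 0 \<and> cmod (char \<nu> t) > 1 - \<epsilon> / 2"
      by (auto simp: eventually_at_filter elim: eventually_mono)
    then obtain t :: real where t: "t \<noteq> 0" "cmod (char \<nu> t) > 1 - \<epsilon> / 2"
      by (auto dest: eventually_happens)
    have "\<forall>\<^sub>F n in sequentially. cmod (mix_char M (Y n) (V n) t) > 1 - \<epsilon> / 2"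
      using t by (intro order_tendstoD(1)[OF tendsto_norm[OF lim]])
    then have "\<forall>\<^sub>F n in sequentially. prob_norm M (\<lambda>\<omega>. t\<^sup>2 / 2 * V n \<omega>) \<le> \<epsilon>"
    proof eventually_elim
      case (elim n)
      define E where "E = (\<integral>\<omega>. exp (- (t\<^sup>2 / 2 * V n \<omega>)) \<partial>M)"
      have "prob_norm M (\<lambda>\<omega>. t\<^sup>2 / 2 * V n \<omega>) \<le> 2 * (1 - E)"
        unfolding E_def using V by (intro prob_norm_le_exp) auto
      moreover have "1 - \<epsilon> / 2 < E"
        unfolding E_def using V elim by (intro less_le_trans[OF elim norm_mix_char_le_1]) auto
      then have "2 * (1 - E) \<le> \<epsilon>" by simp
      ultimately show ?case by (rule order_trans)
    qed
    then show "\<exists>s>0. \<forall>\<^sub>F n in sequentially. prob_norm M (\<lambda>\<omega>. s * V n \<omega>) \<le> \<epsilon>"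
      using t by (intro exI[of _ "t\<^sup>2 / 2"]) auto
  qed
qed

end

lemma (in prob_space) prob_norm_mult_tendsto_0:
  assumes [measurable]: "\<And>n. Z n \<in> borel_measurable M" and "(\<lambda>n. prob_norm M (Z n)) \<longlonglongrightarrow> 0"
  shows "(\<lambda>n. prob_norm M (\<lambda>\<omega>. a * Z n \<omega>)) \<longlonglongrightarrow> 0"
proof (rule tendsto_sandwich[OF _ _ tendsto_const])
  show "(\<lambda>n. (1 + \<bar>a\<bar>) * prob_norm M (Z n)) \<longlonglongrightarrow> 0"
    using tendsto_mult_right_zero[OF assms(2)] .
qed (auto intro!: always_eventually prob_norm_mult_le)

lemma (in prob_space) mix_char_diff_tendsto_0:
  assumes [measurable]: "\<And>n. Y n \<in> borel_measurable M" "\<And>n. V n \<in> borel_measurable M"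
      "\<And>n. Y' n \<in> borel_measurable M" "\<And>n. V' n \<in> borel_measurable M"
    and V: "\<And>n \<omega>. \<omega> \<in> space M \<Longrightarrow> 0 \<le> V n \<omega>" and V': "\<And>n \<omega>. \<omega> \<in> space M \<Longrightarrow> 0 \<le> V' n \<omega>"
    and lim: "(\<lambda>n. prob_norm M (\<lambda>\<omega>. Y n \<omega> - Y' n \<omega>)) \<longlonglongrightarrow> 0" "(\<lambda>n. prob_norm M (\<lambda>\<omega>. V n \<omega> - V' n \<omega>)) \<longlonglongrightarrow> 0"
  shows "(\<lambda>n. mix_char M (Y n) (V n) t - mix_char M (Y' n) (V' n) t) \<longlonglongrightarrow> 0"
proof (rule Lim_null_comparison)
  show "\<forall>\<^sub>F n in sequentially. norm (mix_char M (Y n) (V n) t - mix_char M (Y' n) (V' n) t) \<le>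
      2 * prob_norm M (\<lambda>\<omega>. t * (Y n \<omega> - Y' n \<omega>)) + prob_norm M (\<lambda>\<omega>. t\<^sup>2 / 2 * (V n \<omega> - V' n \<omega>))"
    using V V' by (intro always_eventually allI norm_mix_char_diff_le) auto
  have "(\<lambda>n. 2 * prob_norm M (\<lambda>\<omega>. t * (Y n \<omega> - Y' n \<omega>)) + prob_norm M (\<lambda>\<omega>. t\<^sup>2 / 2 * (V n \<omega> - V' n \<omega>))) \<longlonglongrightarrow> 2 * 0 + 0"
    using lim by (intro tendsto_intros prob_norm_mult_tendsto_0) auto
  then show "(\<lambda>n. 2 * prob_norm M (\<lambda>\<omega>. t * (Y n \<omega> - Y' n \<omega>)) + prob_norm M (\<lambda>\<omega>. t\<^sup>2 / 2 * (V n \<omega> - V' n \<omega>))) \<longlonglongrightarrow> 0" by simp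
qed

lemma mix_char_scale_mean: "mix_char M (\<lambda>\<omega>. a * Y \<omega>) (\<lambda>_. 0) t = mix_char M Y (\<lambda>_. 0) (a * t)"
  by (simp add: mix_char_def mult_ac)

lemma mix_char_scale_var: "mix_char M (\<lambda>_. 0) (\<lambda>\<omega>. a\<^sup>2 * V \<omega>) t = mix_char M (\<lambda>_. 0) V (a * t)"
  by (simp add: mix_char_def mult_ac power_mult_distrib)

lemma mix_char_centred: "mix_char M (\<lambda>_. 0) V t = complex_of_real (\<integral>\<omega>. exp (- (t\<^sup>2 / 2 * V \<omega>)) \<partial>M)"
proof -
  have "exp (\<i> * complex_of_real (t * 0) - complex_of_real (t\<^sup>2 / 2 * V \<omega>)) = complex_of_real (exp (- (t\<^sup>2 / 2 * V \<omega>)))" for \<omega>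
    unfolding exp_of_real[symmetric] by simp
  then show ?thesis unfolding mix_char_def by (simp only: integral_complex_of_real)
qed

section \<open>Degenerate limits and ratios of scales\<close>

lemma real_distribution_return: "real_distribution (return borel x)"
proof -
  interpret prob_space "return borel (x :: real)" by (rule prob_space_return) simp
  show ?thesis by standard simp_all
qed

lemma char_return: "char (return borel x) t = iexp (t * x)"
  unfolding char_def by (subst integral_return) auto

lemma AE_const_imp_eq_return:
  assumes \<nu>: "real_distribution \<nu>" and c: "AE y in \<nu>. y = c"
  shows "\<nu> = return borel c"
proof (rule Levy_uniqueness[OF \<nu> real_distribution_return], rule ext)
  interpret real_distribution \<nu> by fact
  fix t
  have "char \<nu> t = (CLINT y|\<nu>. iexp (t * c))"
    unfolding char_def by (rule integral_cong_AE) (use c in auto)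
  then show "char \<nu> t = char (return borel c) t" using prob_space by (simp add: char_return)
qed

text \<open>
If the modulus is 1 everywhere, then the difference of two independent copies has characteristic function 1,
so it vanishes almost surely and the law is a point mass.
\<close>

lemma nondegenerate_imp_norm_char_less_1:
  assumes \<nu>: "real_distribution \<nu>" and nd: "nondegenerate \<nu>"
  shows "\<exists>u. cmod (char \<nu> u) < 1"
proof (rule ccontr)
  assume neg: "\<nexists>u. cmod (char \<nu> u) < 1"
  interpret real_distribution \<nu> by fact
  interpret P: pair_prob_space \<nu> \<nu> ..
  have one: "cmod (char \<nu> t) = 1" for t using neg cmod_char_le_1[of t] by (metis antisym not_less)
  let ?D = "distr (\<nu> \<Otimes>\<^sub>M \<nu>) borel (\<lambda>(x, y). x - y)"
  have "?D = return borel 0"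
  proof (rule Levy_uniqueness)
    show "real_distribution ?D" by (rule P.real_distribution_distr) measurable
    show "real_distribution (return borel 0)" by (rule real_distribution_return)
    show "char ?D = char (return borel 0)"
    proof
      fix t
      have neg_char: "char \<nu> (- t) = cnj (char \<nu> t)"
      proof -
        have "cnj (iexp (t * x)) = iexp (- t * x)" for x by (simp add: exp_cnj)
        then have "char \<nu> (- t) = (CLINT x|\<nu>. cnj (iexp (t * x)))" unfolding char_def by simp
        also have "\<dots> = cnj (char \<nu> t)" unfolding char_def by (rule Bochner_Integration.integral_cnj)
        finally show ?thesis .
      qed
      have i: "complex_integrable (\<nu> \<Otimes>\<^sub>M \<nu>) (\<lambda>(x, y). iexp (t * (x - y)))"
        by (intro P.integrable_const_bound[where B = 1] AE_I2) (auto simp: split_beta)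
      have "char ?D t = (CLINT z|\<nu> \<Otimes>\<^sub>M \<nu>. (\<lambda>(x, y). iexp (t * (x - y))) z)"
        unfolding char_def by (subst integral_distr) (auto intro!: Bochner_Integration.integral_cong simp: split_beta)
      also have "\<dots> = (CLINT x|\<nu>. CLINT y|\<nu>. iexp (t * (x - y)))"
        by (rule P.integral_fst[OF i, symmetric])
      also have "\<dots> = (CLINT x|\<nu>. CLINT y|\<nu>. iexp (t * x) * iexp (- t * y))"
      proof (intro Bochner_Integration.integral_cong refl)
        show "iexp (t * (x - y)) = iexp (t * x) * iexp (- t * y)" for x y
          unfolding exp_add[symmetric] by (rule arg_cong[where f = exp]) (simp add: algebra_simps)
      qed
      also have "\<dots> = char \<nu> t * char \<nu> (- t)" unfolding char_def by simp
      also have "\<dots> = 1" unfolding neg_char complex_norm_square[symmetric] one by simp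
      finally show "char ?D t = char (return borel 0) t" by (simp add: char_return)
    qed
  qed
  moreover have "AE z in return borel (0 :: real). z = 0" by (subst AE_return) auto
  ultimately have "AE z in ?D. z = 0" by (simp only:)
  then have "AE z in \<nu> \<Otimes>\<^sub>M \<nu>. (\<lambda>(x, y). x - y) z = 0"
    by (subst (asm) AE_distr_iff) auto
  then have "AE x in \<nu>. AE y in \<nu>. x = y" using P.AE_pair[of "\<lambda>z. (\<lambda>(x, y). x - y) z = 0"] by auto
  then obtain x0 where "AE y in \<nu>. x0 = y"
    using eventually_happens'[OF ae_filter_bot] by blast
  then have "\<nu> = return borel x0" by (intro AE_const_imp_eq_return \<nu>) auto
  then show False using nd unfolding nondegenerate_def by blast
qed

text \<open>
A form of the convergence of types theorem that uses only one function of the limit. Along a subsequence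
with $\kappa_n \to k$ the hypotheses give $g(t) = g(k t)$; if $k \ne 1$, iterating towards
the origin gives $g(u) = g(0) = 1$. Taking for $g$ the modulus of a characteristic function removes the
centring constants from the comparison.
\<close>

lemma scale_ratio_tendsto_1:
  fixes G :: "nat \<Rightarrow> real \<Rightarrow> real" and g :: "real \<Rightarrow> real" and \<kappa> :: "nat \<Rightarrow> real"
  assumes lim: "\<And>t. (\<lambda>n. G n t) \<longlonglongrightarrow> g t"
    and equi: "\<And>t e. e > 0 \<Longrightarrow> \<exists>h>0. \<exists>N. \<forall>n\<ge>N. \<forall>t'. \<bar>t' - t\<bar> < h \<longrightarrow> \<bar>G n t' - G n t\<bar> < e"
    and cont: "isCont g 0" "g 0 = 1" and nonconst: "g u \<noteq> 1"
    and C: "C > 0" and \<kappa>: "\<And>n. n \<ge> N0 \<Longrightarrow> 1 / C \<le> \<kappa> n \<and> \<kappa> n \<le> C"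
    and rel: "\<And>t. (\<lambda>n. G (m * n) t - G n (\<kappa> n * t)) \<longlonglongrightarrow> 0" and m: "m \<ge> 1"
  shows "\<kappa> \<longlonglongrightarrow> 1"
proof (rule ccontr)
  assume "\<not> \<kappa> \<longlonglongrightarrow> 1"
  then obtain e where e: "e > 0" and far: "\<And>N. \<exists>n\<ge>N. \<not> \<bar>\<kappa> n - 1\<bar> < e"
    unfolding LIMSEQ_iff by fastforce
  have "infinite {n. n \<ge> N0 \<and> \<not> \<bar>\<kappa> n - 1\<bar> < e}"
    unfolding infinite_nat_iff_unbounded_le using far by (metis (mono_tags, lifting) le_trans linear mem_Collect_eq)
  then obtain r1 :: "nat \<Rightarrow> nat" where r1: "strict_mono r1" "\<And>n. r1 n \<ge> N0 \<and> \<not> \<bar>\<kappa> (r1 n) - 1\<bar> < e"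
    using infinite_enumerate[of "{n. n \<ge> N0 \<and> \<not> \<bar>\<kappa> n - 1\<bar> < e}"] by auto
  have "\<forall>n. (\<kappa> \<circ> r1) n \<in> {1 / C..C}" using r1 \<kappa> by auto
  then obtain k r2 where k: "k \<in> {1 / C..C}" and r2: "strict_mono (r2 :: nat \<Rightarrow> nat)" "((\<kappa> \<circ> r1) \<circ> r2) \<longlonglongrightarrow> k"
    using compact_Icc[of "1 / C" C] unfolding compact_eq_seq_compact_metric seq_compact_def by metis
  define r where "r = r1 \<circ> r2"
  have r: "strict_mono r" unfolding r_def using r1(1) r2(1) by (rule strict_mono_o)
  have kl: "(\<lambda>n. \<kappa> (r n)) \<longlonglongrightarrow> k" using r2(2) by (simp add: r_def o_def)
  have "(\<lambda>n. \<bar>\<kappa> (r n) - 1\<bar>) \<longlonglongrightarrow> \<bar>k - 1\<bar>" using kl by (intro tendsto_intros)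
  then have "e \<le> \<bar>k - 1\<bar>"
    using r1(2) by (intro LIMSEQ_le_const) (auto simp: r_def not_less)
  then have k1: "k \<noteq> 1" using e by auto
  have k0: "k > 0" using k C by (auto intro: less_le_trans[of 0 "1 / C"])
  have inv: "g t = g (k * t)" for t
  proof -
    have l1: "(\<lambda>n. G (r n) (\<kappa> (r n) * t)) \<longlonglongrightarrow> g (k * t)"
    proof -
      have "(\<lambda>n. G (r n) (\<kappa> (r n) * t) - G (r n) (k * t)) \<longlonglongrightarrow> 0"
      proof (rule LIMSEQ_I)
        fix e' :: real assume "e' > 0"
        from equi[OF this, of "k * t"] obtain h N where h: "h > 0"
          "\<And>n t'. n \<ge> N \<Longrightarrow> \<bar>t' - k * t\<bar> < h \<Longrightarrow> \<bar>G n t' - G n (k * t)\<bar> < e'" by blast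
        have "(\<lambda>n. \<kappa> (r n) * t) \<longlonglongrightarrow> k * t" using kl by (intro tendsto_intros)
        from LIMSEQ_D[OF this h(1)] obtain N' where N': "\<And>n. n \<ge> N' \<Longrightarrow> \<bar>\<kappa> (r n) * t - k * t\<bar> < h" by auto
        show "\<exists>no. \<forall>n\<ge>no. norm (G (r n) (\<kappa> (r n) * t) - G (r n) (k * t) - 0) < e'"
        proof (intro exI[of _ "max N N'"] allI impI)
          fix n assume "n \<ge> max N N'"
          then show "norm (G (r n) (\<kappa> (r n) * t) - G (r n) (k * t) - 0) < e'"
            using h(2)[of "r n" "\<kappa> (r n) * t"] N'[of n] seq_suble[OF r, of n] by auto
        qed
      qed
      moreover have "(\<lambda>n. G (r n) (k * t)) \<longlonglongrightarrow> g (k * t)"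
        using LIMSEQ_subseq_LIMSEQ[OF lim r] by (simp add: o_def)
      ultimately have "(\<lambda>n. (G (r n) (\<kappa> (r n) * t) - G (r n) (k * t)) + G (r n) (k * t)) \<longlonglongrightarrow> 0 + g (k * t)"
        by (rule tendsto_add)
      then show ?thesis by simp
    qed
    have "strict_mono (\<lambda>n. m * r n)" using m strict_monoD[OF r] by (auto simp: strict_mono_def)
    from LIMSEQ_subseq_LIMSEQ[OF lim this] have l2: "(\<lambda>n. G (m * r n) t) \<longlonglongrightarrow> g t" by (simp add: o_def)
    have "(\<lambda>n. G (m * r n) t - G (r n) (\<kappa> (r n) * t)) \<longlonglongrightarrow> 0"
      using LIMSEQ_subseq_LIMSEQ[OF rel r] by (simp add: o_def)
    with tendsto_diff[OF l2 l1] have "g t - g (k * t) = 0" by (rule LIMSEQ_unique)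
    then show ?thesis by simp
  qed
  have contract: "g u = 1" if q: "0 < q" "q < 1" and inv: "\<And>t. g t = g (q * t)" for q
  proof -
    have "g (q ^ j * u) = g u" for j
      by (induction j) (simp_all add: mult.assoc inv[symmetric])
    moreover have "(\<lambda>j. g (q ^ j * u)) \<longlonglongrightarrow> g (0 * u)"
      using cont q by (intro isCont_tendsto_compose[where g = g] tendsto_intros LIMSEQ_power_zero) auto
    ultimately have "(\<lambda>_::nat. g u) \<longlonglongrightarrow> 1" using cont by simp
    then show ?thesis by (simp add: tendsto_const_iff)
  qed
  have "g u = 1"
  proof (cases "k < 1")
    case True
    then show ?thesis using contract[of k] k0 inv by blast
  next
    case False
    have "g t = g (1 / k * t)" for t using inv[of "1 / k * t"] k0 by simp
    then show ?thesis using contract[of "1 / k"] False k1 by simp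
  qed
  then show False using nonconst by simp
qed

section \<open>Scaling families\<close>

text \<open>
The properties of truncated means $Y_n$ and variances $V_n$ that the direct implication
rests on. The random variables $Q_m$ bound the effect of lowering the truncation level from $\tau b_n$ to $\tau b_m$;
the direction $b_m \le b_n$ is the one in which the tail beyond the smaller level controls the error.
\<close>

locale scaling_family = prob_space M for M :: "'a measure" +
  fixes Y V Q :: "nat \<Rightarrow> 'a \<Rightarrow> real" and b :: "nat \<Rightarrow> real" and \<nu> :: "real measure"
  assumes Y_meas [measurable]: "\<And>n. Y n \<in> borel_measurable M"
    and V_meas [measurable]: "\<And>n. V n \<in> borel_measurable M"
    and Q_meas [measurable]: "\<And>n. Q n \<in> borel_measurable M"
    and V_nonneg: "\<And>n \<omega>. \<omega> \<in> space M \<Longrightarrow> 0 \<le> V n \<omega>"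
    and Q_lim: "(\<lambda>n. prob_norm M (Q n)) \<longlonglongrightarrow> 0"
    and b_pos: "\<And>n. n \<ge> 1 \<Longrightarrow> b n > 0"
    and compare: "\<And>n m. n \<ge> 1 \<Longrightarrow> m \<ge> 1 \<Longrightarrow> b m \<le> b n \<Longrightarrow> \<exists>d. \<forall>\<omega>\<in>space M.
        \<bar>Y n \<omega> - (real n * b m / (real m * b n)) * Y m \<omega> - d\<bar> \<le> real n / real m * \<bar>Q m \<omega>\<bar> \<and>
        \<bar>V n \<omega> - (real n * (b m)\<^sup>2 / (real m * (b n)\<^sup>2)) * V m \<omega>\<bar> \<le> real n / real m * \<bar>Q m \<omega>\<bar>"
    and real_distribution_limit: "real_distribution \<nu>"
    and nondegenerate_limit: "nondegenerate \<nu>"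
    and mix_char_lim: "\<And>t. (\<lambda>n. mix_char M (Y n) (V n) t) \<longlonglongrightarrow> char \<nu> t"
begin

definition mean_factor :: "nat \<Rightarrow> nat \<Rightarrow> real" where
  "mean_factor n m = real n * b m / (real m * b n)"

definition var_factor :: "nat \<Rightarrow> nat \<Rightarrow> real" where
  "var_factor n m = real n * (b m)\<^sup>2 / (real m * (b n)\<^sup>2)"

text \<open>
The constant $d$ may depend on both indices; only its being deterministic matters.
\<close>

definition scaled_close :: "nat \<Rightarrow> nat \<Rightarrow> real \<Rightarrow> bool" where
  "scaled_close n m e \<longleftrightarrow>
     (\<exists>d. prob_norm M (\<lambda>\<omega>. Y n \<omega> - (mean_factor n m * Y m \<omega> + d)) \<le> e) \<and>
     prob_norm M (\<lambda>\<omega>. V n \<omega> - var_factor n m * V m \<omega>) \<le> e"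

lemma factor_pos:
  assumes "n \<ge> 1" "m \<ge> 1"
  shows "mean_factor n m > 0" "var_factor n m > 0"
  using assms b_pos[of n] b_pos[of m] by (auto simp: mean_factor_def var_factor_def)

lemma factor_inverse:
  assumes "n \<ge> 1" "m \<ge> 1"
  shows "mean_factor n m * mean_factor m n = 1" "var_factor n m * var_factor m n = 1"
  using assms b_pos[of n] b_pos[of m] by (auto simp: mean_factor_def var_factor_def field_simps)

lemma var_factor_eq:
  assumes "n \<ge> 1" "m \<ge> 1"
  shows "var_factor n m = (mean_factor n m)\<^sup>2 * (real m / real n)"
  using assms b_pos[of n] b_pos[of m] by (auto simp: mean_factor_def var_factor_def field_simps power2_eq_square)

lemma bounded_Y: "bounded_in_prob M Y" and bounded_V: "bounded_in_prob M V"
  by (rule mix_char_convergent_imp_bounded_in_prob[OF Y_meas V_meas V_nonneg real_distribution_limit mix_char_lim]; assumption)+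

lemma bounded_in_probD:
  assumes "bounded_in_prob M Z" "\<epsilon> > 0"
  obtains s N where "s > 0" "\<And>n. n \<ge> N \<Longrightarrow> prob_norm M (\<lambda>\<omega>. s * Z n \<omega>) \<le> \<epsilon>"
  using assms unfolding bounded_in_prob_def eventually_sequentially by blast

text \<open>
The quantitative form of nondegeneracy: at one fixed argument $u$ the mixtures stay away from modulus 1.
\<close>

lemma norm_limit_char_gap:
  obtains u \<eta> N where "\<eta> > 0" "\<And>n. n \<ge> N \<Longrightarrow> cmod (mix_char M (Y n) (V n) u) < 1 - 3 * \<eta>"
proof -
  obtain u where u: "cmod (char \<nu> u) < 1"
    using nondegenerate_imp_norm_char_less_1[OF real_distribution_limit nondegenerate_limit] by blast
  define \<eta> where "\<eta> = (1 - cmod (char \<nu> u)) / 4"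
  have "\<eta> > 0" using u by (simp add: \<eta>_def)
  moreover have "\<forall>\<^sub>F n in sequentially. cmod (mix_char M (Y n) (V n) u) < 1 - 3 * \<eta>"
    using u by (intro order_tendstoD(2)[OF tendsto_norm[OF mix_char_lim]]) (simp add: \<eta>_def field_simps)
  ultimately show thesis using that by (auto simp: eventually_sequentially)
qed

lemma Q_small:
  assumes "K > 0" "\<epsilon> > 0"
  obtains N where "\<And>n. n \<ge> N \<Longrightarrow> K * prob_norm M (Q n) \<le> \<epsilon>"
proof -
  have "\<forall>\<^sub>F n in sequentially. prob_norm M (Q n) < \<epsilon> / K"
    using assms by (intro order_tendstoD(2)[OF Q_lim]) auto
  then obtain N where N: "\<And>n. n \<ge> N \<Longrightarrow> prob_norm M (Q n) < \<epsilon> / K" by (auto simp: eventually_sequentially)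
  have "K * prob_norm M (Q n) \<le> \<epsilon>" if "n \<ge> N" for n
    using N[OF that] \<open>K > 0\<close> by (simp add: field_simps)
  then show thesis by (rule that)
qed

lemma mix_char_zero: "mix_char M (\<lambda>_. 0) (\<lambda>_. 0) t = 1"
  by (simp add: mix_char_def prob_space)

lemma norm_mix_char_ge:
  assumes [measurable]: "W \<in> borel_measurable M" "U \<in> borel_measurable M" and "\<And>\<omega>. \<omega> \<in> space M \<Longrightarrow> 0 \<le> U \<omega>"
  shows "cmod (mix_char M W U t) \<ge> 1 - 2 * prob_norm M (\<lambda>\<omega>. t * W \<omega>) - prob_norm M (\<lambda>\<omega>. t\<^sup>2 / 2 * U \<omega>)"
proof -
  have "cmod (mix_char M W U t - 1) \<le> 2 * prob_norm M (\<lambda>\<omega>. t * W \<omega>) + prob_norm M (\<lambda>\<omega>. t\<^sup>2 / 2 * U \<omega>)"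
    using norm_mix_char_diff_le[of W U "\<lambda>_. 0" "\<lambda>_. 0" t] assms by (simp add: mix_char_zero)
  then show ?thesis using norm_triangle_ineq3[of "mix_char M W U t" 1] by simp
qed

lemma norm_mix_char_shift: "cmod (mix_char M (\<lambda>\<omega>. W \<omega> + d) U t) = cmod (mix_char M W U t)"
  by (simp add: mix_char_shift norm_mult del: of_real_mult)

lemma compare_prob_norm:
  assumes n: "n \<ge> 1" and m: "m \<ge> 1" and le: "b m \<le> b n" and L: "L \<ge> 1" "real n \<le> L * real m"
  obtains d where "prob_norm M (\<lambda>\<omega>. Y n \<omega> - (mean_factor n m * Y m \<omega> + d)) \<le> L * prob_norm M (Q m)"
    "prob_norm M (\<lambda>\<omega>. V n \<omega> - var_factor n m * V m \<omega>) \<le> L * prob_norm M (Q m)"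
proof -
  obtain d where d: "\<And>\<omega>. \<omega> \<in> space M \<Longrightarrow> \<bar>Y n \<omega> - mean_factor n m * Y m \<omega> - d\<bar> \<le> real n / real m * \<bar>Q m \<omega>\<bar>"
    "\<And>\<omega>. \<omega> \<in> space M \<Longrightarrow> \<bar>V n \<omega> - var_factor n m * V m \<omega>\<bar> \<le> real n / real m * \<bar>Q m \<omega>\<bar>"
    using compare[OF n m le] unfolding mean_factor_def var_factor_def by blast
  have "real n / real m \<le> L" using L m by (simp add: divide_le_eq)
  then have nm: "real n / real m * \<bar>Q m \<omega>\<bar> \<le> L * \<bar>Q m \<omega>\<bar>" for \<omega> by (rule mult_right_mono) simp
  show thesis
  proof (rule that)
    show "prob_norm M (\<lambda>\<omega>. Y n \<omega> - (mean_factor n m * Y m \<omega> + d)) \<le> L * prob_norm M (Q m)"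
      using order_trans[OF d(1) nm] L by (intro prob_norm_scale) (auto simp: diff_diff_eq)
    show "prob_norm M (\<lambda>\<omega>. V n \<omega> - var_factor n m * V m \<omega>) \<le> L * prob_norm M (Q m)"
      using order_trans[OF d(2) nm] L by (intro prob_norm_scale) auto
  qed
qed

lemma factor_le:
  assumes "n \<ge> 1" "m \<ge> 1" "real n \<le> L * real m" "b m \<le> C * b n"
  shows "mean_factor n m \<le> L * C" "var_factor n m \<le> L * C\<^sup>2"
proof -
  have b: "b n > 0" "b m > 0" using b_pos assms by auto
  have nm: "real n / real m \<le> L" "0 \<le> real n / real m" using assms by (auto simp: divide_le_eq)
  then have L: "0 \<le> L" by linarith
  have r: "b m / b n \<le> C" "0 \<le> b m / b n" using assms b by (auto simp: divide_le_eq)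
  have "mean_factor n m = real n / real m * (b m / b n)" by (simp add: mean_factor_def)
  also have "\<dots> \<le> L * C" using nm r L by (intro mult_mono) auto
  finally show "mean_factor n m \<le> L * C" .
  have "var_factor n m = real n / real m * (b m / b n)\<^sup>2" by (simp add: var_factor_def power_divide)
  also have "\<dots> \<le> L * C\<^sup>2" using nm r L by (intro mult_mono power_mono) auto
  finally show "var_factor n m \<le> L * C\<^sup>2" .
qed

text \<open>
If $b_n$ were much larger than $b_m$, then both factors would be tiny, so $Y_n$ and $V_n$ would be almost
$d$ and 0 by tightness of $Y_m$ and $V_m$; the mixture at $n$ would then have modulus close to 1 at $u$.
\<close>

lemma ratio_bounded:
  assumes L: "L \<ge> 1"
  shows "\<exists>C\<ge>1. \<exists>N. \<forall>n\<ge>N. \<forall>m\<ge>N. real n \<le> L * real m \<longrightarrow> b n \<le> C * b m"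
proof -
  obtain u \<eta> N0 where \<eta>: "\<eta> > 0" and gap: "\<And>n. n \<ge> N0 \<Longrightarrow> cmod (mix_char M (Y n) (V n) u) < 1 - 3 * \<eta>"
    by (rule norm_limit_char_gap) blast
  obtain s N1 where s: "s > 0" and sY: "\<And>n. n \<ge> N1 \<Longrightarrow> prob_norm M (\<lambda>\<omega>. s * Y n \<omega>) \<le> \<eta> / 4"
    using bounded_in_probD[OF bounded_Y, of "\<eta> / 4"] \<eta> by auto
  obtain r N2 where r: "r > 0" and rV: "\<And>n. n \<ge> N2 \<Longrightarrow> prob_norm M (\<lambda>\<omega>. r * V n \<omega>) \<le> \<eta> / 2"
    using bounded_in_probD[OF bounded_V, of "\<eta> / 2"] \<eta> by auto
  \<comment> \<open>A common bound for the error factors in the mean and in the variance at argument $u$.\<close>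
  define K where "K = (1 + \<bar>u\<bar> + u\<^sup>2 / 2) * L"
  have K: "K > 0" using L by (simp add: K_def add_pos_nonneg)
  obtain N3 where N3: "\<And>n. n \<ge> N3 \<Longrightarrow> K * prob_norm M (Q n) \<le> \<eta> / 4"
    using Q_small[of K "\<eta> / 4"] K \<eta> by auto
  \<comment> \<open>Beyond this ratio, the factors times $u$ and $u^2/2$ fall below the tightness scales $s$ and $r$.\<close>
  define C where "C = 1 + \<bar>u\<bar> * L / s + u\<^sup>2 / 2 * L / r"
  have C1: "C \<ge> 1" using L s r by (simp add: C_def)
  show ?thesis
  proof (intro exI[of _ C] conjI exI[of _ "Max {1, N0, N1, N2, N3}"] allI impI)
    fix n m assume nm: "n \<ge> Max {1, N0, N1, N2, N3}" "m \<ge> Max {1, N0, N1, N2, N3}" and nL: "real n \<le> L * real m"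
    then have n: "n \<ge> 1" "n \<ge> N0" and m: "m \<ge> 1" "m \<ge> N1" "m \<ge> N2" "m \<ge> N3" by auto
    have bn: "b n > 0" and bm: "b m > 0" using b_pos n m by auto
    show "b n \<le> C * b m"
    proof (rule ccontr)
      assume "\<not> b n \<le> C * b m"
      then have big: "C * b m < b n" by simp
      then have le: "b m \<le> b n" using mult_right_mono[OF C1, of "b m"] bm by linarith
      let ?A = "mean_factor n m" and ?B = "var_factor n m"
      obtain d where d: "prob_norm M (\<lambda>\<omega>. Y n \<omega> - (?A * Y m \<omega> + d)) \<le> L * prob_norm M (Q m)"
        "prob_norm M (\<lambda>\<omega>. V n \<omega> - ?B * V m \<omega>) \<le> L * prob_norm M (Q m)"
        by (rule compare_prob_norm[OF n(1) m(1) le L nL])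
      have "b m \<le> 1 / C * b n" using big C1 by (simp add: field_simps)
      note AB = factor_le[OF n(1) m(1) nL this]
      have "(1 / C)\<^sup>2 \<le> 1 / C" using C1 by (simp add: power2_eq_square field_simps)
      then have B: "?B \<le> L * (1 / C)" using AB(2) L mult_left_mono[of "(1 / C)\<^sup>2" "1 / C" L] by linarith
      have uA: "\<bar>u\<bar> * ?A \<le> s"
      proof -
        have "\<bar>u\<bar> * L / s \<le> C" using L r by (simp add: C_def)
        then have "\<bar>u\<bar> * (L * (1 / C)) \<le> s" using s C1 by (simp add: field_simps)
        with mult_left_mono[OF AB(1) abs_ge_zero] show ?thesis by (rule order_trans)
      qed
      have uB: "u\<^sup>2 / 2 * ?B \<le> r"
      proof -
        have "u\<^sup>2 / 2 * L / r \<le> C" using L s by (simp add: C_def)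
        then have "u\<^sup>2 / 2 * (L * (1 / C)) \<le> r" using r C1 by (simp add: field_simps)
        moreover have "u\<^sup>2 / 2 * ?B \<le> u\<^sup>2 / 2 * (L * (1 / C))" by (rule mult_left_mono[OF B]) simp
        ultimately show ?thesis by (rule order_trans[rotated])
      qed
      have pos: "?A > 0" "?B > 0" using factor_pos n m by auto
      let ?Y = "\<lambda>\<omega>. ?A * Y m \<omega>" and ?V = "\<lambda>\<omega>. ?B * V m \<omega>"
      have err: "prob_norm M (\<lambda>\<omega>. a * Z \<omega>) \<le> \<eta> / 4"
        if [measurable]: "Z \<in> borel_measurable M" and Z: "prob_norm M Z \<le> L * prob_norm M (Q m)"
          and a: "\<bar>a\<bar> \<le> \<bar>u\<bar> + u\<^sup>2 / 2" for Z a
      proof -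
        have "prob_norm M (\<lambda>\<omega>. a * Z \<omega>) \<le> (1 + \<bar>a\<bar>) * prob_norm M Z" by (rule prob_norm_mult_le) measurable
        also have "\<dots> \<le> (1 + \<bar>u\<bar> + u\<^sup>2 / 2) * (L * prob_norm M (Q m))" using a Z by (intro mult_mono) auto
        also have "\<dots> \<le> \<eta> / 4" using N3[OF m(4)] by (simp only: K_def mult.assoc)
        finally show ?thesis .
      qed
      have "cmod (mix_char M (Y n) (V n) u - mix_char M (\<lambda>\<omega>. ?Y \<omega> + d) ?V u) \<le>
          2 * prob_norm M (\<lambda>\<omega>. u * (Y n \<omega> - (?Y \<omega> + d))) + prob_norm M (\<lambda>\<omega>. u\<^sup>2 / 2 * (V n \<omega> - ?V \<omega>))"
        using V_nonneg pos by (intro norm_mix_char_diff_le) auto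
      also have "\<dots> \<le> 2 * (\<eta> / 4) + \<eta> / 4"
        using d by (intro add_mono mult_left_mono err) auto
      finally have close: "cmod (mix_char M (Y n) (V n) u - mix_char M (\<lambda>\<omega>. ?Y \<omega> + d) ?V u) \<le> 3 * (\<eta> / 4)" by simp
      have f1: "prob_norm M (\<lambda>\<omega>. u * ?Y \<omega>) \<le> \<eta> / 4"
      proof (rule order_trans[OF prob_norm_mono sY[OF m(2)]])
        show "\<bar>u * ?Y \<omega>\<bar> \<le> \<bar>s * Y m \<omega>\<bar>" for \<omega>
          using mult_right_mono[OF uA, of "\<bar>Y m \<omega>\<bar>"] pos s by (simp add: abs_mult mult.assoc)
      qed auto
      have f2: "prob_norm M (\<lambda>\<omega>. u\<^sup>2 / 2 * ?V \<omega>) \<le> \<eta> / 2"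
      proof (rule order_trans[OF prob_norm_mono rV[OF m(3)]])
        show "\<bar>u\<^sup>2 / 2 * ?V \<omega>\<bar> \<le> \<bar>r * V m \<omega>\<bar>" for \<omega>
          using mult_right_mono[OF uB, of "\<bar>V m \<omega>\<bar>"] pos r by (simp add: abs_mult mult.assoc)
      qed auto
      have "cmod (mix_char M ?Y ?V u) \<ge> 1 - 2 * prob_norm M (\<lambda>\<omega>. u * ?Y \<omega>) - prob_norm M (\<lambda>\<omega>. u\<^sup>2 / 2 * ?V \<omega>)"
        using V_nonneg pos by (intro norm_mix_char_ge) auto
      then have "cmod (mix_char M (\<lambda>\<omega>. ?Y \<omega> + d) ?V u) \<ge> 1 - \<eta>"
        using f1 f2 unfolding norm_mix_char_shift by linarith
      then have "cmod (mix_char M (Y n) (V n) u) \<ge> 1 - \<eta> - 3 * (\<eta> / 4)"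
        using close norm_triangle_ineq3[of "mix_char M (Y n) (V n) u" "mix_char M (\<lambda>\<omega>. ?Y \<omega> + d) ?V u"] by linarith
      then show False using gap[OF n(2)] \<eta> by linarith
    qed
  qed (rule C1)
qed

text \<open>
The scaling relation for all pairs of bounded ratio. If $b_n < b_m$, the relation is used in the other
direction and solved for the quantities at $n$; the bound on $b_m / b_n$ controls the error after division.
\<close>

lemma comparable:
  assumes L: "L \<ge> 1" and e: "e > 0"
  obtains N where "N \<ge> 1" "\<forall>n\<ge>N. \<forall>m\<ge>N. real n \<le> L * real m \<longrightarrow> real m \<le> L * real n \<longrightarrow> scaled_close n m e"
proof -
  obtain C N1 where C: "C \<ge> 1" and ratio: "\<And>n m. n \<ge> N1 \<Longrightarrow> m \<ge> N1 \<Longrightarrow> real n \<le> L * real m \<Longrightarrow> b n \<le> C * b m"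
    using ratio_bounded[OF L] by blast
  define K where "K = 1 + L * C\<^sup>2"
  have "C \<le> C\<^sup>2" using C by (simp add: power2_eq_square)
  then have "L * C \<le> L * C\<^sup>2" using L by simp
  then have K: "K \<ge> 1" "1 + L * C \<le> K" "1 + L * C\<^sup>2 \<le> K" using L C by (simp_all add: K_def)
  obtain N2 where N2: "\<And>n. n \<ge> N2 \<Longrightarrow> K * L * prob_norm M (Q n) \<le> e" using Q_small[of "K * L" e] K L e by auto
  have core: "scaled_close n m e"
    if nm: "n \<ge> Max {1, N1, N2}" "m \<ge> Max {1, N1, N2}" and r: "real n \<le> L * real m" "real m \<le> L * real n" for n m
  proof -
    from nm have n: "n \<ge> 1" "n \<ge> N1" "n \<ge> N2" and m: "m \<ge> 1" "m \<ge> N1" "m \<ge> N2" by auto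
    have mono: "L * prob_norm M (Q k) \<le> K * L * prob_norm M (Q k)" for k
      using K(1) L mult_right_mono[of 1 K "L * prob_norm M (Q k)"] by (simp add: mult.assoc)
    show ?thesis
    proof (cases "b m \<le> b n")
      case True
      from compare_prob_norm[OF n(1) m(1) True L r(1)] show ?thesis
        using N2[OF m(3)] mono[of m] unfolding scaled_close_def by (meson order_trans)
    next
      case False
      then have "b n \<le> b m" by simp
      then obtain d where d: "prob_norm M (\<lambda>\<omega>. Y m \<omega> - (mean_factor m n * Y n \<omega> + d)) \<le> L * prob_norm M (Q n)"
        "prob_norm M (\<lambda>\<omega>. V m \<omega> - var_factor m n * V n \<omega>) \<le> L * prob_norm M (Q n)"
        using compare_prob_norm[OF m(1) n(1) _ L r(2)] by blast
      let ?A = "mean_factor n m" and ?B = "var_factor n m"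
      note le = factor_le[OF n(1) m(1) r(1) ratio[OF m(2) n(2) r(2)]]
      have err: "prob_norm M (\<lambda>\<omega>. - a * Z \<omega>) \<le> e"
        if [measurable]: "Z \<in> borel_measurable M" and Z: "prob_norm M Z \<le> L * prob_norm M (Q n)"
          and a: "0 < a" "1 + a \<le> K" for Z a
      proof -
        have "prob_norm M (\<lambda>\<omega>. - a * Z \<omega>) \<le> (1 + \<bar>- a\<bar>) * prob_norm M Z" by (rule prob_norm_mult_le) measurable
        also have "\<dots> \<le> K * (L * prob_norm M (Q n))" using a Z by (intro mult_mono) auto
        also have "\<dots> \<le> e" using N2[OF n(3)] by (simp only: mult.assoc)
        finally show ?thesis .
      qed
      have pos: "?A > 0" "?B > 0" using factor_pos n m by auto
      have "Y n \<omega> - (?A * Y m \<omega> + - ?A * d) = - ?A * (Y m \<omega> - (mean_factor m n * Y n \<omega> + d))" for \<omega>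
        using factor_inverse(1)[OF n(1) m(1)] by (simp add: algebra_simps mult.assoc[symmetric])
      moreover have "prob_norm M (\<lambda>\<omega>. - ?A * (Y m \<omega> - (mean_factor m n * Y n \<omega> + d))) \<le> e"
        using d(1) pos(1) le(1) K(2) by (intro err) auto
      ultimately have "prob_norm M (\<lambda>\<omega>. Y n \<omega> - (?A * Y m \<omega> + - ?A * d)) \<le> e" by presburger
      then have "\<exists>d. prob_norm M (\<lambda>\<omega>. Y n \<omega> - (?A * Y m \<omega> + d)) \<le> e" by (rule exI)
      moreover have "V n \<omega> - ?B * V m \<omega> = - ?B * (V m \<omega> - var_factor m n * V n \<omega>)" for \<omega>
        using factor_inverse(2)[OF n(1) m(1)] by (simp add: algebra_simps mult.assoc[symmetric])
      moreover have "prob_norm M (\<lambda>\<omega>. - ?B * (V m \<omega> - var_factor m n * V n \<omega>)) \<le> e"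
        using d(2) pos(2) le(2) K(3) by (intro err) auto
      ultimately show ?thesis unfolding scaled_close_def by simp
    qed
  qed
  show thesis
  proof (rule that[of "Max {1, N1, N2}"])
    show "Max {1, N1, N2} \<ge> 1" by simp
  qed (use core in blast)
qed

text \<open>
If the variance at $m$ is small, then $Y_m$ alone keeps the modulus at $u$ away from 1. A very large
factor $A$ would carry this to the tiny argument $u / A$ for $Y_n$, against the tightness of $Y_n$.
\<close>

lemma mean_factor_bounded_if_var_small:
  obtains \<delta> C where "\<delta> > 0" "C > 0"
    "\<And>L. L \<ge> 1 \<Longrightarrow> \<exists>N. \<forall>n\<ge>N. \<forall>m\<ge>N. real n \<le> L * real m \<longrightarrow> real m \<le> L * real n \<longrightarrow>
      prob_norm M (V m) \<le> \<delta> \<longrightarrow> mean_factor n m \<le> C"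
proof -
  obtain u \<eta> N0 where \<eta>: "\<eta> > 0" and gap: "\<And>n. n \<ge> N0 \<Longrightarrow> cmod (mix_char M (Y n) (V n) u) < 1 - 3 * \<eta>"
    by (rule norm_limit_char_gap) blast
  obtain s N1 where s: "s > 0" and sY: "\<And>n. n \<ge> N1 \<Longrightarrow> prob_norm M (\<lambda>\<omega>. s * Y n \<omega>) \<le> \<eta> / 4"
    using bounded_in_probD[OF bounded_Y, of "\<eta> / 4"] \<eta> by auto
  define K where "K = 1 + u\<^sup>2 / 2"
  have K: "K \<ge> 1" by (simp add: K_def)
  show thesis
  proof (rule that[of "\<eta> / K" "1 + \<bar>u\<bar> / s"])
    show "\<eta> / K > 0" "1 + \<bar>u\<bar> / s > 0" using \<eta> K s by (auto intro: add_pos_nonneg)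
    fix L :: real assume L: "L \<ge> 1"
    have e: "\<eta> / (4 * (1 + s)) > 0" using \<eta> s by simp
    obtain N2 where N2: "N2 \<ge> 1" and cmp: "\<forall>n\<ge>N2. \<forall>m\<ge>N2. real n \<le> L * real m \<longrightarrow> real m \<le> L * real n \<longrightarrow>
        scaled_close n m (\<eta> / (4 * (1 + s)))"
      by (rule comparable[OF L e])
    show "\<exists>N. \<forall>n\<ge>N. \<forall>m\<ge>N. real n \<le> L * real m \<longrightarrow> real m \<le> L * real n \<longrightarrow>
      prob_norm M (V m) \<le> \<eta> / K \<longrightarrow> mean_factor n m \<le> 1 + \<bar>u\<bar> / s"
    proof (intro exI[of _ "Max {N0, N1, N2}"] allI impI)
      fix n m assume nm: "n \<ge> Max {N0, N1, N2}" "m \<ge> Max {N0, N1, N2}" and r: "real n \<le> L * real m" "real m \<le> L * real n"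
        and small: "prob_norm M (V m) \<le> \<eta> / K"
      then have n: "n \<ge> 1" "n \<ge> N1" "n \<ge> N2" and m: "m \<ge> 1" "m \<ge> N0" "m \<ge> N2" using N2 by auto
      let ?A = "mean_factor n m"
      have A: "?A > 0" using factor_pos n m by auto
      show "?A \<le> 1 + \<bar>u\<bar> / s"
      proof (rule ccontr)
        assume "\<not> ?A \<le> 1 + \<bar>u\<bar> / s"
        then have "\<bar>u\<bar> / s < ?A" by simp
        then have ts: "\<bar>u / ?A\<bar> \<le> s" using s A by (simp add: field_simps)
        define t where "t = u / ?A"
        have tA: "t * ?A = u" using A by (simp add: t_def)
        obtain d where d: "prob_norm M (\<lambda>\<omega>. Y n \<omega> - (?A * Y m \<omega> + d)) \<le> \<eta> / (4 * (1 + s))"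
          using cmp n(3) m(3) r unfolding scaled_close_def by blast
        have f1: "prob_norm M (\<lambda>\<omega>. t * Y n \<omega>) \<le> \<eta> / 4"
        proof (rule order_trans[OF prob_norm_mono sY[OF n(2)]])
          show "\<bar>t * Y n \<omega>\<bar> \<le> \<bar>s * Y n \<omega>\<bar>" for \<omega>
            using mult_right_mono[OF ts, of "\<bar>Y n \<omega>\<bar>"] s by (simp add: abs_mult t_def)
        qed auto
        have g1: "cmod (mix_char M (Y n) (\<lambda>_. 0) t) \<ge> 1 - \<eta> / 2"
          using norm_mix_char_ge[of "Y n" "\<lambda>_. 0" t] f1 by (simp add: prob_norm_def)
        have "prob_norm M (\<lambda>\<omega>. t * (Y n \<omega> - (?A * Y m \<omega> + d))) \<le> (1 + s) * prob_norm M (\<lambda>\<omega>. Y n \<omega> - (?A * Y m \<omega> + d))"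
        proof (rule prob_norm_scale)
          have "\<bar>t\<bar> \<le> 1 + s" using ts by (simp only: t_def)
          then show "\<bar>t * (Y n \<omega> - (?A * Y m \<omega> + d))\<bar> \<le> (1 + s) * \<bar>Y n \<omega> - (?A * Y m \<omega> + d)\<bar>" for \<omega>
            unfolding abs_mult by (rule mult_right_mono) simp
        qed (use s in auto)
        also have "\<dots> \<le> (1 + s) * (\<eta> / (4 * (1 + s)))" using d s by (intro mult_left_mono) auto
        also have "\<dots> = \<eta> / 4" using s by (simp add: field_simps)
        finally have f2: "prob_norm M (\<lambda>\<omega>. t * (Y n \<omega> - (?A * Y m \<omega> + d))) \<le> \<eta> / 4" .
        have g2: "cmod (mix_char M (Y n) (\<lambda>_. 0) t - mix_char M (\<lambda>\<omega>. ?A * Y m \<omega> + d) (\<lambda>_. 0) t) \<le> \<eta> / 2"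
          using norm_mix_char_diff_le[of "Y n" "\<lambda>_. 0" "\<lambda>\<omega>. ?A * Y m \<omega> + d" "\<lambda>_. 0" t] f2 by (simp add: prob_norm_def)
        have g3: "mix_char M (\<lambda>\<omega>. ?A * Y m \<omega>) (\<lambda>_. 0) t = mix_char M (Y m) (\<lambda>_. 0) u"
          unfolding mix_char_def mult.assoc[symmetric] tA by simp
        have "prob_norm M (\<lambda>\<omega>. u\<^sup>2 / 2 * V m \<omega>) \<le> K * prob_norm M (V m)"
          using K by (intro prob_norm_scale) (auto simp: abs_mult K_def algebra_simps)
        also have "\<dots> \<le> \<eta>" using small K by (simp add: field_simps)
        finally have f3: "prob_norm M (\<lambda>\<omega>. u\<^sup>2 / 2 * V m \<omega>) \<le> \<eta>" .
        have g4: "cmod (mix_char M (Y m) (\<lambda>_. 0) u - mix_char M (Y m) (V m) u) \<le> \<eta>"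
          using norm_mix_char_diff_le[of "Y m" "\<lambda>_. 0" "Y m" "V m" u] V_nonneg f3 by (simp add: prob_norm_def)
        have "cmod (mix_char M (Y m) (\<lambda>_. 0) u) \<ge> 1 - \<eta>"
          using g1 norm_triangle_ineq3[of "mix_char M (Y n) (\<lambda>_. 0) t" "mix_char M (\<lambda>\<omega>. ?A * Y m \<omega> + d) (\<lambda>_. 0) t"] g2
          unfolding norm_mix_char_shift g3 by linarith
        then have "cmod (mix_char M (Y m) (V m) u) \<ge> 1 - 2 * \<eta>"
          using g4 norm_triangle_ineq3[of "mix_char M (Y m) (\<lambda>_. 0) u" "mix_char M (Y m) (V m) u"] by linarith
        then show False using gap[OF m(2)] \<eta> by linarith
      qed
    qed
  qed
qed

end

section \<open>The dichotomy between random mean and random variance\<close>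

context scaling_family
begin

text \<open>
With $A$ bounded by $C$, the variance factor is $A^2 m / n \le C^2 / k$ for $n \ge k m$. As $V$ is
bounded in probability, a small factor makes the variance as small as desired. The window $k m \le n \le k^2 m$
is wide enough for successive windows to overlap and narrow enough for ratios to be bounded.
\<close>

lemma var_contracts:
  obtains \<delta> where "\<delta> > 0" "\<And>\<delta>'. \<delta>' > 0 \<Longrightarrow> \<exists>k\<ge>2. \<exists>N\<ge>1. \<forall>m\<ge>N. \<forall>n. k * m \<le> n \<longrightarrow> n \<le> k\<^sup>2 * m \<longrightarrow>
    prob_norm M (V m) \<le> \<delta> \<longrightarrow> prob_norm M (V n) \<le> \<delta>'"
proof -
  obtain \<delta> C where \<delta>: "\<delta> > 0" and C: "C > 0" and AC: "\<And>L. L \<ge> 1 \<Longrightarrow> \<exists>N. \<forall>n\<ge>N. \<forall>m\<ge>N. real n \<le> L * real m \<longrightarrow>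
      real m \<le> L * real n \<longrightarrow> prob_norm M (V m) \<le> \<delta> \<longrightarrow> mean_factor n m \<le> C"
    by (rule mean_factor_bounded_if_var_small) blast
  show thesis
  proof (rule that[OF \<delta>])
    fix \<delta>' :: real assume \<delta>': "\<delta>' > 0"
    obtain s N1 where s: "s > 0" and sV: "\<And>n. n \<ge> N1 \<Longrightarrow> prob_norm M (\<lambda>\<omega>. s * V n \<omega>) \<le> \<delta>' / 2"
      using bounded_in_probD[OF bounded_V, of "\<delta>' / 2"] \<delta>' by auto
    define k where "k = 2 + nat \<lceil>C\<^sup>2 / s\<rceil>"
    have k2: "k \<ge> 2" by (simp add: k_def)
    have ks: "C\<^sup>2 / real k \<le> s"
    proof -
      have "C\<^sup>2 / s \<le> real k" unfolding k_def using real_nat_ceiling_ge[of "C\<^sup>2 / s"] by simp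
      then show ?thesis using s k2 by (simp add: field_simps)
    qed
    define L where "L = real (k\<^sup>2)"
    have L: "L \<ge> 1" using k2 by (simp add: L_def)
    obtain N2 where N2: "\<forall>n\<ge>N2. \<forall>m\<ge>N2. real n \<le> L * real m \<longrightarrow>
      real m \<le> L * real n \<longrightarrow> prob_norm M (V m) \<le> \<delta> \<longrightarrow> mean_factor n m \<le> C" using AC[OF L] by blast
    have e: "\<delta>' / 2 > 0" using \<delta>' by simp
    obtain N3 where N3: "N3 \<ge> 1" "\<forall>n\<ge>N3. \<forall>m\<ge>N3. real n \<le> L * real m \<longrightarrow> real m \<le> L * real n \<longrightarrow> scaled_close n m (\<delta>' / 2)"
      by (rule comparable[OF L e])
    show "\<exists>k\<ge>2. \<exists>N\<ge>1. \<forall>m\<ge>N. \<forall>n. k * m \<le> n \<longrightarrow> n \<le> k\<^sup>2 * m \<longrightarrow>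
      prob_norm M (V m) \<le> \<delta> \<longrightarrow> prob_norm M (V n) \<le> \<delta>'"
    proof (rule exI[of _ k], rule conjI[OF k2], rule exI[of _ "Max {N1, N2, N3}"], intro conjI allI impI)
      show "Max {N1, N2, N3} \<ge> 1" using N3(1) by simp
      fix m n assume m: "m \<ge> Max {N1, N2, N3}" and n: "k * m \<le> n" "n \<le> k\<^sup>2 * m" and small: "prob_norm M (V m) \<le> \<delta>"
      have m': "m \<ge> 1" "m \<ge> N1" "m \<ge> N2" "m \<ge> N3" using m N3(1) by auto
      have "m \<le> k * m" using k2 by simp
      then have mn: "m \<le> n" using n by linarith
      then have n': "n \<ge> 1" "n \<ge> N2" "n \<ge> N3" using m' by auto
      have rn: "real n \<le> L * real m" using n(2) unfolding L_def of_nat_mult[symmetric] of_nat_le_iff .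
      have rm: "real m \<le> L * real n" using mn L mult_mono[of 1 L "real m" "real n"] by simp
      have A: "mean_factor n m \<le> C" using N2 m' n' rn rm small by blast
      have posA: "mean_factor n m > 0" and posB: "var_factor n m > 0" using factor_pos m' n' by auto
      have "var_factor n m = (mean_factor n m)\<^sup>2 * (real m / real n)" using var_factor_eq m' n' by simp
      also have "\<dots> \<le> C\<^sup>2 * (1 / real k)"
      proof (intro mult_mono power_mono)
        have "real k * real m \<le> real n" using n(1) unfolding of_nat_mult[symmetric] of_nat_le_iff .
        then show "real m / real n \<le> 1 / real k" using k2 n' by (simp add: field_simps)
      qed (use A posA in auto)
      also have "\<dots> \<le> s" using ks by simp
      finally have Bs: "var_factor n m \<le> s" .
      have "prob_norm M (V n) \<le> prob_norm M (\<lambda>\<omega>. s * V m \<omega>) + prob_norm M (\<lambda>\<omega>. V n \<omega> - var_factor n m * V m \<omega>)"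
      proof (rule prob_norm_le_add)
        fix \<omega> assume "\<omega> \<in> space M"
        then have "0 \<le> V m \<omega>" by (rule V_nonneg)
        then have "\<bar>var_factor n m * V m \<omega>\<bar> \<le> \<bar>s * V m \<omega>\<bar>" using mult_right_mono[OF Bs] posB s by (simp add: abs_mult)
        then show "\<bar>V n \<omega>\<bar> \<le> \<bar>s * V m \<omega>\<bar> + \<bar>V n \<omega> - var_factor n m * V m \<omega>\<bar>" by linarith
      qed auto
      also have "\<dots> \<le> \<delta>' / 2 + \<delta>' / 2"
        using N3(2) m' n' rn rm sV[OF m'(2)] unfolding scaled_close_def by (intro add_mono) blast+
      finally show "prob_norm M (V n) \<le> \<delta>'" by simp
    qed
  qed
qed

text \<open>
The region of small variance is absorbing: a window of indices with small variance starts the next one,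
and these windows cover all later indices. Once there, contraction by arbitrary factors gives the limit 0.
\<close>

lemma var_vanishes_or_persists:
  "(\<lambda>n. prob_norm M (V n)) \<longlonglongrightarrow> 0 \<or> (\<exists>\<delta>>0. \<exists>N. \<forall>n\<ge>N. prob_norm M (V n) > \<delta>)"
proof -
  obtain \<delta> where \<delta>: "\<delta> > 0" and step: "\<And>\<delta>'. \<delta>' > 0 \<Longrightarrow> \<exists>k\<ge>2. \<exists>N\<ge>1. \<forall>m\<ge>N. \<forall>n. k * m \<le> n \<longrightarrow> n \<le> k\<^sup>2 * m \<longrightarrow>
    prob_norm M (V m) \<le> \<delta> \<longrightarrow> prob_norm M (V n) \<le> \<delta>'"
    by (rule var_contracts) blast
  show ?thesis
  proof (cases "\<exists>N. \<forall>n\<ge>N. prob_norm M (V n) > \<delta>")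
    case True
    then show ?thesis using \<delta> by blast
  next
    case False
    \<comment> \<open>Every large \<open>n\<close> lies in the window of \<open>n div k\<close>.\<close>
    have window: "k * m \<le> n \<and> n \<le> k\<^sup>2 * m \<and> m < n" if k: "k \<ge> 2" and m: "m = n div k" "m \<ge> 1" for k m n :: nat
    proof -
      have k0: "k > 0" using k by simp
      have "n < k * (m + 1)" using k0 m(1) by (metis Suc_eq_plus1 dividend_less_times_div mult_Suc_right add.commute)
      also have "\<dots> \<le> k * (k * m)"
      proof (rule mult_left_mono)
        show "m + 1 \<le> k * m" using mult_right_mono[OF k, of m] m(2) by linarith
      qed simp
      finally have "n \<le> k\<^sup>2 * m" by (simp add: power2_eq_square mult.assoc)
      moreover have "m < n" using m k unfolding m(1) by (intro div_less_dividend) (auto intro!: Nat.gr0I)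
      ultimately show ?thesis unfolding m(1) by (simp add: times_div_less_eq_dividend)
    qed
    have quot: "n div k \<ge> N" if "k * N \<le> n" "k \<ge> 2" for k n N :: nat
      using that by (simp add: less_eq_div_iff_mult_less_eq mult.commute)
    obtain k N where k: "k \<ge> 2" and N: "N \<ge> 1" and win: "\<And>m n. m \<ge> N \<Longrightarrow> k * m \<le> n \<Longrightarrow> n \<le> k\<^sup>2 * m \<Longrightarrow>
      prob_norm M (V m) \<le> \<delta> \<Longrightarrow> prob_norm M (V n) \<le> \<delta>" using step[OF \<delta>] by blast
    obtain n0 where n0: "n0 \<ge> N" "prob_norm M (V n0) \<le> \<delta>" using False by (meson not_less)
    have stay: "prob_norm M (V n) \<le> \<delta>" if "k * n0 \<le> n" for n
      using that
    proof (induction n rule: less_induct)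
      case (less n)
      show ?case
      proof (cases "n \<le> k\<^sup>2 * n0")
        case True
        then show ?thesis using win[OF n0(1) less.prems] n0 by blast
      next
        case far: False
        have "k * n0 \<le> n div k" using far k by (intro quot) (simp_all add: power2_eq_square mult.assoc)
        moreover have "n0 \<le> k * n0" using k by simp
        ultimately have m: "k * n0 \<le> n div k" "n div k \<ge> N" "n div k \<ge> 1" using n0(1) N by linarith+
        note w = window[OF k refl m(3)]
        show ?thesis using win[OF m(2)] w less.IH[OF _ m(1)] by blast
      qed
    qed
    have "(\<lambda>n. prob_norm M (V n)) \<longlonglongrightarrow> 0"
    proof (rule LIMSEQ_I)
      fix e :: real assume "e > 0"
      then have e2: "e / 2 > 0" by simp
      obtain k' N' where k': "k' \<ge> 2" and N': "N' \<ge> 1" and win': "\<And>m n. m \<ge> N' \<Longrightarrow> k' * m \<le> n \<Longrightarrow> n \<le> k'\<^sup>2 * m \<Longrightarrow>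
        prob_norm M (V m) \<le> \<delta> \<Longrightarrow> prob_norm M (V n) \<le> e / 2" using step[OF e2] by blast
      show "\<exists>no. \<forall>n\<ge>no. norm (prob_norm M (V n) - 0) < e"
      proof (intro exI[of _ "k' * (N' + k * n0)"] allI impI)
        fix n assume n: "n \<ge> k' * (N' + k * n0)"
        from quot[OF this k'] have m: "n div k' \<ge> N'" "n div k' \<ge> 1" "k * n0 \<le> n div k'" using N' by linarith+
        have "prob_norm M (V n) \<le> e / 2"
          using win'[OF m(1)] window[OF k' refl m(2)] stay[OF m(3)] by blast
        then show "norm (prob_norm M (V n) - 0) < e" using \<open>e > 0\<close> by simp
      qed
    qed
    then show ?thesis by blast
  qed
qed

text \<open>
Compare $m$ with $n = k m$. Since the variance at $n$ is not small and $V$ is bounded in probability, the variance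
factor from $m$ to $n$ is at least some $s > 0$, whatever $k$ is. Therefore the mean factor back from $n$ to $m$
has square at most $1/(s k)$, and $Y_m$ is within a small multiple of the tight variable $Y_n$ of a constant.
\<close>

lemma mean_concentrates:
  assumes \<delta>: "\<delta> > 0" and N0: "\<And>n. n \<ge> N0 \<Longrightarrow> prob_norm M (V n) > \<delta>"
  obtains c where "(\<lambda>n. prob_norm M (\<lambda>\<omega>. Y n \<omega> - c n)) \<longlonglongrightarrow> 0"
proof -
  have close: "\<exists>N. \<forall>m\<ge>N. \<exists>d. prob_norm M (\<lambda>\<omega>. Y m \<omega> - d) \<le> \<epsilon>" if \<epsilon>: "\<epsilon> > 0" for \<epsilon>
  proof -
    have e4: "\<delta> / 4 > 0" "\<epsilon> / 2 > 0" using \<delta> \<epsilon> by auto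
    obtain s N1 where s: "s > 0" and sV: "\<And>n. n \<ge> N1 \<Longrightarrow> prob_norm M (\<lambda>\<omega>. s * V n \<omega>) \<le> \<delta> / 4"
      using bounded_in_probD[OF bounded_V e4(1)] by metis
    obtain r N2 where r: "r > 0" and rY: "\<And>n. n \<ge> N2 \<Longrightarrow> prob_norm M (\<lambda>\<omega>. r * Y n \<omega>) \<le> \<epsilon> / 2"
      using bounded_in_probD[OF bounded_Y e4(2)] by metis
    define k where "k = 1 + nat \<lceil>1 / (s * r\<^sup>2)\<rceil>"
    have k1: "k \<ge> 1" by (simp add: k_def)
    have kr: "1 / (s * r\<^sup>2) \<le> real k" unfolding k_def using real_nat_ceiling_ge[of "1 / (s * r\<^sup>2)"] by simp
    have L: "real k \<ge> 1" using k1 by simp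
    have e: "min (\<epsilon> / 2) (\<delta> / 4) > 0" using e4 by simp
    obtain N3 where N3: "N3 \<ge> 1" "\<forall>n\<ge>N3. \<forall>m\<ge>N3. real n \<le> real k * real m \<longrightarrow> real m \<le> real k * real n \<longrightarrow> scaled_close n m (min (\<epsilon> / 2) (\<delta> / 4))"
      by (rule comparable[OF L e])
    show ?thesis
    proof (intro exI[of _ "Max {N0, N1, N2, N3}"] allI impI)
      fix m assume "m \<ge> Max {N0, N1, N2, N3}"
      then have m: "m \<ge> 1" "m \<ge> N0" "m \<ge> N1" "m \<ge> N2" "m \<ge> N3" using N3(1) by auto
      let ?n = "k * m"
      have "m \<le> ?n" using k1 by simp
      then have n: "?n \<ge> 1" "?n \<ge> N0" "?n \<ge> N2" "?n \<ge> N3" using m by linarith+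
      have rn: "real ?n \<le> real k * real m" and rm: "real m \<le> real k * real ?n"
        using mult_mono[of 1 "real k" "real m" "real ?n"] L \<open>m \<le> ?n\<close> by (simp_all del: of_nat_mult) simp
      have posA: "mean_factor m ?n > 0" and posB: "var_factor ?n m > 0" using factor_pos m n by auto
      \<comment> \<open>The variance at the larger index is not small, so the rescaling factor is bounded below.\<close>
      have B: "var_factor ?n m > s"
      proof (rule ccontr)
        assume "\<not> var_factor ?n m > s"
        then have Bs: "var_factor ?n m \<le> s" by simp
        have "prob_norm M (V ?n) \<le> prob_norm M (\<lambda>\<omega>. s * V m \<omega>) + prob_norm M (\<lambda>\<omega>. V ?n \<omega> - var_factor ?n m * V m \<omega>)"
        proof (rule prob_norm_le_add)
          fix \<omega> assume "\<omega> \<in> space M"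
          then have "0 \<le> V m \<omega>" by (rule V_nonneg)
          then have "\<bar>var_factor ?n m * V m \<omega>\<bar> \<le> \<bar>s * V m \<omega>\<bar>" using mult_right_mono[OF Bs] posB s by (simp add: abs_mult)
          then show "\<bar>V ?n \<omega>\<bar> \<le> \<bar>s * V m \<omega>\<bar> + \<bar>V ?n \<omega> - var_factor ?n m * V m \<omega>\<bar>" by linarith
        qed auto
        also have "\<dots> \<le> \<delta> / 4 + \<delta> / 4"
        proof (intro add_mono)
          have "prob_norm M (\<lambda>\<omega>. V ?n \<omega> - var_factor ?n m * V m \<omega>) \<le> min (\<epsilon> / 2) (\<delta> / 4)" using N3(2) m n rn rm unfolding scaled_close_def by blast
          then show "prob_norm M (\<lambda>\<omega>. V ?n \<omega> - var_factor ?n m * V m \<omega>) \<le> \<delta> / 4" by simp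
        qed (rule sV[OF m(3)])
        finally show False using N0[OF n(2)] \<delta> by simp
      qed
      have A: "mean_factor m ?n \<le> r"
      proof (rule power2_le_imp_le)
        have eq: "var_factor ?n m = (mean_factor ?n m)\<^sup>2 / real k" using var_factor_eq[OF n(1) m(1)] m k1 by simp
        have inv: "(mean_factor m ?n)\<^sup>2 * (mean_factor ?n m)\<^sup>2 = 1"
          using factor_inverse(1)[OF m(1) n(1)] by (simp flip: power_mult_distrib)
        have "(mean_factor m ?n)\<^sup>2 * (s * real k) \<le> (mean_factor m ?n)\<^sup>2 * (mean_factor ?n m)\<^sup>2"
          using B eq k1 by (intro mult_left_mono) (auto simp: field_simps)
        then have "(mean_factor m ?n)\<^sup>2 * (s * real k) \<le> 1" unfolding inv .
        then have "(mean_factor m ?n)\<^sup>2 \<le> 1 / (s * real k)" using s k1 by (simp add: field_simps)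
        also have "\<dots> \<le> r\<^sup>2" using kr s r k1 by (simp add: field_simps)
        finally show "(mean_factor m ?n)\<^sup>2 \<le> r\<^sup>2" .
      qed (use r in simp)
      obtain d where d: "prob_norm M (\<lambda>\<omega>. Y m \<omega> - (mean_factor m ?n * Y ?n \<omega> + d)) \<le> min (\<epsilon> / 2) (\<delta> / 4)"
        using N3(2) m n rn rm unfolding scaled_close_def by blast
      have "prob_norm M (\<lambda>\<omega>. Y m \<omega> - d) \<le> prob_norm M (\<lambda>\<omega>. r * Y ?n \<omega>) +
          prob_norm M (\<lambda>\<omega>. Y m \<omega> - (mean_factor m ?n * Y ?n \<omega> + d))"
      proof (rule prob_norm_le_add)
        fix \<omega>
        have "\<bar>mean_factor m ?n * Y ?n \<omega>\<bar> \<le> \<bar>r * Y ?n \<omega>\<bar>"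
          using mult_right_mono[OF A, of "\<bar>Y ?n \<omega>\<bar>"] posA r by (simp add: abs_mult)
        then show "\<bar>Y m \<omega> - d\<bar> \<le> \<bar>r * Y ?n \<omega>\<bar> + \<bar>Y m \<omega> - (mean_factor m ?n * Y ?n \<omega> + d)\<bar>" by linarith
      qed auto
      also have "\<dots> \<le> \<epsilon> / 2 + \<epsilon> / 2" using d rY[OF n(3)] by (intro add_mono) auto
      finally show "\<exists>d. prob_norm M (\<lambda>\<omega>. Y m \<omega> - d) \<le> \<epsilon>" by (intro exI[of _ d]) simp
    qed
  qed
  \<comment> \<open>Nearly optimal constants turn the approximation for each accuracy into one sequence.\<close>
  define I where "I m = (INF d. prob_norm M (\<lambda>\<omega>. Y m \<omega> - d))" for m
  have bdd: "bdd_below (range (\<lambda>d. prob_norm M (\<lambda>\<omega>. Y m \<omega> - d)))" for m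
    by (rule bdd_belowI[of _ 0]) auto
  have "\<exists>d. prob_norm M (\<lambda>\<omega>. Y m \<omega> - d) < I m + inverse (real (Suc m))" for m
    using cInf_lessD[of "range (\<lambda>d. prob_norm M (\<lambda>\<omega>. Y m \<omega> - d))" "I m + inverse (real (Suc m))"]
    unfolding I_def by auto
  then obtain c where c: "\<And>m. prob_norm M (\<lambda>\<omega>. Y m \<omega> - c m) < I m + inverse (real (Suc m))" by metis
  have "(\<lambda>m. prob_norm M (\<lambda>\<omega>. Y m \<omega> - c m)) \<longlonglongrightarrow> 0"
  proof (rule LIMSEQ_I)
    fix e :: real assume e: "e > 0"
    obtain N where N: "\<forall>m\<ge>N. \<exists>d. prob_norm M (\<lambda>\<omega>. Y m \<omega> - d) \<le> e / 2" using close[of "e / 2"] e by auto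
    obtain N' where N': "inverse (real (Suc N')) < e / 2" using reals_Archimedean[of "e / 2"] e by auto
    show "\<exists>no. \<forall>n\<ge>no. norm (prob_norm M (\<lambda>\<omega>. Y n \<omega> - c n) - 0) < e"
    proof (intro exI[of _ "max N N'"] allI impI)
      fix n assume n: "n \<ge> max N N'"
      then obtain d where "prob_norm M (\<lambda>\<omega>. Y n \<omega> - d) \<le> e / 2" using N by auto
      then have "I n \<le> e / 2" unfolding I_def by (intro cINF_lower2[OF bdd UNIV_I])
      moreover have "inverse (real (Suc n)) \<le> inverse (real (Suc N'))" using n by (intro le_imp_inverse_le) auto
      ultimately have "prob_norm M (\<lambda>\<omega>. Y n \<omega> - c n) < e" using c[of n] N' by linarith
      then show "norm (prob_norm M (\<lambda>\<omega>. Y n \<omega> - c n) - 0) < e" by simp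
    qed
  qed
  then show thesis by (rule that)
qed

end

section \<open>Regular variation of the norming constants\<close>

context scaling_family
begin

lemma norm_char_limit_props:
  "isCont (\<lambda>t. cmod (char \<nu> t)) 0" "cmod (char \<nu> 0) = 1" "\<exists>u. cmod (char \<nu> u) \<noteq> 1"
proof -
  interpret \<nu>: real_distribution \<nu> by (rule real_distribution_limit)
  show "isCont (\<lambda>t. cmod (char \<nu> t)) 0" using \<nu>.isCont_char by (intro continuous_intros) auto
  show "cmod (char \<nu> 0) = 1" by (simp add: \<nu>.char_zero)
  show "\<exists>u. cmod (char \<nu> u) \<noteq> 1"
    using nondegenerate_imp_norm_char_less_1[OF real_distribution_limit nondegenerate_limit] by (metis less_irrefl)
qed

lemma norming_ratio_bounds:
  assumes m: "m \<ge> 1"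
  obtains C N where "C \<ge> 1" "\<forall>n\<ge>N. n \<ge> 1 \<and> 1 / C \<le> b n / b (m * n) \<and> b n / b (m * n) \<le> C"
proof -
  obtain C N where C: "C \<ge> 1" and r: "\<And>n k. n \<ge> N \<Longrightarrow> k \<ge> N \<Longrightarrow> real n \<le> real m * real k \<Longrightarrow> b n \<le> C * b k"
    using ratio_bounded[of "real m"] m by auto
  show thesis
  proof (rule that[OF C, of "max 1 N"], intro allI impI)
    fix n assume n: "max 1 N \<le> n"
    have mn: "n \<le> m * n" using m by simp
    have "b n \<le> C * b (m * n)"
    proof (rule r)
      have "n \<le> m * (m * n)" using m by simp
      then show "real n \<le> real m * real (m * n)" unfolding of_nat_mult[symmetric] of_nat_le_iff .
    qed (use n mn in \<open>auto intro: le_trans[OF _ mn]\<close>)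
    moreover have "b (m * n) \<le> C * b n" by (rule r) (use n mn in \<open>auto intro: le_trans[OF _ mn]\<close>)
    moreover have "b n > 0" "b (m * n) > 0" using b_pos n m by auto
    ultimately show "n \<ge> 1 \<and> 1 / C \<le> b n / b (m * n) \<and> b n / b (m * n) \<le> C" using n C by (auto simp: field_simps)
  qed
qed

text \<open>
The common part of both cases. The factor $f$ is $m$ when the mean carries the limit and $\sqrt m$ when the
variance does; \<open>H n\<close> is the characteristic function of the part that carries it.
\<close>

lemma norming_ratio_tendsto_1:
  fixes H :: "nat \<Rightarrow> real \<Rightarrow> complex"
  assumes m: "m \<ge> 1" and f: "1 \<le> f"
    and lim: "\<And>t. (\<lambda>n. cmod (H n t)) \<longlonglongrightarrow> cmod (char \<nu> t)"
    and equi: "\<And>t e. e > 0 \<Longrightarrow> \<exists>h>0. \<exists>N. \<forall>n\<ge>N. \<forall>t'. \<bar>t' - t\<bar> < h \<longrightarrow> cmod (H n t' - H n t) < e"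
    and rel: "\<And>t e. e > 0 \<Longrightarrow> \<exists>N. \<forall>n\<ge>N. \<bar>cmod (H (m * n) t) - cmod (H n (f * b n / b (m * n) * t))\<bar> < e"
  shows "(\<lambda>n. f * b n / b (m * n)) \<longlonglongrightarrow> 1"
proof -
  obtain C N where C: "C \<ge> 1" and N: "\<forall>n\<ge>N. n \<ge> 1 \<and> 1 / C \<le> b n / b (m * n) \<and> b n / b (m * n) \<le> C"
    by (rule norming_ratio_bounds[OF m])
  obtain u where u: "cmod (char \<nu> u) \<noteq> 1" using norm_char_limit_props(3) by blast
  show ?thesis
  proof (rule scale_ratio_tendsto_1[where G = "\<lambda>n t. cmod (H n t)" and g = "\<lambda>t. cmod (char \<nu> t)" and m = m and C = "f * C"])
    show "\<exists>h>0. \<exists>N. \<forall>n\<ge>N. \<forall>t'. \<bar>t' - t\<bar> < h \<longrightarrow> \<bar>cmod (H n t') - cmod (H n t)\<bar> < e" if "e > 0" for t e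
      using equi[OF that, of t] norm_triangle_ineq3 by (meson le_less_trans)
    show "f * C > 0" using f C by simp
    show "(\<lambda>n. cmod (H (m * n) t) - cmod (H n (f * b n / b (m * n) * t))) \<longlonglongrightarrow> 0" for t
      by (rule LIMSEQ_I) (use rel[of _ t] in simp)
    fix n assume n: "n \<ge> N"
    have "1 / (f * C) \<le> 1 * (1 / C)" using f C by (simp add: field_simps)
    also have "\<dots> \<le> f * (b n / b (m * n))" using N n f C by (intro mult_mono) auto
    finally have "1 / (f * C) \<le> f * b n / b (m * n)" by simp
    moreover have "f * (b n / b (m * n)) \<le> f * C" using N n f by (intro mult_left_mono) auto
    ultimately show "1 / (f * C) \<le> f * b n / b (m * n) \<and> f * b n / b (m * n) \<le> f * C" by simp
  qed (use norm_char_limit_props(1,2) lim u m in auto)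
qed

lemma comparable_multiple:
  assumes m: "m \<ge> 1" and e: "e > 0"
  obtains N where "N \<ge> 1" "\<forall>n\<ge>N. scaled_close (m * n) n e"
proof -
  have "real m \<ge> 1" using m by simp
  from comparable[OF this e] obtain N where N: "N \<ge> 1"
    "\<forall>n\<ge>N. \<forall>k\<ge>N. real n \<le> real m * real k \<longrightarrow> real k \<le> real m * real n \<longrightarrow> scaled_close n k e" by blast
  have "scaled_close (m * n) n e" if n: "n \<ge> N" for n
  proof -
    have mn: "n \<le> m * n" "n \<le> m * (m * n)" using m by auto
    then have "real n \<le> real m * real (m * n)" "m * n \<ge> N"
      using n le_trans[OF n mn(1)] by (simp_all only: of_nat_mult[symmetric] of_nat_le_iff)
    then show ?thesis using N(2) n by simp
  qed
  with N(1) show thesis by (intro that) auto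
qed

text \<open>
With vanishing variance the modulus of $E e^{i t Y_n}$ converges to that of the limit, and $Y_{mn}$ is
$A\, Y_n$ up to a constant, with $A = m b_n / b_{mn}$.
\<close>

lemma norming_ratio_random_mean:
  assumes V0: "(\<lambda>n. prob_norm M (V n)) \<longlonglongrightarrow> 0" and m: "m \<ge> 1"
  shows "(\<lambda>n. real m * b n / b (m * n)) \<longlonglongrightarrow> 1"
proof (rule norming_ratio_tendsto_1[where H = "\<lambda>n. mix_char M (Y n) (\<lambda>_. 0)", OF m])
  show "1 \<le> real m" using m by simp
  show "(\<lambda>n. cmod (mix_char M (Y n) (\<lambda>_. 0) t)) \<longlonglongrightarrow> cmod (char \<nu> t)" for t
  proof -
    have "(\<lambda>n. mix_char M (Y n) (\<lambda>_. 0) t - mix_char M (Y n) (V n) t) \<longlonglongrightarrow> 0"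
      using V0 by (intro mix_char_diff_tendsto_0) (auto simp: V_nonneg prob_norm_def)
    from tendsto_add[OF this mix_char_lim[of t]] show ?thesis by (intro tendsto_norm) simp
  qed
  fix t e :: real assume e: "e > 0"
  then have "e / 3 > 0" by simp
  from bounded_in_probD[OF bounded_Y this] obtain s N1 where s: "s > 0"
    "\<And>n. n \<ge> N1 \<Longrightarrow> prob_norm M (\<lambda>\<omega>. s * Y n \<omega>) \<le> e / 3" by metis
  show "\<exists>h>0. \<exists>N. \<forall>n\<ge>N. \<forall>t'. \<bar>t' - t\<bar> < h \<longrightarrow> cmod (mix_char M (Y n) (\<lambda>_. 0) t' - mix_char M (Y n) (\<lambda>_. 0) t) < e"
  proof (rule exI[of _ s], rule conjI[OF s(1)], rule exI[of _ N1], intro allI impI)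
    fix n t' assume n: "n \<ge> N1" and t': "\<bar>t' - t\<bar> < s"
    have "cmod (mix_char M (\<lambda>\<omega>. t' * Y n \<omega>) (\<lambda>_. 0) 1 - mix_char M (\<lambda>\<omega>. t * Y n \<omega>) (\<lambda>_. 0) 1)
      \<le> 2 * prob_norm M (\<lambda>\<omega>. 1 * (t' * Y n \<omega> - t * Y n \<omega>)) + prob_norm M (\<lambda>\<omega>. 1\<^sup>2 / 2 * (0 - 0))"
      by (rule norm_mix_char_diff_le) auto
    then have "cmod (mix_char M (Y n) (\<lambda>_. 0) t' - mix_char M (Y n) (\<lambda>_. 0) t) \<le> 2 * prob_norm M (\<lambda>\<omega>. t' * Y n \<omega> - t * Y n \<omega>)"
      by (simp add: mix_char_scale_mean prob_norm_def)
    also have "prob_norm M (\<lambda>\<omega>. t' * Y n \<omega> - t * Y n \<omega>) \<le> prob_norm M (\<lambda>\<omega>. s * Y n \<omega>)"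
    proof (rule prob_norm_mono)
      show "\<bar>t' * Y n \<omega> - t * Y n \<omega>\<bar> \<le> \<bar>s * Y n \<omega>\<bar>" for \<omega>
        using mult_right_mono[of "\<bar>t' - t\<bar>" s "\<bar>Y n \<omega>\<bar>"] t' s by (simp add: abs_mult left_diff_distrib[symmetric])
    qed auto
    finally show "cmod (mix_char M (Y n) (\<lambda>_. 0) t' - mix_char M (Y n) (\<lambda>_. 0) t) < e" using s(2)[OF n] e by simp
  qed
next
  fix t e :: real assume e: "e > 0"
  define D where "D = 1 + \<bar>t\<bar>"
  have D: "D > 0" by (simp add: D_def add_pos_nonneg)
  then have "e / (4 * D) > 0" using e by simp
  from comparable_multiple[OF m this] obtain N where N: "N \<ge> 1" "\<forall>n\<ge>N. scaled_close (m * n) n (e / (4 * D))" .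
  show "\<exists>N. \<forall>n\<ge>N. \<bar>cmod (mix_char M (Y (m * n)) (\<lambda>_. 0) t) - cmod (mix_char M (Y n) (\<lambda>_. 0) (real m * b n / b (m * n) * t))\<bar> < e"
  proof (intro exI[of _ N] allI impI)
    fix n assume n: "n \<ge> N"
    let ?A = "mean_factor (m * n) n"
    obtain d where d: "prob_norm M (\<lambda>\<omega>. Y (m * n) \<omega> - (?A * Y n \<omega> + d)) \<le> e / (4 * D)"
      using N(2) n unfolding scaled_close_def by blast
    have A: "real m * b n / b (m * n) = ?A" using n N(1) by (simp add: mean_factor_def)
    have "cmod (mix_char M (Y (m * n)) (\<lambda>_. 0) t - mix_char M (\<lambda>\<omega>. ?A * Y n \<omega> + d) (\<lambda>_. 0) t) \<le>
      2 * prob_norm M (\<lambda>\<omega>. t * (Y (m * n) \<omega> - (?A * Y n \<omega> + d))) + prob_norm M (\<lambda>\<omega>. t\<^sup>2 / 2 * (0 - 0))"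
      by (rule norm_mix_char_diff_le) auto
    also have "\<dots> \<le> 2 * (D * (e / (4 * D)))"
      using prob_norm_mult_le[of "\<lambda>\<omega>. Y (m * n) \<omega> - (?A * Y n \<omega> + d)" t] mult_left_mono[OF d, of D] D
      by (simp add: prob_norm_def[of M "\<lambda>_. 0"] D_def)
    also have "\<dots> < e" using D e by simp
    finally show "\<bar>cmod (mix_char M (Y (m * n)) (\<lambda>_. 0) t) - cmod (mix_char M (Y n) (\<lambda>_. 0) (real m * b n / b (m * n) * t))\<bar> < e"
      unfolding A mix_char_scale_mean[symmetric] norm_mix_char_shift[of "\<lambda>\<omega>. ?A * Y n \<omega>" d, symmetric]
      using norm_triangle_ineq3 by (rule le_less_trans[rotated])
  qed
qed

text \<open>
With the mean asymptotically deterministic, the mixture is a unimodular factor times the Laplace transform of $V_n$.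
\<close>

lemma laplace_var_limit:
  assumes c: "(\<lambda>n. prob_norm M (\<lambda>\<omega>. Y n \<omega> - c n)) \<longlonglongrightarrow> 0"
  shows "(\<lambda>n. iexp (t * c n) * mix_char M (\<lambda>_. 0) (V n) t) \<longlonglongrightarrow> char \<nu> t"
    and "(\<lambda>n. cmod (mix_char M (\<lambda>_. 0) (V n) t)) \<longlonglongrightarrow> cmod (char \<nu> t)"
proof -
  have "(\<lambda>n. mix_char M (\<lambda>\<omega>. 0 + c n) (V n) t - mix_char M (Y n) (V n) t) \<longlonglongrightarrow> 0"
    using c by (intro mix_char_diff_tendsto_0) (auto simp: V_nonneg prob_norm_def abs_minus_commute)
  from tendsto_add[OF this mix_char_lim[of t]]
  show 1: "(\<lambda>n. iexp (t * c n) * mix_char M (\<lambda>_. 0) (V n) t) \<longlonglongrightarrow> char \<nu> t"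
    unfolding mix_char_shift by simp
  from tendsto_norm[OF 1] show "(\<lambda>n. cmod (mix_char M (\<lambda>_. 0) (V n) t)) \<longlonglongrightarrow> cmod (char \<nu> t)"
    by (simp add: norm_mult del: of_real_mult)
qed

lemma norm_mix_char_centred_diff_le:
  assumes [measurable]: "U \<in> borel_measurable M" "U' \<in> borel_measurable M"
    and "\<And>\<omega>. \<omega> \<in> space M \<Longrightarrow> 0 \<le> U \<omega>" "\<And>\<omega>. \<omega> \<in> space M \<Longrightarrow> 0 \<le> U' \<omega>"
  shows "cmod (mix_char M (\<lambda>_. 0) U t - mix_char M (\<lambda>_. 0) U' t) \<le> prob_norm M (\<lambda>\<omega>. t\<^sup>2 / 2 * (U \<omega> - U' \<omega>))"
  using norm_mix_char_diff_le[of "\<lambda>_. 0" U "\<lambda>_. 0" U' t] assms by (simp add: prob_norm_def[of M "\<lambda>_. 0"])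

text \<open>
Now the variance carries the limit: $V_{mn}$ is close to $B\, V_n$ with $B = (\sqrt m\, b_n / b_{mn})^2$,
and a factor $\kappa^2$ in the variance is a factor $\kappa$ in the argument.
\<close>

lemma norming_ratio_random_variance:
  assumes c: "(\<lambda>n. prob_norm M (\<lambda>\<omega>. Y n \<omega> - c n)) \<longlonglongrightarrow> 0" and m: "m \<ge> 1"
  shows "(\<lambda>n. sqrt (real m) * b n / b (m * n)) \<longlonglongrightarrow> 1"
proof (rule norming_ratio_tendsto_1[where H = "\<lambda>n. mix_char M (\<lambda>_. 0) (V n)", OF m])
  show "1 \<le> sqrt (real m)" using m by simp
  show "(\<lambda>n. cmod (mix_char M (\<lambda>_. 0) (V n) t)) \<longlonglongrightarrow> cmod (char \<nu> t)" for t by (rule laplace_var_limit(2)[OF c])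
  fix t e :: real assume e: "e > 0"
  then have "e / 2 > 0" by simp
  from bounded_in_probD[OF bounded_V this] obtain s N1 where s: "s > 0"
    "\<And>n. n \<ge> N1 \<Longrightarrow> prob_norm M (\<lambda>\<omega>. s * V n \<omega>) \<le> e / 2" by metis
  have "(\<lambda>t'. t'\<^sup>2 / 2) \<midarrow>t\<rightarrow> t\<^sup>2 / 2" by (intro tendsto_intros) simp
  from LIM_D[OF this s(1)] obtain h where h: "h > 0" "\<And>t'. t' \<noteq> t \<Longrightarrow> \<bar>t' - t\<bar> < h \<Longrightarrow> \<bar>t'\<^sup>2 / 2 - t\<^sup>2 / 2\<bar> < s" by auto
  show "\<exists>h>0. \<exists>N. \<forall>n\<ge>N. \<forall>t'. \<bar>t' - t\<bar> < h \<longrightarrow> cmod (mix_char M (\<lambda>_. 0) (V n) t' - mix_char M (\<lambda>_. 0) (V n) t) < e"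
  proof (rule exI[of _ h], rule conjI[OF h(1)], rule exI[of _ N1], intro allI impI)
    fix n t' assume n: "n \<ge> N1" and t': "\<bar>t' - t\<bar> < h"
    have hs: "\<bar>t'\<^sup>2 / 2 - t\<^sup>2 / 2\<bar> \<le> s" using h(2)[OF _ t'] s(1) by (cases "t' = t") auto
    have "cmod (mix_char M (\<lambda>_. 0) (V n) t' - mix_char M (\<lambda>_. 0) (V n) t) \<le> prob_norm M (\<lambda>\<omega>. 1\<^sup>2 / 2 * (t'\<^sup>2 * V n \<omega> - t\<^sup>2 * V n \<omega>))"
      using norm_mix_char_centred_diff_le[of "\<lambda>\<omega>. t'\<^sup>2 * V n \<omega>" "\<lambda>\<omega>. t\<^sup>2 * V n \<omega>" 1] V_nonneg by (simp add: mix_char_scale_var)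
    also have "\<dots> \<le> prob_norm M (\<lambda>\<omega>. s * V n \<omega>)"
    proof (rule prob_norm_mono)
      fix \<omega>
      have "1\<^sup>2 / 2 * (t'\<^sup>2 * V n \<omega> - t\<^sup>2 * V n \<omega>) = (t'\<^sup>2 / 2 - t\<^sup>2 / 2) * V n \<omega>" by (simp add: algebra_simps)
      then show "\<bar>1\<^sup>2 / 2 * (t'\<^sup>2 * V n \<omega> - t\<^sup>2 * V n \<omega>)\<bar> \<le> \<bar>s * V n \<omega>\<bar>"
        using mult_right_mono[OF hs, of "\<bar>V n \<omega>\<bar>"] s(1) by (simp only: abs_mult abs_of_pos)
    qed auto
    also have "\<dots> < e" using s(2)[OF n] e by simp
    finally show "cmod (mix_char M (\<lambda>_. 0) (V n) t' - mix_char M (\<lambda>_. 0) (V n) t) < e" .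
  qed
next
  fix t e :: real assume e: "e > 0"
  define D where "D = 1 + \<bar>t\<^sup>2 / 2\<bar>"
  have D: "D > 0" by (simp add: D_def add_pos_nonneg)
  then have "e / (2 * D) > 0" using e by simp
  from comparable_multiple[OF m this] obtain N where N: "N \<ge> 1" "\<forall>n\<ge>N. scaled_close (m * n) n (e / (2 * D))" .
  show "\<exists>N. \<forall>n\<ge>N. \<bar>cmod (mix_char M (\<lambda>_. 0) (V (m * n)) t) - cmod (mix_char M (\<lambda>_. 0) (V n) (sqrt (real m) * b n / b (m * n) * t))\<bar> < e"
  proof (intro exI[of _ N] allI impI)
    fix n assume n: "n \<ge> N"
    let ?B = "var_factor (m * n) n"
    have d: "prob_norm M (\<lambda>\<omega>. V (m * n) \<omega> - ?B * V n \<omega>) \<le> e / (2 * D)"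
      using N(2) n unfolding scaled_close_def by blast
    have B: "(sqrt (real m) * b n / b (m * n))\<^sup>2 = ?B"
      using n N(1) by (simp add: var_factor_def power_mult_distrib power_divide)
    have "cmod (mix_char M (\<lambda>_. 0) (V (m * n)) t - mix_char M (\<lambda>_. 0) (\<lambda>\<omega>. ?B * V n \<omega>) t) \<le>
      prob_norm M (\<lambda>\<omega>. t\<^sup>2 / 2 * (V (m * n) \<omega> - ?B * V n \<omega>))"
      using V_nonneg by (intro norm_mix_char_centred_diff_le) (auto simp flip: B)
    also have "\<dots> \<le> D * prob_norm M (\<lambda>\<omega>. V (m * n) \<omega> - ?B * V n \<omega>)"
      unfolding D_def by (rule prob_norm_mult_le) measurable
    also have "\<dots> \<le> D * (e / (2 * D))" using d D by (intro mult_left_mono) auto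
    also have "\<dots> < e" using D e by simp
    finally show "\<bar>cmod (mix_char M (\<lambda>_. 0) (V (m * n)) t) - cmod (mix_char M (\<lambda>_. 0) (V n) (sqrt (real m) * b n / b (m * n) * t))\<bar> < e"
      unfolding mix_char_scale_var[symmetric] B using norm_triangle_ineq3 by (rule le_less_trans[rotated])
  qed
qed

end

section \<open>Laplace transforms of laws on the half-line\<close>

text \<open>
Through $u = e^{-s x}$ the Laplace transform at the multiples of $s$ gives the moments of a law on
$[0,1]$, which determine the integrals of continuous functions by Weierstrass' theorem. The functions
$\cos(t x)$ and $\sin(t x)$ are not continuous in $u$ at 0, but become so after multiplication by $e^{-s x}$; then
$s \to 0$. The truncation \<open>max 0 x\<close> makes the integrands bounded and continuous on the whole line.
\<close>

lemma laplace_transform_determines_law: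
  fixes \<rho> \<rho>' :: "real measure"
  assumes rd: "real_distribution \<rho>" "real_distribution \<rho>'"
    and nonneg: "AE x in \<rho>. 0 \<le> x" "AE x in \<rho>'. 0 \<le> x"
    and eq: "\<And>s. s > 0 \<Longrightarrow> (\<integral>x. exp (- (s * max 0 x)) \<partial>\<rho>) = (\<integral>x. exp (- (s * max 0 x)) \<partial>\<rho>')"
  shows "\<rho> = \<rho>'"
proof -
  interpret P: real_distribution \<rho> by fact
  interpret Q: real_distribution \<rho>' by fact
  have cont_eq: "(\<integral>x. F (exp (- (s * max 0 x))) \<partial>\<rho>) = (\<integral>x. F (exp (- (s * max 0 x))) \<partial>\<rho>')"
    if F: "continuous_on {0..1} F" and s: "s > 0" for F :: "real \<Rightarrow> real" and s
  proof -
    let ?U = "\<lambda>x. exp (- (s * max 0 x))"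
    have U: "?U x \<in> {0..1}" for x using s by simp
    have Fm[measurable]: "(\<lambda>x. F (?U x)) \<in> borel_measurable borel"
    proof -
      have "continuous_on UNIV (\<lambda>x. F (?U x))"
        using U by (intro continuous_on_compose2[OF F] continuous_intros) auto
      then show ?thesis by (rule borel_measurable_continuous_onI)
    qed
    have "compact (F ` {0..1})" using F by (rule compact_continuous_image) simp
    then obtain B where B: "\<And>x. x \<in> {0..1} \<Longrightarrow> \<bar>F x\<bar> \<le> B" by (force simp: bounded_iff dest!: compact_imp_bounded)
    have FB: "\<bar>F (?U x)\<bar> \<le> B" for x using B[OF U[of x]] .
    have iP: "integrable \<rho> (\<lambda>x. F (?U x))" and iQ: "integrable \<rho>' (\<lambda>x. F (?U x))"
      using FB by (intro P.integrable_const_bound[where B = B] Q.integrable_const_bound[where B = B] AE_I2; simp)+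
    have close: "\<bar>(\<integral>x. F (?U x) \<partial>\<rho>) - (\<integral>x. F (?U x) \<partial>\<rho>')\<bar> \<le> e" if e: "e > 0" for e
    proof -
      obtain g where g: "real_polynomial_function g" "\<And>x. x \<in> {0..1} \<Longrightarrow> \<bar>F x - g x\<bar> < e / 2"
        using Stone_Weierstrass_real_polynomial_function[OF _ F, of "e / 2"] e by auto
      obtain c n where gc: "g = (\<lambda>x. \<Sum>i\<le>n. c i * x ^ i)" using g(1) unfolding real_polynomial_function_iff_sum by blast
      have pw: "?U x ^ i = exp (- (real i * s * max 0 x))" for x i
        by (simp add: exp_of_nat_mult[symmetric] mult.assoc)
      have ip: "integrable D (\<lambda>x. ?U x ^ i)" if "real_distribution D" for D i
      proof -
        interpret D: real_distribution D by fact
        show ?thesis using U by (intro D.integrable_const_bound[where B = 1] AE_I2) (auto intro: power_le_one)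
      qed
      have ig: "integrable D (\<lambda>x. g (?U x))" if "real_distribution D" for D
        unfolding gc using ip[OF that] by (intro Bochner_Integration.integrable_sum integrable_mult_right)
      have mom: "(\<integral>x. ?U x ^ i \<partial>\<rho>) = (\<integral>x. ?U x ^ i \<partial>\<rho>')" for i
      proof (cases "i = 0")
        case True
        then show ?thesis using P.prob_space Q.prob_space by simp
      next
        case False
        then show ?thesis unfolding pw using s by (intro eq) simp
      qed
      have geq: "(\<integral>x. g (?U x) \<partial>\<rho>) = (\<integral>x. g (?U x) \<partial>\<rho>')"
        unfolding gc using ip rd mom by (simp add: Bochner_Integration.integral_sum)
      have near: "\<bar>(\<integral>x. F (?U x) \<partial>D) - (\<integral>x. g (?U x) \<partial>D)\<bar> \<le> e / 2"
        if D: "real_distribution D" and iD: "integrable D (\<lambda>x. F (?U x))" for D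
      proof -
        interpret D: real_distribution D by fact
        have "(\<integral>x. F (?U x) \<partial>D) - (\<integral>x. g (?U x) \<partial>D) = (\<integral>x. F (?U x) - g (?U x) \<partial>D)"
          using iD ig[OF D] by simp
        also have "\<bar>\<dots>\<bar> \<le> (\<integral>x. \<bar>F (?U x) - g (?U x)\<bar> \<partial>D)" by (rule integral_abs_bound)
        also have "\<dots> \<le> (\<integral>x. e / 2 \<partial>D)"
          using iD ig[OF D] g(2)[OF U] by (intro integral_mono) (auto intro: less_imp_le)
        also have "\<dots> = e / 2" using D.prob_space by simp
        finally show ?thesis .
      qed
      show ?thesis using near[OF rd(1) iP] near[OF rd(2) iQ] geq by linarith
    qed
    show ?thesis
    proof (rule ccontr)
      assume "\<not> ?thesis"
      then show False using close[of "\<bar>(\<integral>x. F (?U x) \<partial>\<rho>) - (\<integral>x. F (?U x) \<partial>\<rho>')\<bar> / 2"] by auto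
    qed
  qed
  have trig: "(\<integral>x. h (t * max 0 x) \<partial>\<rho>) = (\<integral>x. h (t * max 0 x) \<partial>\<rho>')"
    if h: "continuous_on UNIV h" "\<And>y. \<bar>h y\<bar> \<le> 1" for h :: "real \<Rightarrow> real" and t
  proof -
    have hm[measurable]: "h \<in> borel_measurable borel" using h(1) by (rule borel_measurable_continuous_onI)
    have damped: "(\<integral>x. exp (- (s * max 0 x)) * h (t * max 0 x) \<partial>\<rho>) = (\<integral>x. exp (- (s * max 0 x)) * h (t * max 0 x) \<partial>\<rho>')"
      if s: "s > 0" for s
    proof -
      \<comment> \<open>At $u = 0$ the value is 0 because of the factor $u$, and this is also the limit.\<close>
      define F where "F u = u * h (- (t / s) * ln u)" for u
      have "continuous_on {0..1} F" unfolding continuous_on_eq_continuous_within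
      proof
        fix u :: real assume u: "u \<in> {0..1}"
        show "continuous (at u within {0..1}) F"
        proof (cases "u = 0")
          case True
          have "(F \<longlongrightarrow> 0) (at 0 within {0..1})"
          proof (rule Lim_null_comparison)
            show "\<forall>\<^sub>F u in at 0 within {0..1}. norm (F u) \<le> \<bar>u\<bar>"
              using h(2) by (intro always_eventually) (auto simp: F_def abs_mult intro: mult_left_le)
            show "((\<lambda>u::real. \<bar>u\<bar>) \<longlongrightarrow> 0) (at 0 within {0..1})" by (intro tendsto_rabs_zero tendsto_ident_at)
          qed
          then show ?thesis using True by (simp add: continuous_within F_def)
        next
          case False
          have "isCont h y" for y using h(1) by (simp add: continuous_on_eq_continuous_at)
          moreover have "isCont (\<lambda>u. - (t / s) * ln u) u" using False u by (intro isCont_mult isCont_ln) auto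
          ultimately have "isCont (\<lambda>u. h (- (t / s) * ln u)) u" by (rule isCont_o2[rotated])
          then have "isCont F u" unfolding F_def by (rule isCont_mult[OF continuous_ident])
          then show ?thesis by (rule continuous_at_imp_continuous_within)
        qed
      qed
      from cont_eq[OF this s] show ?thesis using s by (simp add: F_def)
    qed
    have lim: "(\<lambda>n. \<integral>x. exp (- (inverse (real (Suc n)) * max 0 x)) * h (t * max 0 x) \<partial>D) \<longlonglongrightarrow> (\<integral>x. h (t * max 0 x) \<partial>D)"
      if D: "real_distribution D" for D
    proof -
      interpret D: real_distribution D by fact
      show ?thesis
      proof (rule integral_dominated_convergence[where w = "\<lambda>_. 1"])
        show "AE x in D. (\<lambda>n. exp (- (inverse (real (Suc n)) * max 0 x)) * h (t * max 0 x)) \<longlonglongrightarrow> h (t * max 0 x)"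
        proof (rule AE_I2)
          fix x
          have "(\<lambda>n. exp (- (inverse (real (Suc n)) * max 0 x)) * h (t * max 0 x)) \<longlonglongrightarrow> exp (- (0 * max 0 x)) * h (t * max 0 x)"
            by (intro tendsto_intros LIMSEQ_inverse_real_of_nat)
          then show "(\<lambda>n. exp (- (inverse (real (Suc n)) * max 0 x)) * h (t * max 0 x)) \<longlonglongrightarrow> h (t * max 0 x)" by simp
        qed
        show "AE x in D. norm (exp (- (inverse (real (Suc n)) * max 0 x)) * h (t * max 0 x)) \<le> 1" for n
        proof (rule AE_I2)
          fix x
          have "exp (- (inverse (real (Suc n)) * max 0 x)) * \<bar>h (t * max 0 x)\<bar> \<le> 1 * 1"
          proof (rule mult_mono)
            have "0 \<le> inverse (real (Suc n)) * max 0 x" by (intro mult_nonneg_nonneg) auto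
            then show "exp (- (inverse (real (Suc n)) * max 0 x)) \<le> 1" by simp
          qed (use h(2) in auto)
          then show "norm (exp (- (inverse (real (Suc n)) * max 0 x)) * h (t * max 0 x)) \<le> 1" by (simp add: abs_mult)
        qed
      qed auto
    qed
    have "(\<integral>x. exp (- (inverse (real (Suc n)) * max 0 x)) * h (t * max 0 x) \<partial>\<rho>) =
        (\<integral>x. exp (- (inverse (real (Suc n)) * max 0 x)) * h (t * max 0 x) \<partial>\<rho>')" for n
      by (rule damped) simp
    with lim[OF rd(1)] have "(\<lambda>n. \<integral>x. exp (- (inverse (real (Suc n)) * max 0 x)) * h (t * max 0 x) \<partial>\<rho>') \<longlonglongrightarrow> (\<integral>x. h (t * max 0 x) \<partial>\<rho>)"
      by (simp only:)
    then show ?thesis using lim[OF rd(2)] by (rule LIMSEQ_unique)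
  qed
  have char_eq: "char D t = Complex (\<integral>x. cos (t * max 0 x) \<partial>D) (\<integral>x. sin (t * max 0 x) \<partial>D)"
    if D: "real_distribution D" and nn: "AE x in D. 0 \<le> x" for D t
  proof -
    interpret D: real_distribution D by fact
    have i: "complex_integrable D (\<lambda>x. iexp (t * max 0 x))"
      by (intro D.integrable_const_bound[where B = 1] AE_I2) auto
    have "char D t = (CLINT x|D. iexp (t * max 0 x))"
      unfolding char_def by (rule integral_cong_AE) (use nn in \<open>auto simp: max_def\<close>)
    moreover have "Re (CLINT x|D. iexp (t * max 0 x)) = (\<integral>x. cos (t * max 0 x) \<partial>D)"
      by (subst integral_Re[OF i, symmetric]) (simp add: Re_exp)
    moreover have "Im (CLINT x|D. iexp (t * max 0 x)) = (\<integral>x. sin (t * max 0 x) \<partial>D)"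
      by (subst integral_Im[OF i, symmetric]) (simp add: Im_exp)
    ultimately show ?thesis by (simp add: complex_eq_iff)
  qed
  show ?thesis
  proof (rule Levy_uniqueness[OF rd], rule ext)
    fix t
    show "char \<rho> t = char \<rho>' t"
      unfolding char_eq[OF rd(1) nonneg(1)] char_eq[OF rd(2) nonneg(2)]
      using trig[of cos t] trig[of sin t] by (simp add: continuous_on_cos continuous_on_sin continuous_on_id)
  qed
qed

context prob_space
begin

lemma weak_limit_nonneg:
  assumes [measurable]: "\<And>n. V n \<in> borel_measurable M" and V: "\<And>n \<omega>. \<omega> \<in> space M \<Longrightarrow> 0 \<le> V n \<omega>"
    and \<rho>: "real_distribution \<rho>" and w: "weak_conv_m (\<lambda>n. distr M borel (V n)) \<rho>"
  shows "AE x in \<rho>. 0 \<le> x"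
proof -
  interpret \<rho>: real_distribution \<rho> by fact
  have "(\<lambda>n. \<integral>x. min 1 (max 0 (- x)) \<partial>distr M borel (V n)) \<longlonglongrightarrow> (\<integral>x. min 1 (max 0 (- x)) \<partial>\<rho>)"
    by (rule weak_conv_imp_integral_bdd_continuous_conv[OF _ \<rho> w, where B = 1]) (auto intro!: continuous_intros)
  moreover have "(\<integral>x. min 1 (max 0 (- x)) \<partial>distr M borel (V n)) = 0" for n
  proof -
    have "(\<integral>x. min 1 (max 0 (- x)) \<partial>distr M borel (V n)) = (\<integral>\<omega>. min 1 (max 0 (- V n \<omega>)) \<partial>M)"
      by (subst integral_distr) auto
    also have "\<dots> = (\<integral>\<omega>. 0 \<partial>M)" using V by (intro Bochner_Integration.integral_cong) (simp_all add: max_absorb1)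
    finally show ?thesis by simp
  qed
  ultimately have "(\<integral>x. min 1 (max 0 (- x)) \<partial>\<rho>) = 0" by (simp add: LIMSEQ_const_iff)
  moreover have "integrable \<rho> (\<lambda>x. min 1 (max 0 (- x)))"
    by (intro \<rho>.integrable_const_bound[where B = 1] AE_I2) auto
  ultimately have "AE x in \<rho>. min 1 (max 0 (- x)) = 0" by (subst (asm) integral_nonneg_eq_0_iff_AE) auto
  then show ?thesis by eventually_elim (auto simp: min_def max_def split: if_splits)
qed

lemma weak_limit_laplace:
  assumes m[measurable]: "\<And>n. V n \<in> borel_measurable M" and V: "\<And>n \<omega>. \<omega> \<in> space M \<Longrightarrow> 0 \<le> V n \<omega>"
    and \<rho>: "real_distribution \<rho>" and w: "weak_conv_m (\<lambda>n. distr M borel (V n)) \<rho>" and s: "s \<ge> 0"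
  shows "(\<lambda>n. \<integral>\<omega>. exp (- (s * V n \<omega>)) \<partial>M) \<longlonglongrightarrow> (\<integral>x. exp (- (s * max 0 x)) \<partial>\<rho>)"
proof -
  have "(\<lambda>n. \<integral>x. exp (- (s * max 0 x)) \<partial>distr M borel (V n)) \<longlonglongrightarrow> (\<integral>x. exp (- (s * max 0 x)) \<partial>\<rho>)"
    by (rule weak_conv_imp_integral_bdd_continuous_conv[OF _ \<rho> w, where B = 1]) (use s in \<open>auto intro!: continuous_intros\<close>)
  moreover have "(\<integral>x. exp (- (s * max 0 x)) \<partial>distr M borel (V n)) = (\<integral>\<omega>. exp (- (s * V n \<omega>)) \<partial>M)" for n
  proof -
    have "(\<integral>x. exp (- (s * max 0 x)) \<partial>distr M borel (V n)) = (\<integral>\<omega>. exp (- (s * max 0 (V n \<omega>))) \<partial>M)"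
      by (subst integral_distr) auto
    also have "\<dots> = (\<integral>\<omega>. exp (- (s * V n \<omega>)) \<partial>M)" using V by (intro Bochner_Integration.integral_cong) (auto simp: max_def)
    finally show ?thesis .
  qed
  ultimately show ?thesis by simp
qed

text \<open>
The bound holds from some index on; each of the finitely many earlier variables is tight by itself.
\<close>

lemma bounded_in_prob_imp_tight:
  assumes m[measurable]: "\<And>n. V n \<in> borel_measurable M" and bdd: "bounded_in_prob M V"
  shows "tight (\<lambda>n. distr M borel (V n))"
  unfolding tight_def
proof (intro conjI allI impI)
  fix \<epsilon> :: real assume "\<epsilon> > 0"
  then have e2: "\<epsilon> / 2 > 0" by simp
  then obtain s0 N where s0: "s0 > 0" "\<And>n. n \<ge> N \<Longrightarrow> prob_norm M (\<lambda>\<omega>. s0 * V n \<omega>) \<le> \<epsilon> / 2"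
    using bdd unfolding bounded_in_prob_def eventually_sequentially by blast
  obtain f where f: "\<And>n. f n > 0" "\<And>n. prob_norm M (\<lambda>\<omega>. f n * V n \<omega>) \<le> \<epsilon> / 2"
    using prob_norm_small_multiple[OF m e2] by metis
  define s where "s = Min (insert s0 (f ` {..<N}))"
  have s: "s > 0" unfolding s_def using s0 f by (subst Min_gr_iff) auto
  have mono: "prob_norm M (\<lambda>\<omega>. s * V n \<omega>) \<le> prob_norm M (\<lambda>\<omega>. r * V n \<omega>)" if "s \<le> r" for r n
    using that s by (intro prob_norm_mono) (auto simp: abs_mult intro!: mult_right_mono)
  have sV: "prob_norm M (\<lambda>\<omega>. s * V n \<omega>) \<le> \<epsilon> / 2" for n
  proof (cases "n < N")
    case True
    then have "s \<le> f n" unfolding s_def by (intro Min_le) auto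
    from mono[OF this, of n] f(2)[of n] show ?thesis by linarith
  next
    case False
    have "s \<le> s0" unfolding s_def by (intro Min_le) auto
    from mono[OF this, of n] s0(2)[of n] False show ?thesis by linarith
  qed
  show "\<exists>a b. a < b \<and> (\<forall>n. measure (distr M borel (V n)) {a<..b} > 1 - \<epsilon>)"
  proof (rule exI[of _ "- (1 / s)"], rule exI[of _ "1 / s"], intro conjI allI)
    show "- (1 / s) < 1 / s" using s by (simp add: field_simps)
    fix n
    let ?A = "{\<omega>\<in>space M. \<not> (- (1 / s) < V n \<omega> \<and> V n \<omega> \<le> 1 / s)}"
    have A: "?A \<in> events" by measurable
    have "prob ?A = (\<integral>\<omega>. indicator ?A \<omega> \<partial>M)" by (simp add: Int_absorb1)
    also have "\<dots> \<le> prob_norm M (\<lambda>\<omega>. s * V n \<omega>)" unfolding prob_norm_def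
    proof (rule integral_mono)
      show "integrable M (indicat_real ?A)" using A by (intro integrable_real_indicator) (auto simp: less_top[symmetric])
      fix \<omega>
      have "1 \<le> \<bar>s * V n \<omega>\<bar>" if "\<not> (- (1 / s) < V n \<omega> \<and> V n \<omega> \<le> 1 / s)"
      proof -
        have "1 / s \<le> \<bar>V n \<omega>\<bar>" using that by linarith
        then show ?thesis using s by (simp add: abs_mult field_simps)
      qed
      then show "indicat_real ?A \<omega> \<le> min 1 \<bar>s * V n \<omega>\<bar>" by (auto simp: indicator_def)
    qed auto
    finally have "prob ?A \<le> \<epsilon> / 2" using sV[of n] by simp
    moreover have "measure (distr M borel (V n)) {- (1 / s)<..1 / s} = 1 - prob ?A"
    proof -
      have "measure (distr M borel (V n)) {- (1 / s)<..1 / s} = prob (space M - ?A)"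
        by (subst measure_distr) (auto intro!: arg_cong[where f = prob])
      then show ?thesis using prob_compl[OF A] by simp
    qed
    ultimately show "measure (distr M borel (V n)) {- (1 / s)<..1 / s} > 1 - \<epsilon>" using \<open>\<epsilon> > 0\<close> by simp
  qed
qed simp

text \<open>
Helly's theorem supplies a limit point, and all limit points have the same Laplace transform.
\<close>

lemma laplace_convergent_imp_weak_conv:
  assumes m[measurable]: "\<And>n. V n \<in> borel_measurable M" and V: "\<And>n \<omega>. \<omega> \<in> space M \<Longrightarrow> 0 \<le> V n \<omega>"
    and bdd: "bounded_in_prob M V"
    and lim: "\<And>s. s > 0 \<Longrightarrow> (\<lambda>n. \<integral>\<omega>. exp (- (s * V n \<omega>)) \<partial>M) \<longlonglongrightarrow> L s"
  obtains \<rho> where "real_distribution \<rho>" "weak_conv_m (\<lambda>n. distr M borel (V n)) \<rho>"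
proof -
  let ?\<mu> = "\<lambda>n. distr M borel (V n)"
  have tight: "tight ?\<mu>" by (rule bounded_in_prob_imp_tight[OF m bdd])
  have lap: "(\<integral>x. exp (- (s * max 0 x)) \<partial>\<rho>) = L s"
    if r: "strict_mono r" "real_distribution \<rho>" "weak_conv_m (?\<mu> \<circ> r) \<rho>" and s: "s > 0" for r :: "nat \<Rightarrow> nat" and \<rho> s
  proof -
    have "(\<lambda>n. \<integral>\<omega>. exp (- (s * V (r n) \<omega>)) \<partial>M) \<longlonglongrightarrow> (\<integral>x. exp (- (s * max 0 x)) \<partial>\<rho>)"
      using r s V by (intro weak_limit_laplace) (auto simp: o_def)
    moreover have "(\<lambda>n. \<integral>\<omega>. exp (- (s * V (r n) \<omega>)) \<partial>M) \<longlonglongrightarrow> L s"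
      using LIMSEQ_subseq_LIMSEQ[OF lim[OF s] r(1)] by (simp add: o_def)
    ultimately show ?thesis by (rule LIMSEQ_unique)
  qed
  have nn: "AE x in \<rho>. 0 \<le> x" if r: "real_distribution \<rho>" "weak_conv_m (?\<mu> \<circ> r) \<rho>" for r :: "nat \<Rightarrow> nat" and \<rho>
    using weak_limit_nonneg[of "\<lambda>n. V (r n)" \<rho>] r V by (simp add: o_def)
  obtain r \<rho> where r: "strict_mono (r :: nat \<Rightarrow> nat)" and \<rho>: "real_distribution \<rho>" "weak_conv_m (?\<mu> \<circ> r) \<rho>"
    using tight_imp_convergent_subsubsequence[OF tight strict_mono_id] by auto
  have "weak_conv_m ?\<mu> \<rho>"
  proof (rule tight_subseq_weak_converge[OF _ \<rho>(1) tight])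
    show "weak_conv_m (?\<mu> \<circ> s) \<rho>" if s: "strict_mono s" "real_distribution \<nu>" "weak_conv_m (?\<mu> \<circ> s) \<nu>" for s \<nu>
    proof -
      have "\<nu> = \<rho>"
        using lap[OF s] lap[OF r \<rho>] nn[OF s(2,3)] nn[OF \<rho>]
        by (intro laplace_transform_determines_law s(2) \<rho>(1)) auto
      then show ?thesis using s(3) by simp
    qed
  qed simp
  with \<rho>(1) show thesis by (rule that)
qed

end

text \<open>
On the arc where the angles stay in $[-1, 1]$ the logarithm inverts the exponential continuously.
\<close>

lemma tendsto_of_iexp_tendsto:
  fixes c :: "nat \<Rightarrow> real"
  assumes lim: "(\<lambda>n. iexp (t * c n)) \<longlonglongrightarrow> z" and t: "t > 0" and bnd: "\<forall>\<^sub>F n in sequentially. t * \<bar>c n\<bar> \<le> 1"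
  shows "\<exists>l. c \<longlonglongrightarrow> l"
proof -
  have cos1: "cos (t * c n) \<ge> cos 1" if "t * \<bar>c n\<bar> \<le> 1" for n
  proof -
    have "cos 1 \<le> cos \<bar>t * c n\<bar>"
      using that t pi_gt3 by (intro cos_monotone_0_pi_le) (auto simp: abs_mult)
    then show ?thesis by simp
  qed
  have "(\<lambda>n. cos (t * c n)) \<longlonglongrightarrow> Re z"
    using tendsto_Re[OF lim] by (simp add: Re_exp)
  then have "cos 1 \<le> Re z"
  proof (rule tendsto_lowerbound)
    show "\<forall>\<^sub>F n in sequentially. cos 1 \<le> cos (t * c n)" using bnd cos1 by (auto elim: eventually_mono)
  qed simp
  then have Re: "Re z > 0" using cos_gt_zero[of 1] pi_gt3 by linarith
  then have z: "z \<notin> \<real>\<^sub>\<le>\<^sub>0" by (auto simp: complex_nonpos_Reals_iff)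
  have "(\<lambda>n. Im (Ln (iexp (t * c n))) / t) \<longlonglongrightarrow> Im (Ln z) / t"
    using z t by (intro tendsto_intros tendsto_Ln lim) auto
  moreover have "\<forall>\<^sub>F n in sequentially. Im (Ln (iexp (t * c n))) / t = c n"
    using bnd
  proof eventually_elim
    case (elim n)
    have "\<bar>t * c n\<bar> \<le> 1" using elim t by (simp add: abs_mult)
    then have "Ln (iexp (t * c n)) = \<i> * complex_of_real (t * c n)"
      using pi_gt3 by (intro Ln_exp) (auto simp: abs_le_iff)
    then show ?case using t by simp
  qed
  ultimately have "c \<longlonglongrightarrow> Im (Ln z) / t" by (rule Lim_transform_eventually)
  then show ?thesis by blast
qed

section \<open>The limit with random variance\<close>

context scaling_family
begin

text \<open>
The Laplace transforms of $V_n$ converge to the modulus of the limit characteristic function, so $V_n$ converges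
in law. Dividing the mixture by this transform, which has a positive limit, leaves $e^{i t c_n}$; since
$c_n$ is bounded, one small $t$ suffices to conclude that $c_n$ converges.
\<close>

lemma random_variance_limit:
  assumes c: "(\<lambda>n. prob_norm M (\<lambda>\<omega>. Y n \<omega> - c n)) \<longlonglongrightarrow> 0"
  obtains \<gamma> \<rho> where "(\<lambda>n. prob_norm M (\<lambda>\<omega>. Y n \<omega> - \<gamma>)) \<longlonglongrightarrow> 0" "real_distribution \<rho>"
    "weak_conv_m (\<lambda>n. distr M borel (V n)) \<rho>" "\<rho> \<noteq> return borel 0"
    "\<And>t. char \<nu> t = iexp (t * \<gamma>) * complex_of_real (\<integral>x. exp (- (t\<^sup>2 / 2 * max 0 x)) \<partial>\<rho>)"
proof -
  have lap: "(\<lambda>n. \<integral>\<omega>. exp (- (t\<^sup>2 / 2 * V n \<omega>)) \<partial>M) \<longlonglongrightarrow> cmod (char \<nu> t)" for t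
    using laplace_var_limit(2)[OF c, of t] unfolding mix_char_centred by (simp add: Bochner_Integration.integral_nonneg)
  have "(\<lambda>n. \<integral>\<omega>. exp (- (s * V n \<omega>)) \<partial>M) \<longlonglongrightarrow> cmod (char \<nu> (sqrt (2 * s)))" if "s > 0" for s
    using lap[of "sqrt (2 * s)"] that by simp
  then obtain \<rho> where \<rho>: "real_distribution \<rho>" and w: "weak_conv_m (\<lambda>n. distr M borel (V n)) \<rho>"
    using laplace_convergent_imp_weak_conv[OF V_meas V_nonneg bounded_V, of "\<lambda>s. cmod (char \<nu> (sqrt (2 * s)))"] by blast
  interpret \<rho>: real_distribution \<rho> by fact
  let ?g = "\<lambda>t. \<integral>x. exp (- (t\<^sup>2 / 2 * max 0 x)) \<partial>\<rho>"
  have lim_g: "(\<lambda>n. \<integral>\<omega>. exp (- (t\<^sup>2 / 2 * V n \<omega>)) \<partial>M) \<longlonglongrightarrow> ?g t" for t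
    by (rule weak_limit_laplace[OF V_meas V_nonneg \<rho> w]) auto
  have g: "?g t = cmod (char \<nu> t)" for t using LIMSEQ_unique[OF lim_g lap] .
  have g_pos: "?g t > 0" for t
  proof -
    have i: "integrable \<rho> (\<lambda>x. exp (- (t\<^sup>2 / 2 * max 0 x)))"
      by (intro \<rho>.integrable_const_bound[where B = 1] AE_I2) auto
    have "?g t \<noteq> 0"
      by (subst integral_nonneg_eq_0_iff_AE[OF i]) (auto simp: \<rho>.AE_False)
    then show ?thesis by (simp add: less_le Bochner_Integration.integral_nonneg)
  qed
  obtain s N where s: "s > 0" and sY: "\<And>n. n \<ge> N \<Longrightarrow> prob_norm M (\<lambda>\<omega>. s * Y n \<omega>) \<le> 1 / 4"
    using bounded_in_probD[OF bounded_Y, of "1 / 4"] by auto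
  have "(\<lambda>n. prob_norm M (\<lambda>\<omega>. s * (Y n \<omega> - c n))) \<longlonglongrightarrow> 0"
    using c by (intro prob_norm_mult_tendsto_0) auto
  then have "\<forall>\<^sub>F n in sequentially. prob_norm M (\<lambda>\<omega>. s * (Y n \<omega> - c n)) < 1 / 4"
    by (rule order_tendstoD(2)) simp
  then have bnd: "\<forall>\<^sub>F n in sequentially. s * \<bar>c n\<bar> \<le> 1"
    using eventually_ge_at_top[of N]
  proof eventually_elim
    case (elim n)
    have "min 1 \<bar>s * c n\<bar> = prob_norm M (\<lambda>\<omega>. s * c n)" by (simp add: prob_norm_def prob_space)
    also have "\<dots> \<le> prob_norm M (\<lambda>\<omega>. s * Y n \<omega>) + prob_norm M (\<lambda>\<omega>. s * (Y n \<omega> - c n))"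
      by (rule prob_norm_le_add) (auto simp: algebra_simps)
    also have "\<dots> < 1" using elim sY[of n] by linarith
    finally show ?case using s by (simp add: abs_mult min_def split: if_splits)
  qed
  have "(\<lambda>n. iexp (s * c n) * mix_char M (\<lambda>_. 0) (V n) s / mix_char M (\<lambda>_. 0) (V n) s) \<longlonglongrightarrow> char \<nu> s / complex_of_real (?g s)"
    using g_pos[of s] unfolding mix_char_centred
    by (intro tendsto_divide laplace_var_limit(1)[OF c, unfolded mix_char_centred] tendsto_of_real lim_g) auto
  moreover have "\<forall>\<^sub>F n in sequentially. iexp (s * c n) * mix_char M (\<lambda>_. 0) (V n) s / mix_char M (\<lambda>_. 0) (V n) s = iexp (s * c n)"
    using order_tendstoD(1)[OF lim_g g_pos, of s] by eventually_elim (simp add: mix_char_centred)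
  ultimately have "(\<lambda>n. iexp (s * c n)) \<longlonglongrightarrow> char \<nu> s / complex_of_real (?g s)"
    by (rule Lim_transform_eventually)
  from tendsto_of_iexp_tendsto[OF this s bnd] obtain \<gamma> where \<gamma>: "c \<longlonglongrightarrow> \<gamma>" by blast
  have char_eq: "char \<nu> t = iexp (t * \<gamma>) * complex_of_real (?g t)" for t
  proof (rule LIMSEQ_unique[OF laplace_var_limit(1)[OF c]])
    show "(\<lambda>n. iexp (t * c n) * mix_char M (\<lambda>_. 0) (V n) t) \<longlonglongrightarrow> iexp (t * \<gamma>) * complex_of_real (?g t)"
      unfolding mix_char_centred by (intro tendsto_intros lim_g \<gamma>)
  qed
  have "(\<lambda>n. prob_norm M (\<lambda>\<omega>. Y n \<omega> - \<gamma>)) \<longlonglongrightarrow> 0"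
  proof (rule tendsto_sandwich[OF _ _ tendsto_const])
    have "(\<lambda>n. prob_norm M (\<lambda>\<omega>. Y n \<omega> - c n) + \<bar>c n - \<gamma>\<bar>) \<longlonglongrightarrow> 0 + \<bar>\<gamma> - \<gamma>\<bar>"
      by (intro tendsto_intros c \<gamma>)
    then show "(\<lambda>n. prob_norm M (\<lambda>\<omega>. Y n \<omega> - c n) + \<bar>c n - \<gamma>\<bar>) \<longlonglongrightarrow> 0" by simp
    show "\<forall>\<^sub>F n in sequentially. prob_norm M (\<lambda>\<omega>. Y n \<omega> - \<gamma>) \<le> prob_norm M (\<lambda>\<omega>. Y n \<omega> - c n) + \<bar>c n - \<gamma>\<bar>"
    proof (intro always_eventually allI)
      fix n
      have "prob_norm M (\<lambda>\<omega>. Y n \<omega> - \<gamma>) \<le> prob_norm M (\<lambda>\<omega>. Y n \<omega> - c n) + prob_norm M (\<lambda>\<omega>. c n - \<gamma>)"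
        by (rule prob_norm_le_add) auto
      also have "prob_norm M (\<lambda>\<omega>. c n - \<gamma>) \<le> \<bar>c n - \<gamma>\<bar>" by (simp add: prob_norm_def prob_space)
      finally show "prob_norm M (\<lambda>\<omega>. Y n \<omega> - \<gamma>) \<le> prob_norm M (\<lambda>\<omega>. Y n \<omega> - c n) + \<bar>c n - \<gamma>\<bar>" by simp
    qed
  qed auto
  moreover have "\<rho> \<noteq> return borel 0"
  proof
    assume "\<rho> = return borel 0"
    then have "?g t = 1" for t by (simp add: integral_return)
    then show False using norm_char_limit_props(3) g by simp
  qed
  ultimately show thesis using \<rho> w char_eq by (intro that)
qed

end

section \<open>Mixing measures with a degenerate coordinate\<close>

lemma mixing_measure_product:
  assumes D1: "real_distribution D1" and D2: "real_distribution D2" and nonneg: "AE s in D2. 0 \<le> s"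
  shows "mixing_measure (D1 \<Otimes>\<^sub>M D2)"
    and "normal_mixture_char (D1 \<Otimes>\<^sub>M D2) t = char D1 t * complex_of_real (\<integral>s. exp (- (t\<^sup>2 / 2 * s)) \<partial>D2)"
proof -
  interpret D1: real_distribution D1 by fact
  interpret D2: real_distribution D2 by fact
  interpret P: pair_prob_space D1 D2 ..
  have sets: "sets (D1 \<Otimes>\<^sub>M D2) = sets (borel :: (real \<times> real) measure)"
    unfolding borel_prod[symmetric] by (rule sets_pair_measure_cong) simp_all
  have "D2.prob {0..} = 1"
  proof -
    have "AE s in D2. s \<in> {0..}" using nonneg by simp
    then show ?thesis by (subst D2.prob_eq_1) auto
  qed
  then have "emeasure (D1 \<Otimes>\<^sub>M D2) (UNIV \<times> {0..}) = 1"
    using D1.prob_space by (subst D2.emeasure_pair_measure_Times) (auto simp: D1.emeasure_eq_measure D2.emeasure_eq_measure)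
  then have "measure (D1 \<Otimes>\<^sub>M D2) (UNIV \<times> {0..}) = 1" by (simp add: measure_def)
  then show "mixing_measure (D1 \<Otimes>\<^sub>M D2)"
    unfolding mixing_measure_def using sets P.prob_space_axioms by simp
  let ?f = "\<lambda>\<gamma> s. exp (\<i> * complex_of_real (t * \<gamma>) - complex_of_real (t\<^sup>2 / 2 * s))"
  have AE: "AE z in D1 \<Otimes>\<^sub>M D2. 0 \<le> snd z"
  proof (rule P.AE_pair_measure)
    show "{z \<in> space (D1 \<Otimes>\<^sub>M D2). 0 \<le> snd z} \<in> sets (D1 \<Otimes>\<^sub>M D2)" by measurable
  qed (use nonneg in simp)
  have i: "complex_integrable (D1 \<Otimes>\<^sub>M D2) (case_prod ?f)"
  proof (rule P.integrable_const_bound[where B = 1])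
    show "AE z in D1 \<Otimes>\<^sub>M D2. cmod (case_prod ?f z) \<le> 1"
      using AE by eventually_elim (auto simp: split_beta)
  qed measurable
  have "normal_mixture_char (D1 \<Otimes>\<^sub>M D2) t = (CLINT \<gamma>|D1. CLINT s|D2. ?f \<gamma> s)"
    unfolding normal_mixture_char_def by (rule P.integral_fst[OF i, symmetric])
  also have "\<dots> = (CLINT \<gamma>|D1. CLINT s|D2. iexp (t * \<gamma>) * complex_of_real (exp (- (t\<^sup>2 / 2 * s))))"
  proof (intro Bochner_Integration.integral_cong refl)
    show "?f \<gamma> s = iexp (t * \<gamma>) * complex_of_real (exp (- (t\<^sup>2 / 2 * s)))" for \<gamma> s
      unfolding exp_of_real[symmetric] exp_add[symmetric] by simp
  qed
  also have "\<dots> = char D1 t * complex_of_real (\<integral>s. exp (- (t\<^sup>2 / 2 * s)) \<partial>D2)"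
    unfolding char_def by simp
  finally show "normal_mixture_char (D1 \<Otimes>\<^sub>M D2) t = char D1 t * complex_of_real (\<integral>s. exp (- (t\<^sup>2 / 2 * s)) \<partial>D2)" .
qed

lemma normal_mixture_char_random_mean:
  assumes \<rho>: "real_distribution \<rho>"
  shows "mixing_measure (\<rho> \<Otimes>\<^sub>M return borel 0)" "normal_mixture_char (\<rho> \<Otimes>\<^sub>M return borel 0) t = char \<rho> t"
proof -
  have nn: "AE s in return borel (0 :: real). 0 \<le> s" by (subst AE_return) auto
  show "mixing_measure (\<rho> \<Otimes>\<^sub>M return borel 0)" by (rule mixing_measure_product(1)[OF \<rho> real_distribution_return nn])
  show "normal_mixture_char (\<rho> \<Otimes>\<^sub>M return borel 0) t = char \<rho> t"
    unfolding mixing_measure_product(2)[OF \<rho> real_distribution_return nn] by (simp add: integral_return)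
qed

lemma normal_mixture_char_random_variance:
  assumes \<rho>: "real_distribution \<rho>" and nn: "AE s in \<rho>. 0 \<le> s"
  shows "mixing_measure (return borel \<gamma> \<Otimes>\<^sub>M \<rho>)"
    "normal_mixture_char (return borel \<gamma> \<Otimes>\<^sub>M \<rho>) t = iexp (t * \<gamma>) * complex_of_real (\<integral>x. exp (- (t\<^sup>2 / 2 * max 0 x)) \<partial>\<rho>)"
proof -
  interpret \<rho>: real_distribution \<rho> by fact
  show "mixing_measure (return borel \<gamma> \<Otimes>\<^sub>M \<rho>)" by (rule mixing_measure_product(1)[OF real_distribution_return \<rho> nn])
  have "(\<integral>s. exp (- (t\<^sup>2 / 2 * s)) \<partial>\<rho>) = (\<integral>x. exp (- (t\<^sup>2 / 2 * max 0 x)) \<partial>\<rho>)"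
  proof (rule integral_cong_AE)
    show "AE s in \<rho>. exp (- (t\<^sup>2 / 2 * s)) = exp (- (t\<^sup>2 / 2 * max 0 s))"
      using nn by eventually_elim (simp add: max_absorb2)
  qed auto
  then show "normal_mixture_char (return borel \<gamma> \<Otimes>\<^sub>M \<rho>) t = iexp (t * \<gamma>) * complex_of_real (\<integral>x. exp (- (t\<^sup>2 / 2 * max 0 x)) \<partial>\<rho>)"
    unfolding mixing_measure_product(2)[OF real_distribution_return \<rho> nn] char_return by simp
qed

section \<open>Normed sums of a directed sequence\<close>

text \<open>
Raising the truncation level from $\tau B'$ to $\tau B$ changes the integrands only where $|x| \ge \tau B'$, and
there by at most $\tau B$ and $(\tau B)^2$.
\<close>

lemma (in real_distribution) truncated_moments_compare:
  fixes \<tau> B B' :: real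
  assumes \<tau>: "\<tau> > 0" and B: "0 < B'" "B' \<le> B"
  defines "r \<equiv> prob {x. \<tau> * B' \<le> \<bar>x\<bar>}"
  defines "m \<equiv> \<lambda>B. LINT x:{x. \<bar>x\<bar> < \<tau> * B}|M. x" and "q \<equiv> \<lambda>B. LINT x:{x. \<bar>x\<bar> < \<tau> * B}|M. x\<^sup>2"
  shows "\<bar>m B - m B'\<bar> \<le> \<tau> * B * r" "\<bar>(q B - (m B)\<^sup>2) - (q B' - (m B')\<^sup>2)\<bar> \<le> 3 * (\<tau> * B)\<^sup>2 * r"
proof -
  define T where "T B = {x::real. \<bar>x\<bar> < \<tau> * B}" for B
  have Tm[measurable]: "T B \<in> sets borel" for B unfolding T_def by measurable
  have R[measurable]: "{x. \<tau> * B' \<le> \<bar>x\<bar>} \<in> sets borel" by measurable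
  have iR: "integrable M (indicat_real {x. \<tau> * B' \<le> \<bar>x\<bar>})"
    by (intro integrable_real_indicator) (auto simp: less_top[symmetric])
  have m: "m B = (\<integral>x. indicator (T B) x * x \<partial>M)" and q: "q B = (\<integral>x. indicator (T B) x * x\<^sup>2 \<partial>M)" for B
    unfolding m_def q_def set_lebesgue_integral_def T_def by simp_all
  have TB: "\<tau> * B' \<le> \<tau> * B" using \<tau> B by simp
  have bm: "\<bar>indicator (T C) x * x\<bar> \<le> \<tau> * C" if "C > 0" for C x
    using that \<tau> by (auto simp: T_def indicator_def)
  have bq: "\<bar>indicator (T C) x * x\<^sup>2\<bar> \<le> (\<tau> * C)\<^sup>2" if "C > 0" for C x
  proof (cases "x \<in> T C")
    case True
    then have "\<bar>x\<bar> \<le> \<bar>\<tau> * C\<bar>" using that \<tau> by (simp add: T_def)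
    then show ?thesis using True by (simp add: abs_le_square_iff)
  qed simp
  have im: "integrable M (\<lambda>x. indicator (T C) x * x)" if "C > 0" for C
    using bm[OF that] by (intro integrable_const_bound[where B = "\<tau> * C"] AE_I2) auto
  have iq: "integrable M (\<lambda>x. indicator (T C) x * x\<^sup>2)" if "C > 0" for C
    using bq[OF that] by (intro integrable_const_bound[where B = "(\<tau> * C)\<^sup>2"] AE_I2) auto
  have B0: "B > 0" using B by simp
  show md: "\<bar>m B - m B'\<bar> \<le> \<tau> * B * r"
  proof -
    have "m B - m B' = (\<integral>x. indicator (T B) x * x - indicator (T B') x * x \<partial>M)"
      unfolding m using im[OF B0] im[OF B(1)] by simp
    also have "\<bar>\<dots>\<bar> \<le> (\<integral>x. \<bar>indicator (T B) x * x - indicator (T B') x * x\<bar> \<partial>M)" by (rule integral_abs_bound)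
    also have "\<dots> \<le> (\<integral>x. \<tau> * B * indicator {x. \<tau> * B' \<le> \<bar>x\<bar>} x \<partial>M)"
    proof (rule integral_mono)
      show "\<bar>indicator (T B) x * x - indicator (T B') x * x\<bar> \<le> \<tau> * B * indicat_real {x. \<tau> * B' \<le> \<bar>x\<bar>} x" for x
      proof (cases "\<tau> * B' \<le> \<bar>x\<bar>")
        case True
        then have "x \<notin> T B'" by (simp add: T_def)
        then show ?thesis using True bm[OF B0, of x] by simp
      next
        case False
        then have "x \<in> T B'" "x \<in> T B" using TB unfolding T_def by auto
        then show ?thesis using False by simp
      qed
    qed (use im[OF B0] im[OF B(1)] iR in auto)
    also have "\<dots> = \<tau> * B * r" by (simp add: r_def)
    finally show ?thesis .
  qed
  have qd: "\<bar>q B - q B'\<bar> \<le> (\<tau> * B)\<^sup>2 * r"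
  proof -
    have "q B - q B' = (\<integral>x. indicator (T B) x * x\<^sup>2 - indicator (T B') x * x\<^sup>2 \<partial>M)"
      unfolding q using iq[OF B0] iq[OF B(1)] by simp
    also have "\<bar>\<dots>\<bar> \<le> (\<integral>x. \<bar>indicator (T B) x * x\<^sup>2 - indicator (T B') x * x\<^sup>2\<bar> \<partial>M)" by (rule integral_abs_bound)
    also have "\<dots> \<le> (\<integral>x. (\<tau> * B)\<^sup>2 * indicator {x. \<tau> * B' \<le> \<bar>x\<bar>} x \<partial>M)"
    proof (rule integral_mono)
      show "\<bar>indicator (T B) x * x\<^sup>2 - indicator (T B') x * x\<^sup>2\<bar> \<le> (\<tau> * B)\<^sup>2 * indicat_real {x. \<tau> * B' \<le> \<bar>x\<bar>} x" for x
      proof (cases "\<tau> * B' \<le> \<bar>x\<bar>")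
        case True
        then have "x \<notin> T B'" by (simp add: T_def)
        then show ?thesis using True bq[OF B0, of x] by simp
      next
        case False
        then have "x \<in> T B'" "x \<in> T B" using TB unfolding T_def by auto
        then show ?thesis using False by simp
      qed
    qed (use iq[OF B0] iq[OF B(1)] iR in auto)
    also have "\<dots> = (\<tau> * B)\<^sup>2 * r" by (simp add: r_def)
    finally show ?thesis .
  qed
  have mb: "\<bar>m C\<bar> \<le> \<tau> * C" if "C > 0" for C
  proof -
    have "\<bar>m C\<bar> \<le> (\<integral>x. \<bar>indicator (T C) x * x\<bar> \<partial>M)" unfolding m by (rule integral_abs_bound)
    also have "\<dots> \<le> (\<integral>x. \<tau> * C \<partial>M)" using im[OF that] bm[OF that] by (intro integral_mono) auto
    also have "\<dots> = \<tau> * C" using prob_space by simp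
    finally show ?thesis .
  qed
  have "\<bar>(m B)\<^sup>2 - (m B')\<^sup>2\<bar> = \<bar>m B - m B'\<bar> * \<bar>m B + m B'\<bar>"
    by (simp add: abs_mult[symmetric] power2_eq_square algebra_simps)
  also have "\<dots> \<le> (\<tau> * B * r) * (2 * (\<tau> * B))"
    using md mb[OF B0] mb[OF B(1)] TB by (intro mult_mono) auto
  finally have "\<bar>(m B)\<^sup>2 - (m B')\<^sup>2\<bar> \<le> 2 * ((\<tau> * B)\<^sup>2 * r)" by (simp add: power2_eq_square mult_ac)
  then show "\<bar>(q B - (m B)\<^sup>2) - (q B' - (m B')\<^sup>2)\<bar> \<le> 3 * (\<tau> * B)\<^sup>2 * r" using qd by linarith
qed

locale mixed_iid = prob_space M for M :: "'a measure" +
  fixes X :: "nat \<Rightarrow> 'a \<Rightarrow> real" and p :: "'a \<Rightarrow> real measure" and a b :: "nat \<Rightarrow> real"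
  assumes X_meas: "\<And>n. n \<ge> 1 \<Longrightarrow> X n \<in> borel_measurable M"
    and directing: "directing_measure M X p"
    and b_pos: "\<And>n. n \<ge> 1 \<Longrightarrow> b n > 0"
begin

definition normed_sum :: "nat \<Rightarrow> 'a \<Rightarrow> real" where
  "normed_sum n \<omega> = ((\<Sum>i=1..n. X i \<omega>) - a n) / b n"

definition centred_mean :: "real \<Rightarrow> nat \<Rightarrow> 'a \<Rightarrow> real" where
  "centred_mean \<tau> n \<omega> = trunc_mean p b \<tau> n \<omega> - a n / b n"

definition tail_mass :: "real \<Rightarrow> nat \<Rightarrow> 'a \<Rightarrow> real" where
  "tail_mass \<epsilon> n \<omega> = real n * (measure (p \<omega>) {..- (\<epsilon> * b n)} + measure (p \<omega>) {\<epsilon> * b n<..})"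

lemma p_kernel: "p \<in> M \<rightarrow>\<^sub>M prob_algebra borel"
  using directing by (simp add: directing_measure_def)

lemma p_subprob [measurable]: "p \<in> M \<rightarrow>\<^sub>M subprob_algebra borel"
  using p_kernel by (rule measurable_prob_algebraD)

lemma real_distribution_p: "\<omega> \<in> space M \<Longrightarrow> real_distribution (p \<omega>)"
  using measurable_space[OF p_kernel, of \<omega>]
  by (auto simp: space_prob_algebra real_distribution_def real_distribution_axioms_def dest: sets_eq_imp_space_eq)

lemma measurable_integral_p:
  fixes f :: "real \<Rightarrow> 'c::{banach, second_countable_topology}"
  assumes "f \<in> borel_measurable borel"
  shows "(\<lambda>\<omega>. integral\<^sup>L (p \<omega>) f) \<in> borel_measurable M"
  by (rule measurable_compose[OF p_subprob integral_measurable_subprob_algebra[OF assms]])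

lemma measurable_set_integral_p [measurable]:
  fixes f :: "real \<Rightarrow> real"
  assumes [measurable]: "f \<in> borel_measurable borel"
  shows "(\<lambda>\<omega>. LINT x:{x. \<bar>x\<bar> < c}|p \<omega>. f x) \<in> borel_measurable M"
  unfolding set_lebesgue_integral_def by (rule measurable_integral_p) measurable

lemma measurable_trunc_var [measurable]: "trunc_var p b \<tau> n \<in> borel_measurable M"
  unfolding trunc_var_def[abs_def] by measurable

lemma measurable_centred_mean [measurable]: "centred_mean \<tau> n \<in> borel_measurable M"
  unfolding centred_mean_def[abs_def] trunc_mean_def by measurable

lemma measurable_tail_mass [measurable]: "tail_mass \<epsilon> n \<in> borel_measurable M"
  unfolding tail_mass_def[abs_def] by measurable

lemma measurable_normed_sum [measurable]: "normed_sum n \<in> borel_measurable M"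
  unfolding normed_sum_def[abs_def] using X_meas by (intro borel_measurable_divide borel_measurable_diff borel_measurable_sum) auto

lemma trunc_var_nonneg:
  assumes "\<omega> \<in> space M"
  shows "0 \<le> trunc_var p b \<tau> n \<omega>"
proof -
  interpret P: real_distribution "p \<omega>" by (rule real_distribution_p[OF assms])
  let ?f = "\<lambda>x. indicator {x. \<bar>x\<bar> < \<tau> * b n} x * x :: real"
  have bnd: "\<bar>?f x\<bar> \<le> \<bar>\<tau> * b n\<bar>" for x by (auto simp: indicator_def)
  have f2: "(?f x)\<^sup>2 = indicator {x. \<bar>x\<bar> < \<tau> * b n} x * x\<^sup>2" for x by (simp add: indicator_def)
  have i: "integrable (p \<omega>) ?f" using bnd by (intro P.integrable_const_bound[where B = "\<bar>\<tau> * b n\<bar>"] AE_I2) auto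
  have i2: "integrable (p \<omega>) (\<lambda>x. (?f x)\<^sup>2)"
  proof (rule P.integrable_const_bound[where B = "\<bar>\<tau> * b n\<bar>\<^sup>2"])
    show "AE x in p \<omega>. norm ((?f x)\<^sup>2) \<le> \<bar>\<tau> * b n\<bar>\<^sup>2"
    proof (rule AE_I2)
      show "norm ((?f x)\<^sup>2) \<le> \<bar>\<tau> * b n\<bar>\<^sup>2" for x using power_mono[OF bnd[of x], of 2] by simp
    qed
  next
    show "(\<lambda>x. (?f x)\<^sup>2) \<in> borel_measurable (p \<omega>)"
      unfolding measurable_cong_sets[OF P.events_eq_borel refl] by measurable
  qed
  have "0 \<le> P.variance ?f" by (rule P.variance_positive)
  also have "\<dots> = P.expectation (\<lambda>x. (?f x)\<^sup>2) - (P.expectation ?f)\<^sup>2" by (rule P.variance_eq[OF i i2])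
  finally have "(P.expectation ?f)\<^sup>2 \<le> P.expectation (\<lambda>x. (?f x)\<^sup>2)" by simp
  then show ?thesis unfolding trunc_var_def set_lebesgue_integral_def f2 by simp
qed

lemma conv_in_law_iff_char:
  assumes [measurable]: "\<And>n. Z n \<in> borel_measurable M" and \<nu>: "real_distribution \<nu>"
  shows "conv_in_law M Z \<nu> \<longleftrightarrow> (\<forall>t. (\<lambda>n. CLINT \<omega>|M. iexp (t * Z n \<omega>)) \<longlonglongrightarrow> char \<nu> t)"
proof -
  have eq: "char (distr M borel (Z n)) t = (CLINT \<omega>|M. iexp (t * Z n \<omega>))" for n t
    unfolding char_def by (subst integral_distr) auto
  show ?thesis
  proof
    assume "conv_in_law M Z \<nu>"
    then show "\<forall>t. (\<lambda>n. CLINT \<omega>|M. iexp (t * Z n \<omega>)) \<longlonglongrightarrow> char \<nu> t"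
      unfolding conv_in_law_def eq[symmetric] using levy_continuity1[of "\<lambda>n. distr M borel (Z n)" \<nu>] by auto
  next
    assume "\<forall>t. (\<lambda>n. CLINT \<omega>|M. iexp (t * Z n \<omega>)) \<longlonglongrightarrow> char \<nu> t"
    then show "conv_in_law M Z \<nu>" unfolding conv_in_law_def eq[symmetric]
      using \<nu> by (intro conjI levy_continuity) auto
  qed
qed

lemma char_normed_sum:
  assumes n: "n \<ge> 1"
  shows "(CLINT \<omega>|M. iexp (t * normed_sum n \<omega>)) = (CLINT \<omega>|M. iexp (- (t * (a n / b n))) * char (p \<omega>) (t / b n) ^ n)"
proof -
  have "iexp (t * normed_sum n \<omega>) = iexp (- (t * (a n / b n))) * iexp (t / b n * (\<Sum>i=1..n. X i \<omega>))" for \<omega>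
    unfolding exp_add[symmetric] normed_sum_def using b_pos[OF n]
    by (intro arg_cong[where f = exp]) (simp add: field_simps)
  then have "(CLINT \<omega>|M. iexp (t * normed_sum n \<omega>)) = iexp (- (t * (a n / b n))) * (CLINT \<omega>|M. iexp (t / b n * (\<Sum>i=1..n. X i \<omega>)))"
    by (simp only: integral_mult_right_zero)
  also have "(CLINT \<omega>|M. iexp (t / b n * (\<Sum>i=1..n. X i \<omega>))) = (CLINT \<omega>|M. char (p \<omega>) (t / b n) ^ n)"
    by (rule char_sum_eq_expectation_power[OF prob_space_axioms X_meas directing n])
  finally show ?thesis by (simp only: integral_mult_right_zero)
qed

text \<open>
The uniform normal approximation applies outside the event that the scaled tail mass exceeds $\epsilon$. The
probability of this event tends to 0, and on it the integrands differ by at most 2.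
\<close>

lemma char_normed_sum_approx:
  assumes tails: "negligible_tails M p b" and \<tau>: "\<tau> > 0"
  shows "(\<lambda>n. (CLINT \<omega>|M. iexp (t * normed_sum n \<omega>)) - mix_char M (centred_mean \<tau> n) (trunc_var p b \<tau> n) t) \<longlonglongrightarrow> 0"
proof (rule LIMSEQ_I)
  fix e :: real assume e: "e > 0"
  then have e2: "e / 2 > 0" by simp
  obtain \<epsilon> where \<epsilon>: "\<epsilon> > 0" and ap: "\<And>P b n. real_distribution P \<Longrightarrow> b > 0 \<Longrightarrow> n \<ge> 1 \<Longrightarrow>
      real n * (measure P {..- (\<epsilon> * b)} + measure P {\<epsilon> * b<..}) \<le> \<epsilon> \<Longrightarrow>
      cmod (char P (t / b) ^ n - exp (\<i> * complex_of_real (t * trunc_mean (\<lambda>_. P) (\<lambda>_. b) \<tau> n ()) -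
        complex_of_real (t\<^sup>2 / 2 * trunc_var (\<lambda>_. P) (\<lambda>_. b) \<tau> n ()))) \<le> e / 2"
    using char_power_eq_normal_char_approx[OF \<tau> e2, of t] by blast
  have "(\<lambda>n. prob {\<omega>\<in>space M. \<bar>tail_mass \<epsilon> n \<omega> - 0\<bar> > \<epsilon>}) \<longlonglongrightarrow> 0"
    using tails \<epsilon> unfolding negligible_tails_def conv_in_prob_def tail_mass_def by blast
  then have "\<forall>\<^sub>F n in sequentially. prob {\<omega>\<in>space M. \<bar>tail_mass \<epsilon> n \<omega> - 0\<bar> > \<epsilon>} < e / 4"
    using e by (intro order_tendstoD(2)) auto
  then obtain N where N: "\<And>n. n \<ge> N \<Longrightarrow> prob {\<omega>\<in>space M. \<bar>tail_mass \<epsilon> n \<omega> - 0\<bar> > \<epsilon>} < e / 4"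
    by (auto simp: eventually_sequentially)
  show "\<exists>no. \<forall>n\<ge>no. norm ((CLINT \<omega>|M. iexp (t * normed_sum n \<omega>)) - mix_char M (centred_mean \<tau> n) (trunc_var p b \<tau> n) t - 0) < e"
  proof (intro exI[of _ "max 1 N"] allI impI)
    fix n assume "n \<ge> max 1 N"
    then have n: "n \<ge> 1" and nN: "n \<ge> N" by auto
    let ?A = "{\<omega>\<in>space M. \<bar>tail_mass \<epsilon> n \<omega> - 0\<bar> > \<epsilon>}"
    let ?f = "\<lambda>\<omega>. iexp (- (t * (a n / b n))) * char (p \<omega>) (t / b n) ^ n"
    let ?g = "\<lambda>\<omega>. exp (\<i> * complex_of_real (t * centred_mean \<tau> n \<omega>) - complex_of_real (t\<^sup>2 / 2 * trunc_var p b \<tau> n \<omega>))"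
    have A: "?A \<in> events" by measurable
    have char_le: "cmod (char (p \<omega>) s) \<le> 1" if "\<omega> \<in> space M" for \<omega> s
      using real_distribution.cmod_char_le_1[OF real_distribution_p[OF that]] .
    have [measurable]: "(\<lambda>\<omega>. char (p \<omega>) s) \<in> borel_measurable M" for s
      unfolding char_def by (rule measurable_integral_p) measurable
    have fle: "cmod (?f \<omega>) \<le> 1" if "\<omega> \<in> space M" for \<omega>
      using power_le_one[OF norm_ge_zero char_le[OF that]] by (simp add: norm_mult norm_power del: of_real_mult of_real_divide of_real_minus)
    have gle: "cmod (?g \<omega>) \<le> 1" if "\<omega> \<in> space M" for \<omega>
      using trunc_var_nonneg[OF that] by simp
    have fi: "complex_integrable M ?f" using fle by (intro integrable_const_bound[where B = 1] AE_I2) auto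
    have gi: "complex_integrable M ?g" using gle by (intro integrable_const_bound[where B = 1] AE_I2) auto
    have iA: "integrable M (indicat_real ?A)" using A by (intro integrable_real_indicator) (auto simp: less_top[symmetric])
    have "(CLINT \<omega>|M. iexp (t * normed_sum n \<omega>)) - mix_char M (centred_mean \<tau> n) (trunc_var p b \<tau> n) t = (CLINT \<omega>|M. ?f \<omega> - ?g \<omega>)"
      unfolding char_normed_sum[OF n] mix_char_def using fi gi by (rule Bochner_Integration.integral_diff[symmetric])
    then have "norm ((CLINT \<omega>|M. iexp (t * normed_sum n \<omega>)) - mix_char M (centred_mean \<tau> n) (trunc_var p b \<tau> n) t - 0)
      \<le> (\<integral>\<omega>. cmod (?f \<omega> - ?g \<omega>) \<partial>M)" by (simp only: diff_zero integral_norm_bound)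
    also have "\<dots> \<le> (\<integral>\<omega>. e / 2 + 2 * indicator ?A \<omega> \<partial>M)"
    proof (rule integral_mono)
      show "integrable M (\<lambda>\<omega>. cmod (?f \<omega> - ?g \<omega>))" using fi gi by (intro integrable_norm Bochner_Integration.integrable_diff)
      show "integrable M (\<lambda>\<omega>. e / 2 + 2 * indicat_real ?A \<omega>)" using iA by (intro Bochner_Integration.integrable_add integrable_mult_right) auto
      fix \<omega> assume \<omega>: "\<omega> \<in> space M"
      show "cmod (?f \<omega> - ?g \<omega>) \<le> e / 2 + 2 * indicat_real ?A \<omega>"
      proof (cases "\<omega> \<in> ?A")
        case True
        have "cmod (?f \<omega> - ?g \<omega>) \<le> cmod (?f \<omega>) + cmod (?g \<omega>)" by (rule norm_triangle_ineq4)
        then have "cmod (?f \<omega> - ?g \<omega>) \<le> 2" using fle[OF \<omega>] gle[OF \<omega>] by linarith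
        then show ?thesis using True e by simp
      next
        case False
        then have "tail_mass \<epsilon> n \<omega> \<le> \<epsilon>" using \<omega> by auto
        then have "cmod (char (p \<omega>) (t / b n) ^ n - exp (\<i> * complex_of_real (t * trunc_mean p b \<tau> n \<omega>) - complex_of_real (t\<^sup>2 / 2 * trunc_var p b \<tau> n \<omega>))) \<le> e / 2"
          unfolding trunc_mean_def trunc_var_def tail_mass_def by (rule ap[unfolded trunc_mean_def trunc_var_def, OF real_distribution_p[OF \<omega>] b_pos[OF n] n])
        moreover have "?g \<omega> = iexp (- (t * (a n / b n))) * exp (\<i> * complex_of_real (t * trunc_mean p b \<tau> n \<omega>) - complex_of_real (t\<^sup>2 / 2 * trunc_var p b \<tau> n \<omega>))"
          unfolding exp_add[symmetric] centred_mean_def by (rule arg_cong[where f = exp]) (simp add: algebra_simps)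
        ultimately have "cmod (?f \<omega> - ?g \<omega>) \<le> e / 2"
          by (simp only: right_diff_distrib[symmetric] norm_mult norm_exp_i_times mult_1)
        then show ?thesis using False by simp
      qed
    qed
    also have "\<dots> = e / 2 + 2 * prob ?A"
      using iA A by (subst Bochner_Integration.integral_add) (auto simp: prob_space Int_absorb1)
    also have "\<dots> < e" using N[OF nN] by simp
    finally show "norm ((CLINT \<omega>|M. iexp (t * normed_sum n \<omega>)) - mix_char M (centred_mean \<tau> n) (trunc_var p b \<tau> n) t - 0) < e" .
  qed
qed

text \<open>
The reduction of the problem to the two truncated moments.
\<close>

lemma normed_sum_conv_in_law_iff:
  assumes tails: "negligible_tails M p b" and \<tau>: "\<tau> > 0" and \<nu>: "real_distribution \<nu>"
  shows "conv_in_law M normed_sum \<nu> \<longleftrightarrow>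
    (\<forall>t. (\<lambda>n. mix_char M (centred_mean \<tau> n) (trunc_var p b \<tau> n) t) \<longlonglongrightarrow> char \<nu> t)"
  unfolding conv_in_law_iff_char[OF measurable_normed_sum \<nu>]
  using char_normed_sum_approx[OF tails \<tau>] by (auto intro: Lim_transform Lim_transform2)

text \<open>
Multiplying the mean at $m$ by $n b_m / (m b_n)$ replaces its prefactor by $n / b_n$, so that only the two truncation
levels differ; similarly for the variance. The deterministic centrings contribute the constant $d$.
\<close>

lemma truncated_moments_scaling:
  assumes n: "n \<ge> 1" and m: "m \<ge> 1" and le: "b m \<le> b n" and \<tau>: "\<tau> > 0"
  shows "\<exists>d. \<forall>\<omega>\<in>space M.
      \<bar>centred_mean \<tau> n \<omega> - (real n * b m / (real m * b n)) * centred_mean \<tau> m \<omega> - d\<bar>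
        \<le> real n / real m * \<bar>(\<tau> + 3 * \<tau>\<^sup>2) * tail_mass (\<tau> / 2) m \<omega>\<bar> \<and>
      \<bar>trunc_var p b \<tau> n \<omega> - (real n * (b m)\<^sup>2 / (real m * (b n)\<^sup>2)) * trunc_var p b \<tau> m \<omega>\<bar>
        \<le> real n / real m * \<bar>(\<tau> + 3 * \<tau>\<^sup>2) * tail_mass (\<tau> / 2) m \<omega>\<bar>"
proof (intro exI ballI)
  let ?A = "real n * b m / (real m * b n)"
  fix \<omega> assume \<omega>: "\<omega> \<in> space M"
  interpret P: real_distribution "p \<omega>" by (rule real_distribution_p[OF \<omega>])
  have bn: "b n > 0" and bm: "b m > 0" using b_pos n m by auto
  define r where "r = P.prob {x. \<tau> * b m \<le> \<bar>x\<bar>}"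
  have r0: "r \<ge> 0" by (simp add: r_def)
  have "r \<le> P.prob ({..- (\<tau> / 2 * b m)} \<union> {\<tau> / 2 * b m<..})" unfolding r_def
  proof (intro P.finite_measure_mono subsetI)
    fix x assume "x \<in> {x. \<tau> * b m \<le> \<bar>x\<bar>}"
    moreover have "\<tau> * b m > 0" using \<tau> bm by simp
    ultimately show "x \<in> {..- (\<tau> / 2 * b m)} \<union> {\<tau> / 2 * b m<..}" by (auto simp: abs_if split: if_splits)
  qed auto
  also have "\<dots> \<le> P.prob {..- (\<tau> / 2 * b m)} + P.prob {\<tau> / 2 * b m<..}" by (rule measure_Un_le) auto
  finally have rq: "real m * r \<le> tail_mass (\<tau> / 2) m \<omega>" unfolding tail_mass_def by (rule mult_left_mono) simp
  let ?q = "tail_mass (\<tau> / 2) m \<omega>"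
  have q0: "?q \<ge> 0" using rq r0 m by (meson mult_nonneg_nonneg of_nat_0_le_iff order_trans)
  have nr: "real n * r \<le> real n / real m * ?q" using rq n m by (simp add: field_simps mult_left_mono)
  have K: "\<tau> * (real n * r) \<le> real n / real m * \<bar>(\<tau> + 3 * \<tau>\<^sup>2) * ?q\<bar>" "3 * \<tau>\<^sup>2 * (real n * r) \<le> real n / real m * \<bar>(\<tau> + 3 * \<tau>\<^sup>2) * ?q\<bar>"
  proof -
    have "c * (real n * r) \<le> real n / real m * \<bar>(\<tau> + 3 * \<tau>\<^sup>2) * ?q\<bar>" if c: "0 \<le> c" "c \<le> \<tau> + 3 * \<tau>\<^sup>2" for c
    proof -
      have "c * (real n * r) \<le> (\<tau> + 3 * \<tau>\<^sup>2) * (real n / real m * ?q)"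
        using c nr r0 q0 \<tau> n by (intro mult_mono[OF c(2) nr]) auto
      also have "\<dots> = real n / real m * \<bar>(\<tau> + 3 * \<tau>\<^sup>2) * ?q\<bar>" using \<tau> q0 by simp
      finally show ?thesis .
    qed
    then show "\<tau> * (real n * r) \<le> real n / real m * \<bar>(\<tau> + 3 * \<tau>\<^sup>2) * ?q\<bar>" "3 * \<tau>\<^sup>2 * (real n * r) \<le> real n / real m * \<bar>(\<tau> + 3 * \<tau>\<^sup>2) * ?q\<bar>"
      using \<tau> by auto
  qed
  define \<mu> where "\<mu> B = (LINT x:{x. \<bar>x\<bar> < \<tau> * B}|p \<omega>. x)" for B
  define q2 where "q2 B = (LINT x:{x. \<bar>x\<bar> < \<tau> * B}|p \<omega>. x\<^sup>2)" for B
  have cmp: "\<bar>\<mu> (b n) - \<mu> (b m)\<bar> \<le> \<tau> * b n * r"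
    "\<bar>(q2 (b n) - (\<mu> (b n))\<^sup>2) - (q2 (b m) - (\<mu> (b m))\<^sup>2)\<bar> \<le> 3 * (\<tau> * b n)\<^sup>2 * r"
    unfolding \<mu>_def q2_def r_def by (rule P.truncated_moments_compare[OF \<tau> bm le])+
  have "centred_mean \<tau> n \<omega> - ?A * centred_mean \<tau> m \<omega> - (?A * (a m / b m) - a n / b n) = real n / b n * (\<mu> (b n) - \<mu> (b m))"
    unfolding centred_mean_def trunc_mean_def \<mu>_def[symmetric] using bn bm m by (simp add: field_simps)
  then have "\<bar>centred_mean \<tau> n \<omega> - ?A * centred_mean \<tau> m \<omega> - (?A * (a m / b m) - a n / b n)\<bar> = real n / b n * \<bar>\<mu> (b n) - \<mu> (b m)\<bar>"
    using bn by (simp only: abs_mult) simp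
  also have "\<dots> \<le> real n / b n * (\<tau> * b n * r)" using cmp(1) bn by (intro mult_left_mono) auto
  also have "\<dots> = \<tau> * (real n * r)" using bn by simp
  finally have 1: "\<bar>centred_mean \<tau> n \<omega> - ?A * centred_mean \<tau> m \<omega> - (?A * (a m / b m) - a n / b n)\<bar> \<le> \<tau> * (real n * r)" .
  let ?V = "\<lambda>B. q2 B - (\<mu> B)\<^sup>2"
  have "trunc_var p b \<tau> n \<omega> - (real n * (b m)\<^sup>2 / (real m * (b n)\<^sup>2)) * trunc_var p b \<tau> m \<omega> = real n / (b n)\<^sup>2 * (?V (b n) - ?V (b m))"
    unfolding trunc_var_def \<mu>_def[symmetric] q2_def[symmetric] using bn bm m by (simp add: field_simps)
  then have "\<bar>trunc_var p b \<tau> n \<omega> - (real n * (b m)\<^sup>2 / (real m * (b n)\<^sup>2)) * trunc_var p b \<tau> m \<omega>\<bar> = real n / (b n)\<^sup>2 * \<bar>?V (b n) - ?V (b m)\<bar>"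
    using bn by (simp only: abs_mult) simp
  also have "\<dots> \<le> real n / (b n)\<^sup>2 * (3 * (\<tau> * b n)\<^sup>2 * r)" using cmp(2) bn by (intro mult_left_mono) auto
  also have "\<dots> = 3 * \<tau>\<^sup>2 * (real n * r)" using bn by (simp add: power_mult_distrib)
  finally have 2: "\<bar>trunc_var p b \<tau> n \<omega> - (real n * (b m)\<^sup>2 / (real m * (b n)\<^sup>2)) * trunc_var p b \<tau> m \<omega>\<bar> \<le> 3 * \<tau>\<^sup>2 * (real n * r)" .
  show "\<bar>centred_mean \<tau> n \<omega> - (real n * b m / (real m * b n)) * centred_mean \<tau> m \<omega> - (?A * (a m / b m) - a n / b n)\<bar>
        \<le> real n / real m * \<bar>(\<tau> + 3 * \<tau>\<^sup>2) * tail_mass (\<tau> / 2) m \<omega>\<bar> \<and>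
      \<bar>trunc_var p b \<tau> n \<omega> - (real n * (b m)\<^sup>2 / (real m * (b n)\<^sup>2)) * trunc_var p b \<tau> m \<omega>\<bar>
        \<le> real n / real m * \<bar>(\<tau> + 3 * \<tau>\<^sup>2) * tail_mass (\<tau> / 2) m \<omega>\<bar>"
    using 1 2 K by linarith
qed

lemma scaling_family_truncated_moments:
  assumes tails: "negligible_tails M p b" and \<tau>: "\<tau> > 0" and \<nu>: "real_distribution \<nu>" "nondegenerate \<nu>"
    and lim: "conv_in_law M normed_sum \<nu>"
  shows "scaling_family M (centred_mean \<tau>) (trunc_var p b \<tau>) (\<lambda>m \<omega>. (\<tau> + 3 * \<tau>\<^sup>2) * tail_mass (\<tau> / 2) m \<omega>) b \<nu>"
proof (intro scaling_family.intro scaling_family_axioms.intro prob_space_axioms)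
  show "(\<lambda>n. prob_norm M (\<lambda>\<omega>. (\<tau> + 3 * \<tau>\<^sup>2) * tail_mass (\<tau> / 2) n \<omega>)) \<longlonglongrightarrow> 0"
  proof (rule prob_norm_mult_tendsto_0)
    have "conv_in_prob M (tail_mass (\<tau> / 2)) 0"
      using tails half_gt_zero[OF \<tau>] unfolding negligible_tails_def tail_mass_def[abs_def] by blast
    then show "(\<lambda>n. prob_norm M (tail_mass (\<tau> / 2) n)) \<longlonglongrightarrow> 0"
      by (simp add: conv_in_prob_iff_prob_norm)
  qed measurable
  show "(\<lambda>n. mix_char M (centred_mean \<tau> n) (trunc_var p b \<tau> n) t) \<longlonglongrightarrow> char \<nu> t" for t
    using lim unfolding normed_sum_conv_in_law_iff[OF tails \<tau> \<nu>(1)] by blast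
  show "\<exists>d. \<forall>\<omega>\<in>space M.
      \<bar>centred_mean \<tau> n \<omega> - (real n * b m / (real m * b n)) * centred_mean \<tau> m \<omega> - d\<bar>
        \<le> real n / real m * \<bar>(\<tau> + 3 * \<tau>\<^sup>2) * tail_mass (\<tau> / 2) m \<omega>\<bar> \<and>
      \<bar>trunc_var p b \<tau> n \<omega> - (real n * (b m)\<^sup>2 / (real m * (b n)\<^sup>2)) * trunc_var p b \<tau> m \<omega>\<bar>
        \<le> real n / real m * \<bar>(\<tau> + 3 * \<tau>\<^sup>2) * tail_mass (\<tau> / 2) m \<omega>\<bar>"
    if "n \<ge> 1" "m \<ge> 1" "b m \<le> b n" for n m
    using that by (rule truncated_moments_scaling[OF _ _ _ \<tau>])
  show "(\<lambda>\<omega>. (\<tau> + 3 * \<tau>\<^sup>2) * tail_mass (\<tau> / 2) n \<omega>) \<in> borel_measurable M" for n by measurable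
qed (fact measurable_centred_mean measurable_trunc_var trunc_var_nonneg b_pos \<nu>)+

end

section \<open>Random-variance and random-mean limits of normed sums\<close>

text \<open>
Both cases of the dichotomy use this, with $f(n) = n$ and with $f(n) = \sqrt n$.
\<close>

lemma slowly_varying_normalised:
  fixes b f :: "nat \<Rightarrow> real"
  assumes b: "\<And>n. n \<ge> 1 \<Longrightarrow> b n > 0" and f: "\<And>n. n \<ge> 1 \<Longrightarrow> f n > 0"
    and mult: "\<And>m n. f (m * n) = f m * f n"
    and ratio: "\<And>m. m \<ge> 1 \<Longrightarrow> (\<lambda>n. f m * b n / b (m * n)) \<longlonglongrightarrow> 1"
  shows "slowly_varying (\<lambda>n. b n / f n)"
  unfolding slowly_varying_def
proof (intro conjI allI impI)
  show "b n / f n > 0" if "n \<ge> 1" for n using b[OF that] f[OF that] by simp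
  fix m :: nat assume m: "m \<ge> 1"
  have "(\<lambda>n. inverse (f m * b n / b (m * n))) \<longlonglongrightarrow> inverse 1"
    by (intro tendsto_inverse ratio[OF m]) simp
  then have "(\<lambda>n. inverse (f m * b n / b (m * n))) \<longlonglongrightarrow> 1" by simp
  then show "(\<lambda>n. b (m * n) / f (m * n) / (b n / f n)) \<longlonglongrightarrow> 1"
  proof (rule Lim_transform_eventually)
    show "\<forall>\<^sub>F n in sequentially. inverse (f m * b n / b (m * n)) = b (m * n) / f (m * n) / (b n / f n)"
      using eventually_ge_at_top[of 1]
    proof eventually_elim
      case (elim n)
      then show ?case using f[OF elim] f[OF m] b[OF elim] by (simp add: mult field_simps)
    qed
  qed
qed

context mixed_iid
begin

lemma sums_conv_iff:
  "sums_conv_to_mixture M X a b \<nu> \<mu> \<longleftrightarrow> conv_in_law M normed_sum \<nu> \<and> nondegenerate \<nu> \<and>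
     mixing_measure \<mu> \<and> (\<forall>t. char \<nu> t = normal_mixture_char \<mu> t)"
  unfolding sums_conv_to_mixture_def normed_sum_def[abs_def] ..

lemma centred_mean_eq: "(\<lambda>n \<omega>. trunc_mean p b \<tau> n \<omega> - a n / b n) = centred_mean \<tau>"
  by (simp add: fun_eq_iff centred_mean_def)

lemma mix_char_no_variance: "mix_char M Z (\<lambda>_. 0) t = (CLINT \<omega>|M. iexp (t * Z \<omega>))"
  by (simp add: mix_char_def)

text \<open>
The dichotomy for the scaling family of the truncated moments, here at $\tau = 1$, decides between the two cases. The limit law
$\nu$ is kept, and a mixing measure of product form is read off from it.
\<close>

lemma limit_is_random_variance_or_random_mean:
  assumes tails: "negligible_tails M p b" and lim: "conv_in_law M normed_sum \<nu>" and nd: "nondegenerate \<nu>"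
  shows "(\<exists>\<gamma> \<rho>. random_variance_case M p a b \<gamma> \<rho> \<and> sums_conv_to_mixture M X a b \<nu> (return borel \<gamma> \<Otimes>\<^sub>M \<rho>)) \<or>
    (\<exists>\<rho>. random_mean_case M p a b \<rho> \<and> sums_conv_to_mixture M X a b \<nu> (\<rho> \<Otimes>\<^sub>M return borel 0))"
proof -
  have \<nu>: "real_distribution \<nu>" using lim by (simp add: conv_in_law_def)
  interpret S: scaling_family M "centred_mean 1" "trunc_var p b 1" "\<lambda>m \<omega>. (1 + 3 * 1\<^sup>2) * tail_mass (1 / 2) m \<omega>" b \<nu>
    by (rule scaling_family_truncated_moments[OF tails zero_less_one \<nu> nd lim])
  from S.var_vanishes_or_persists show ?thesis
  proof
    assume V0: "(\<lambda>n. prob_norm M (trunc_var p b 1 n)) \<longlonglongrightarrow> 0"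
    have "slowly_varying (\<lambda>n. b n / real n)"
      by (rule slowly_varying_normalised[OF b_pos]) (auto intro: S.norming_ratio_random_mean[OF V0])
    moreover have "conv_in_law M (centred_mean 1) \<nu>"
      unfolding conv_in_law_iff_char[OF measurable_centred_mean \<nu>] mix_char_no_variance[symmetric]
    proof
      fix t
      have "(\<lambda>n. mix_char M (centred_mean 1 n) (\<lambda>_. 0) t - mix_char M (centred_mean 1 n) (trunc_var p b 1 n) t) \<longlonglongrightarrow> 0"
        using V0 by (intro mix_char_diff_tendsto_0) (auto simp: trunc_var_nonneg prob_norm_def)
      from tendsto_add[OF this S.mix_char_lim[of t]]
      show "(\<lambda>n. mix_char M (centred_mean 1 n) (\<lambda>_. 0) t) \<longlonglongrightarrow> char \<nu> t" by simp
    qed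
    moreover have "conv_in_prob M (trunc_var p b 1) 0" using V0 by (simp add: conv_in_prob_iff_prob_norm)
    ultimately have "random_mean_case M p a b \<nu>"
      unfolding random_mean_case_def centred_mean_eq using nd
      by (intro conjI exI[of _ "1 :: real"] exI[of _ "\<lambda>n. b n / real n"]) auto
    moreover have "sums_conv_to_mixture M X a b \<nu> (\<nu> \<Otimes>\<^sub>M return borel 0)"
      unfolding sums_conv_iff using lim nd by (simp add: normal_mixture_char_random_mean[OF \<nu>])
    ultimately show ?thesis by blast
  next
    assume "\<exists>\<delta>>0. \<exists>N. \<forall>n\<ge>N. prob_norm M (trunc_var p b 1 n) > \<delta>"
    then obtain \<delta> N where "\<delta> > 0" "\<And>n. n \<ge> N \<Longrightarrow> prob_norm M (trunc_var p b 1 n) > \<delta>" by blast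
    then obtain c where c: "(\<lambda>n. prob_norm M (\<lambda>\<omega>. centred_mean 1 n \<omega> - c n)) \<longlonglongrightarrow> 0"
      by (rule S.mean_concentrates)
    obtain \<gamma> \<rho> where \<gamma>: "(\<lambda>n. prob_norm M (\<lambda>\<omega>. centred_mean 1 n \<omega> - \<gamma>)) \<longlonglongrightarrow> 0" and \<rho>: "real_distribution \<rho>"
      and w: "weak_conv_m (\<lambda>n. distr M borel (trunc_var p b 1 n)) \<rho>" and \<rho>0: "\<rho> \<noteq> return borel 0"
      and char: "\<And>t. char \<nu> t = iexp (t * \<gamma>) * complex_of_real (\<integral>x. exp (- (t\<^sup>2 / 2 * max 0 x)) \<partial>\<rho>)"
      by (rule S.random_variance_limit[OF c]) blast
    have nn: "AE x in \<rho>. 0 \<le> x" by (rule weak_limit_nonneg[OF measurable_trunc_var trunc_var_nonneg \<rho> w])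
    have "slowly_varying (\<lambda>n. b n / sqrt (real n))"
      by (rule slowly_varying_normalised[OF b_pos]) (auto simp: real_sqrt_mult intro: S.norming_ratio_random_variance[OF c])
    moreover have "conv_in_prob M (centred_mean 1) \<gamma>" using \<gamma> by (simp add: conv_in_prob_iff_prob_norm)
    moreover have "conv_in_law M (trunc_var p b 1) \<rho>" unfolding conv_in_law_def using \<rho> w by simp
    ultimately have "random_variance_case M p a b \<gamma> \<rho>"
      unfolding random_variance_case_def centred_mean_eq using \<rho>0
      by (intro conjI exI[of _ "1 :: real"] exI[of _ "\<lambda>n. b n / sqrt (real n)"]) auto
    moreover have "sums_conv_to_mixture M X a b \<nu> (return borel \<gamma> \<Otimes>\<^sub>M \<rho>)"
      unfolding sums_conv_iff using lim nd char by (simp only: normal_mixture_char_random_variance[OF \<rho> nn]) simp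
    ultimately show ?thesis by blast
  qed
qed

text \<open>
The limit law is realised as the law of $\gamma + \sqrt x\, Z$ with $x$ distributed according to $\rho$. If it were a
point mass, the Laplace transform of $\rho$ would be 1 at one positive argument, which forces $\rho = \delta_0$.
\<close>

lemma random_variance_case_imp_convergence:
  assumes case_A: "random_variance_case M p a b \<gamma> \<rho>" and tails: "negligible_tails M p b"
  shows "\<exists>\<nu>. sums_conv_to_mixture M X a b \<nu> (return borel \<gamma> \<Otimes>\<^sub>M \<rho>)"
proof -
  obtain \<tau> where \<tau>: "\<tau> > 0" and Y: "conv_in_prob M (centred_mean \<tau>) \<gamma>" and V: "conv_in_law M (trunc_var p b \<tau>) \<rho>"
    and \<rho>0: "\<rho> \<noteq> return borel 0"
    using case_A unfolding random_variance_case_def centred_mean_eq by blast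
  have \<rho>: "real_distribution \<rho>" and w: "weak_conv_m (\<lambda>n. distr M borel (trunc_var p b \<tau> n)) \<rho>"
    using V by (auto simp: conv_in_law_def)
  interpret \<rho>: real_distribution \<rho> by fact
  have nn: "AE x in \<rho>. 0 \<le> x" by (rule weak_limit_nonneg[OF measurable_trunc_var trunc_var_nonneg \<rho> w])
  let ?g = "\<lambda>t. \<integral>x. exp (- (t\<^sup>2 / 2 * max 0 x)) \<partial>\<rho>"
  define \<nu> where "\<nu> = normal_mixture_law \<rho> (\<lambda>_. \<gamma>) (\<lambda>x. max 0 x)"
  have \<nu>: "real_distribution \<nu>" unfolding \<nu>_def by (rule \<rho>.real_distribution_normal_mixture_law) auto
  have char: "char \<nu> t = iexp (t * \<gamma>) * complex_of_real (?g t)" for t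
  proof -
    have "char \<nu> t = mix_char \<rho> (\<lambda>_. 0 + \<gamma>) (\<lambda>x. max 0 x) t"
      unfolding \<nu>_def by (subst \<rho>.char_normal_mixture_law) auto
    then show ?thesis unfolding \<rho>.mix_char_shift mix_char_centred .
  qed
  have nd: "nondegenerate \<nu>" unfolding nondegenerate_def
  proof (intro allI notI)
    fix c assume "\<nu> = return borel c"
    then have "cmod (char \<nu> 1) = 1" by (simp add: char_return)
    then have "?g 1 = 1" unfolding char by (simp add: norm_mult Bochner_Integration.integral_nonneg)
    then have "prob_norm \<rho> (\<lambda>x. 1\<^sup>2 / 2 * max 0 x) \<le> 2 * (1 - 1)"
      using \<rho>.prob_norm_le_exp[of "\<lambda>x. 1\<^sup>2 / 2 * max 0 x"] by simp
    then have "prob_norm \<rho> (\<lambda>x. 1\<^sup>2 / 2 * max 0 x) = 0"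
      by (intro antisym \<rho>.prob_norm_nonneg) (simp only: diff_self mult_zero_right)
    moreover have "integrable \<rho> (\<lambda>x. min 1 \<bar>1\<^sup>2 / 2 * max 0 x\<bar>)" by (rule \<rho>.integrable_prob_norm) auto
    ultimately have "AE x in \<rho>. min 1 \<bar>1\<^sup>2 / 2 * max 0 x\<bar> = 0"
      unfolding prob_norm_def by (subst (asm) integral_nonneg_eq_0_iff_AE) auto
    then have "AE x in \<rho>. x = 0"
      using nn by eventually_elim (auto simp: min_def max_def split: if_splits)
    then show False using \<rho>0 AE_const_imp_eq_return[OF \<rho>] by blast
  qed
  have "conv_in_law M normed_sum \<nu>" unfolding normed_sum_conv_in_law_iff[OF tails \<tau> \<nu>]
  proof
    fix t
    have "(\<lambda>n. mix_char M (centred_mean \<tau> n) (trunc_var p b \<tau> n) t - mix_char M (\<lambda>_. 0 + \<gamma>) (trunc_var p b \<tau> n) t) \<longlonglongrightarrow> 0"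
      using Y by (intro mix_char_diff_tendsto_0) (auto simp: trunc_var_nonneg conv_in_prob_iff_prob_norm prob_norm_def)
    moreover have "(\<lambda>n. mix_char M (\<lambda>_. 0 + \<gamma>) (trunc_var p b \<tau> n) t) \<longlonglongrightarrow> char \<nu> t"
      unfolding mix_char_shift mix_char_centred char
      by (intro tendsto_mult tendsto_const tendsto_of_real weak_limit_laplace[OF measurable_trunc_var trunc_var_nonneg \<rho> w]) auto
    ultimately have "(\<lambda>n. (mix_char M (centred_mean \<tau> n) (trunc_var p b \<tau> n) t - mix_char M (\<lambda>_. 0 + \<gamma>) (trunc_var p b \<tau> n) t) +
        mix_char M (\<lambda>_. 0 + \<gamma>) (trunc_var p b \<tau> n) t) \<longlonglongrightarrow> 0 + char \<nu> t" by (rule tendsto_add)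
    then show "(\<lambda>n. mix_char M (centred_mean \<tau> n) (trunc_var p b \<tau> n) t) \<longlonglongrightarrow> char \<nu> t" by simp
  qed
  then have "sums_conv_to_mixture M X a b \<nu> (return borel \<gamma> \<Otimes>\<^sub>M \<rho>)"
    unfolding sums_conv_iff using nd char by (simp only: normal_mixture_char_random_variance[OF \<rho> nn]) simp
  then show ?thesis by blast
qed

text \<open>
Dropping the vanishing variance leaves the characteristic function of the truncated mean, so the limit law is $\rho$.
\<close>

lemma random_mean_case_imp_convergence:
  assumes case_B: "random_mean_case M p a b \<rho>" and tails: "negligible_tails M p b"
  shows "\<exists>\<nu>. sums_conv_to_mixture M X a b \<nu> (\<rho> \<Otimes>\<^sub>M return borel 0)"
proof -
  obtain \<tau> where \<tau>: "\<tau> > 0" and Y: "conv_in_law M (centred_mean \<tau>) \<rho>" and V: "conv_in_prob M (trunc_var p b \<tau>) 0"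
    and nd: "nondegenerate \<rho>"
    using case_B unfolding random_mean_case_def centred_mean_eq by blast
  have \<rho>: "real_distribution \<rho>" using Y by (simp add: conv_in_law_def)
  have "conv_in_law M normed_sum \<rho>" unfolding normed_sum_conv_in_law_iff[OF tails \<tau> \<rho>]
  proof
    fix t
    have "(\<lambda>n. mix_char M (centred_mean \<tau> n) (trunc_var p b \<tau> n) t - mix_char M (centred_mean \<tau> n) (\<lambda>_. 0) t) \<longlonglongrightarrow> 0"
      using V by (intro mix_char_diff_tendsto_0) (auto simp: trunc_var_nonneg conv_in_prob_iff_prob_norm prob_norm_def)
    moreover have "(\<lambda>n. mix_char M (centred_mean \<tau> n) (\<lambda>_. 0) t) \<longlonglongrightarrow> char \<rho> t"
      using Y unfolding conv_in_law_iff_char[OF measurable_centred_mean \<rho>] mix_char_no_variance by blast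
    ultimately have "(\<lambda>n. (mix_char M (centred_mean \<tau> n) (trunc_var p b \<tau> n) t - mix_char M (centred_mean \<tau> n) (\<lambda>_. 0) t) +
        mix_char M (centred_mean \<tau> n) (\<lambda>_. 0) t) \<longlonglongrightarrow> 0 + char \<rho> t" by (rule tendsto_add)
    then show "(\<lambda>n. mix_char M (centred_mean \<tau> n) (trunc_var p b \<tau> n) t) \<longlonglongrightarrow> char \<rho> t" by simp
  qed
  then have "sums_conv_to_mixture M X a b \<rho> (\<rho> \<Otimes>\<^sub>M return borel 0)"
    unfolding sums_conv_iff using nd by (simp add: normal_mixture_char_random_mean[OF \<rho>])
  then show ?thesis by blast
qed

end

theorem theorem9:
  fixes M :: "'a measure"
    and X :: "nat \<Rightarrow> 'a \<Rightarrow> real"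
    and p :: "'a \<Rightarrow> real measure"
    and a b :: "nat \<Rightarrow> real"
  assumes "prob_space M"
    and "\<And>n. n \<ge> 1 \<Longrightarrow> X n \<in> borel_measurable M"
    and "exchangeable M X"
    and "directing_measure M X p"
    and "\<And>n. n \<ge> 1 \<Longrightarrow> b n > 0"
    and "filterlim b at_top sequentially"
  shows
    "(\<forall>\<nu>. (\<exists>\<mu>\<^sub>1\<^sub>2. sums_conv_to_mixture M X a b \<nu> \<mu>\<^sub>1\<^sub>2) \<and> negligible_tails M p b \<longrightarrow>
        (\<exists>\<mu>\<^sub>1\<^sub>2. sums_conv_to_mixture M X a b \<nu> \<mu>\<^sub>1\<^sub>2 \<and>
          ((\<exists>\<gamma>\<^sub>0 \<rho>\<^sub>1. random_variance_case M p a b \<gamma>\<^sub>0 \<rho>\<^sub>1 \<and>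
                     \<mu>\<^sub>1\<^sub>2 = return borel \<gamma>\<^sub>0 \<Otimes>\<^sub>M \<rho>\<^sub>1) \<or>
           (\<exists>\<rho>\<^sub>2. random_mean_case M p a b \<rho>\<^sub>2 \<and>
                  \<mu>\<^sub>1\<^sub>2 = \<rho>\<^sub>2 \<Otimes>\<^sub>M return borel 0)))) \<and>
     (\<forall>\<gamma>\<^sub>0 \<rho>\<^sub>1. random_variance_case M p a b \<gamma>\<^sub>0 \<rho>\<^sub>1 \<and> negligible_tails M p b \<longrightarrow>
        (\<exists>\<nu> \<mu>\<^sub>1\<^sub>2. sums_conv_to_mixture M X a b \<nu> \<mu>\<^sub>1\<^sub>2 \<and>
                 \<mu>\<^sub>1\<^sub>2 = return borel \<gamma>\<^sub>0 \<Otimes>\<^sub>M \<rho>\<^sub>1)) \<and>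
     (\<forall>\<rho>\<^sub>2. random_mean_case M p a b \<rho>\<^sub>2 \<and> negligible_tails M p b \<longrightarrow>
        (\<exists>\<nu> \<mu>\<^sub>1\<^sub>2. sums_conv_to_mixture M X a b \<nu> \<mu>\<^sub>1\<^sub>2 \<and>
                 \<mu>\<^sub>1\<^sub>2 = \<rho>\<^sub>2 \<Otimes>\<^sub>M return borel 0))"
proof -
  interpret mixed_iid M X p a b
    by (intro mixed_iid.intro mixed_iid_axioms.intro) (fact assms)+
  show ?thesis
  proof (intro conjI allI impI)
    fix \<nu>
    assume *: "(\<exists>\<mu>. sums_conv_to_mixture M X a b \<nu> \<mu>) \<and> negligible_tails M p b"
    then have "conv_in_law M normed_sum \<nu>" "nondegenerate \<nu>" by (auto simp: sums_conv_iff)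
    with * show "\<exists>\<mu>. sums_conv_to_mixture M X a b \<nu> \<mu> \<and>
          ((\<exists>\<gamma> \<rho>. random_variance_case M p a b \<gamma> \<rho> \<and> \<mu> = return borel \<gamma> \<Otimes>\<^sub>M \<rho>) \<or>
           (\<exists>\<rho>. random_mean_case M p a b \<rho> \<and> \<mu> = \<rho> \<Otimes>\<^sub>M return borel 0))"
      using limit_is_random_variance_or_random_mean by blast
  next
    fix \<gamma> \<rho>
    assume "random_variance_case M p a b \<gamma> \<rho> \<and> negligible_tails M p b"
    then show "\<exists>\<nu> \<mu>. sums_conv_to_mixture M X a b \<nu> \<mu> \<and> \<mu> = return borel \<gamma> \<Otimes>\<^sub>M \<rho>"
      using random_variance_case_imp_convergence by blast
  next
    fix \<rho>
    assume "random_mean_case M p a b \<rho> \<and> negligible_tails M p b"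
    then show "\<exists>\<nu> \<mu>. sums_conv_to_mixture M X a b \<nu> \<mu> \<and> \<mu> = \<rho> \<Otimes>\<^sub>M return borel 0"
      using random_mean_case_imp_convergence by blast
  qed
qed

end
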